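(* Let $s\ge t\ge 2$ be integers and let $\Gamma$ be a graph. Then $\Gamma$ is a strongly regular graph with parameters $((ts+1)(s+1),(t+1)s,s-1,t+1)$ having a regular point if and only if $\Gamma$ is (isomorphic to) $\Gamma(\mathcal{H},\mathcal{I},\phi)$ for some $\mathcal{H},\mathcal{I},\phi$ such that (i) $\mathcal{H}$ is an association scheme with eigenmatrix $P$ (given in the context); (ii) $\mathcal{I}$ is a $(t+1)$-net of order $s$; (iii) $\phi$ is an isomorphism from the quotient graph $\hat{B}$ of $\mathcal{H}$ to the collinearity graph of $\mathcal{I}$.
   Context: All graphs are finite, simple and undirected. A strongly regular graph with parameters $(\nu,k,\lambda,\mu)$ is a $k$-regular graph on $\nu$ vertices in which any two adjacent vertices have exactly $\lambda$ common neighbours and any two distinct non-adjacent vertices have exactly $\mu$ common neighbours. For a vertex $v$ of $\Gamma$, $\Gamma_i(v)$ denotes the graph induced on the set of vertices at distance $i$ from $v$ ($\Gamma_2(v)$ is the second subconstituent). Eigenmatrix. Let $s\ge t\ge 2$. "An association scheme with eigenmatrix $P$" means a symmetric association scheme with relations (adjacency matrices) ordered $I,B=B_1,B_2,B_3,B_4$ whose first eigenmatrix (columns indexed by the relations in this order, rows by the common eigenspaces in some order) is $$P=\begin{bmatrix} 1 & (s-1)(t+1) & (s-1)(t^2-1) & t-1 & (s-1)t(s-t)\\ 1 &s-1 & 1-s &-1 & 0\\ 1 &s-t-1 & (t-1)(s-t-1) &t-1 & -t(s-t)\\ 1 &-t-1 & t+1 &-1 & 0\\ 1 &-t-1 & 1-t^2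 &t-1 & t^2 \end{bmatrix}.$$ If $s>t$ it is a $4$-class scheme. In the degenerate case $s=t$ the relation $B_4$ is empty and the last row and column of $P$ are omitted, so that it is a $3$-class scheme. In such a scheme $I+B_3$ is an equivalence relation; its classes (there are $s^2$ of them, each of size $t$) are called the fibres. The quotient graph $\hat{B}$ has the fibres as vertices, two distinct fibres being adjacent if some vertex of one is in relation $B$ to some vertex of the other. Regular point. A vertex $v$ of a strongly regular graph $\Gamma$ with parameters $((s+1)(st+1),s(t+1),s-1,t+1)$ is a regular point if the graph $\Gamma_2(v)$ generates (i.e. the smallest association scheme on its vertex set containing its adjacency matrix is) an association scheme with eigenmatrix $P$, in which the adjacency matrix of $\Gamma_2(v)$ is the first relation $B$. Net. A $(t+1)$-net of order $s$ is an incidence structure with a set $\mathcal{P}$ of $s^2$ points and a set $\mathcal{L}$ of $(t+1)s$ blocks, where the blocks are partitioned into $t+1$ parallel classes of $s$ blocks each, each block is incident with $s$ points, the blocks of a parallel class partition the point set, and two blocks from different parallel classes share exactly one point. (If $s=t$ this is an affine plane of order $s$.) Two blocks are parallel if they are in the same parallel class. The collinearity graph of the net has the points as vertices, two distinct points being adjacent if some block is incident with both. The graph $\Gamma(\mathcal{H},\mathcal{I},\phi)$. Given a scheme $\mathcal{H}$ with eigenmatrix $P$ on vertex set $V(\mathcal{H})$, a $(t+1)$-net $\mathcal{I}$ of order $s$ with point set $\mathcal{P}$ and block set $\mathcal{L}$, and a bijection $\phi$ from the fibres of $\mathcal{H}$ to $\mathcal{P}$, the graph $\Gamma(\mathcal{H},\mathcal{I},\phi)$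 has vertex set $\{v\}\cup\mathcal{L}\cup V(\mathcal{H})$ (disjoint union, $v$ a new vertex), with adjacencies: $v$ is adjacent to all blocks in $\mathcal{L}$ and to nothing else; two distinct blocks are adjacent if they are parallel; a block $\ell\in\mathcal{L}$ is adjacent to a vertex of $V(\mathcal{H})$ lying in the fibre $W$ if and only if $\phi(W)$ is incident with $\ell$; two vertices of $V(\mathcal{H})$ are adjacent if they are in the first relation $B$ of $\mathcal{H}$. *)

theory Defs
  imports
    "Graph_Theory.Pair_Digraph"
    "Graph_Theory.Shortest_Path"
    "HOL-Library.Disjoint_Sets"
    "HOL-Library.Infinite_Typeclass"
begin

section \<open>Graphs\<close>

text \<open>
  Finite simple undirected graphs are the values of type \<^typ>\<open>'a pair_pre_digraph\<close> that satisfy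
  the locale predicate \<^const>\<open>pair_graph\<close>: an undirected edge is a pair of opposite arcs.
\<close>

definition neighbours :: "'a pair_pre_digraph \<Rightarrow> 'a \<Rightarrow> 'a set" where
  "neighbours G u = {w \<in> pverts G. (u, w) \<in> parcs G}"

definition strongly_regular :: "'a pair_pre_digraph \<Rightarrow> nat \<Rightarrow> nat \<Rightarrow> nat \<Rightarrow> nat \<Rightarrow> bool" where
  "strongly_regular G n k l m \<longleftrightarrow>
     pair_graph G \<and> card (pverts G) = n \<and>
     (\<forall>u \<in> pverts G. card (neighbours G u) = k) \<and>
     (\<forall>u \<in> pverts G. \<forall>w \<in> pverts G. (u, w) \<in> parcs G \<longrightarrow>
        card (neighbours G u \<inter> neighbours G w) = l) \<and>
     (\<forall>u \<in> pverts G. \<forall>w \<in> pverts G. u \<noteq> w \<and> (u, w) \<notin> parcs G \<longrightarrow>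
        card (neighbours G u \<inter> neighbours G w) = m)"

definition pair_induced :: "'a pair_pre_digraph \<Rightarrow> 'a set \<Rightarrow> 'a pair_pre_digraph" where
  "pair_induced G S = \<lparr>pverts = S, parcs = parcs G \<inter> S \<times> S\<rparr>"

text \<open>
  The graph distance is the library's \<^const>\<open>wf_digraph.\<mu>\<close> (least cost of a walk, infinite
  if there is none) for the cost function that is constantly 1.
\<close>

definition subconstituent :: "'a pair_pre_digraph \<Rightarrow> nat \<Rightarrow> 'a \<Rightarrow> 'a pair_pre_digraph" where
  "subconstituent G i v =
     pair_induced G {u \<in> pverts G. wf_digraph.\<mu> (with_proj G) (\<lambda>_. 1) v u = ereal (real i)}"

definition graph_isomorphism ::
  "('a \<Rightarrow> 'b) \<Rightarrow> 'a pair_pre_digraph \<Rightarrow> 'b pair_pre_digraph \<Rightarrow> bool" where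
  "graph_isomorphism f G G' \<longleftrightarrow>
     bij_betw f (pverts G) (pverts G') \<and>
     (\<forall>u \<in> pverts G. \<forall>w \<in> pverts G. (u, w) \<in> parcs G \<longleftrightarrow> (f u, f w) \<in> parcs G')"


section \<open>Symmetric association schemes\<close>

text \<open>Only the relations \<open>scheme_rel H i\<close> with \<open>i \<le> num_classes H\<close> are part of the scheme.\<close>

record 'a scheme =
  scheme_pts :: "'a set"
  num_classes :: nat
  scheme_rel :: "nat \<Rightarrow> ('a \<times> 'a) set"

definition assoc_scheme :: "'a scheme \<Rightarrow> bool" where
  "assoc_scheme H \<longleftrightarrow>
     (let X = scheme_pts H; d = num_classes H; R = scheme_rel H in
       finite X \<and> X \<noteq> {} \<and>
       R 0 = Id_on X \<and>
       (\<forall>i\<le>d. R i \<noteq> {} \<and> sym (R i)) \<and>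
       disjoint_family_on R {..d} \<and>
       (\<Union>i\<le>d. R i) = X \<times> X \<and>
       (\<exists>p. \<forall>i\<le>d. \<forall>j\<le>d. \<forall>k\<le>d. \<forall>(x, y) \<in> R k.
          card {z \<in> X. (x, z) \<in> R i \<and> (z, y) \<in> R j} = p i j k))"

definition adj_matrix :: "('a \<times> 'a) set \<Rightarrow> 'a \<Rightarrow> 'a \<Rightarrow> real" where
  "adj_matrix R u w = (if (u, w) \<in> R then 1 else 0)"

text \<open>
  Real vectors indexed by the vertices are functions that vanish outside the vertex set.  The
  common eigenspaces are the maximal nonzero spaces on which every adjacency matrix is a scalar;
  since the matrices are symmetric, real scalars suffice.  Only the first
  \<open>num_classes H + 1\<close> entries of \<open>\<theta>\<close> matter.
\<close>

definition common_eigenspace :: "'a scheme \<Rightarrow> (nat \<Rightarrow> real) \<Rightarrow> ('a \<Rightarrow> real) set" where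
  "common_eigenspace H \<theta> =
     {x. (\<forall>u. u \<notin> scheme_pts H \<longrightarrow> x u = 0) \<and>
         (\<forall>j\<le>num_classes H. \<forall>u \<in> scheme_pts H.
            (\<Sum>w \<in> scheme_pts H. adj_matrix (scheme_rel H j) u w * x w) = \<theta> j * x u)}"

definition common_eigenspaces :: "'a scheme \<Rightarrow> ('a \<Rightarrow> real) set set" where
  "common_eigenspaces H =
     {common_eigenspace H \<theta> | \<theta>. common_eigenspace H \<theta> \<noteq> {\<lambda>_. 0}}"

text \<open>
  Row \<open>i\<close> of \<open>P\<close> lists the eigenvalues of the adjacency matrices on one common eigenspace, and the
  rows correspond bijectively to the common eigenspaces.
\<close>

definition first_eigenmatrix :: "'a scheme \<Rightarrow> (nat \<Rightarrow> nat \<Rightarrow> real) \<Rightarrow> bool" where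
  "first_eigenmatrix H P \<longleftrightarrow>
     bij_betw (\<lambda>i. common_eigenspace H (P i)) {..num_classes H} (common_eigenspaces H)"

definition matrix_P :: "nat \<Rightarrow> nat \<Rightarrow> nat \<Rightarrow> nat \<Rightarrow> real" where
  "matrix_P m n i j = (let s = real m; t = real n in
     [[1, (s-1)*(t+1), (s-1)*(t^2-1),  t-1, (s-1)*t*(s-t)],
      [1, s-1,         1-s,            -1,  0            ],
      [1, s-t-1,       (t-1)*(s-t-1),  t-1, -t*(s-t)     ],
      [1, -t-1,        t+1,            -1,  0            ],
      [1, -t-1,        1-t^2,          t-1, t^2          ]] ! i ! j)"

text \<open>
  For \<open>s = t\<close> the scheme has only 3 classes, so that \<^const>\<open>first_eigenmatrix\<close> does
  not see the last row and column of \<^const>\<open>matrix_P\<close>.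
\<close>

definition scheme_with_eigenmatrix_P :: "nat \<Rightarrow> nat \<Rightarrow> 'a scheme \<Rightarrow> bool" where
  "scheme_with_eigenmatrix_P s t H \<longleftrightarrow>
     assoc_scheme H \<and> num_classes H = (if s = t then 3 else 4) \<and>
     first_eigenmatrix H (matrix_P s t)"

text \<open>
  The 0/1 matrix of \<open>E\<close> lies in the algebra spanned by the adjacency matrices of \<open>H\<close> iff \<open>E\<close> is a
  union of relations of \<open>H\<close>.
\<close>

definition scheme_contains :: "'a scheme \<Rightarrow> ('a \<times> 'a) set \<Rightarrow> bool" where
  "scheme_contains H E \<longleftrightarrow> (\<exists>J \<subseteq> {..num_classes H}. E = (\<Union>j \<in> J. scheme_rel H j))"

definition generates_scheme :: "'a pair_pre_digraph \<Rightarrow> 'a scheme \<Rightarrow> bool" where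
  "generates_scheme G H \<longleftrightarrow>
     assoc_scheme H \<and> scheme_pts H = pverts G \<and> scheme_contains H (parcs G) \<and>
     (\<forall>H' :: 'a scheme.
        assoc_scheme H' \<and> scheme_pts H' = pverts G \<and> scheme_contains H' (parcs G) \<longrightarrow>
        (\<forall>i\<le>num_classes H. scheme_contains H' (scheme_rel H i)))"

text \<open>To be used for strongly regular graphs with parameters
  \<open>((s + 1) * (s * t + 1), s * (t + 1), s - 1, t + 1)\<close>.\<close>

definition regular_point :: "nat \<Rightarrow> nat \<Rightarrow> 'a pair_pre_digraph \<Rightarrow> 'a \<Rightarrow> bool" where
  "regular_point s t G v \<longleftrightarrow>
     v \<in> pverts G \<and>
     (\<exists>H. generates_scheme (subconstituent G 2 v) H \<and> scheme_with_eigenmatrix_P s t H \<and>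
          scheme_rel H 1 = parcs (subconstituent G 2 v))"

definition fibres :: "'a scheme \<Rightarrow> 'a set set" where
  "fibres H = scheme_pts H // (scheme_rel H 0 \<union> scheme_rel H 3)"

definition quotient_graph :: "'a scheme \<Rightarrow> 'a set pair_pre_digraph" where
  "quotient_graph H =
     \<lparr>pverts = fibres H,
      parcs = {(W, W'). W \<in> fibres H \<and> W' \<in> fibres H \<and> W \<noteq> W' \<and>
                        (\<exists>x \<in> W. \<exists>y \<in> W'. (x, y) \<in> scheme_rel H 1)}\<rparr>"


section \<open>Nets\<close>

record ('p, 'l) net_structure =
  points :: "'p set"
  blocks :: "'l set"
  incid :: "('p \<times> 'l) set"
  par_classes :: "'l set set"

text \<open>\<open>net k n\<close>: a \<open>k\<close>-net of order \<open>n\<close>.\<close>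

definition net :: "nat \<Rightarrow> nat \<Rightarrow> ('p, 'l) net_structure \<Rightarrow> bool" where
  "net k n I \<longleftrightarrow>
     finite (points I) \<and> card (points I) = n^2 \<and>
     finite (blocks I) \<and> card (blocks I) = k * n \<and>
     incid I \<subseteq> points I \<times> blocks I \<and>
     partition_on (blocks I) (par_classes I) \<and> card (par_classes I) = k \<and>
     (\<forall>C \<in> par_classes I. card C = n) \<and>
     (\<forall>l \<in> blocks I. card {p \<in> points I. (p, l) \<in> incid I} = n) \<and>
     (\<forall>C \<in> par_classes I. \<forall>p \<in> points I. \<exists>!l. l \<in> C \<and> (p, l) \<in> incid I) \<and>
     (\<forall>C \<in> par_classes I. \<forall>D \<in> par_classes I. C \<noteq> D \<longrightarrow>
        (\<forall>l \<in> C. \<forall>m \<in> D. card {p \<in> points I. (p, l) \<in> incid I \<and> (p, m) \<in> incid I} = 1))"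

definition parallel :: "('p, 'l) net_structure \<Rightarrow> 'l \<Rightarrow> 'l \<Rightarrow> bool" where
  "parallel I l m \<longleftrightarrow> (\<exists>C \<in> par_classes I. l \<in> C \<and> m \<in> C)"

definition collinearity_graph :: "('p, 'l) net_structure \<Rightarrow> 'p pair_pre_digraph" where
  "collinearity_graph I =
     \<lparr>pverts = points I,
      parcs = {(p, q). p \<in> points I \<and> q \<in> points I \<and> p \<noteq> q \<and>
                       (\<exists>l \<in> blocks I. (p, l) \<in> incid I \<and> (q, l) \<in> incid I)}\<rparr>"


section \<open>The graph built from a scheme, a net and a bijection\<close>

datatype ('l, 'h) gvertex = Apex | Block 'l | SVertex 'h

definition glued_graph ::
  "'h scheme \<Rightarrow> ('p, 'l) net_structure \<Rightarrow> ('h set \<Rightarrow> 'p) \<Rightarrow> ('l, 'h) gvertex pair_pre_digraph"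
where
  "glued_graph H I \<phi> =
     (let E = {(Apex, Block l) | l. l \<in> blocks I}
            \<union> {(Block l, Block m) | l m. l \<in> blocks I \<and> m \<in> blocks I \<and> l \<noteq> m \<and> parallel I l m}
            \<union> {(Block l, SVertex x) | l x W.
                 l \<in> blocks I \<and> W \<in> fibres H \<and> x \<in> W \<and> (\<phi> W, l) \<in> incid I}
            \<union> {(SVertex x, SVertex y) | x y. (x, y) \<in> scheme_rel H 1}
      in \<lparr>pverts = {Apex} \<union> Block ` blocks I \<union> SVertex ` scheme_pts H, parcs = E \<union> E\<inverse>\<rparr>)"

end

theory Submission
  imports Defs
begin

text \<open>
  Write \<open>A\<^sub>0, \<dots>, A\<^sub>d\<close> for the adjacency matrices of a scheme and
  \<open>p\<^sub>i\<^sub>j(k)\<close> for its intersection numbers.  On the \<open>r\<close>-th common eigenspace the product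
  \<open>A\<^sub>i A\<^sub>j\<close> is the scalar \<open>P r i * P r j\<close>, and also the scalar
  \<open>\<Sum>k. p\<^sub>i\<^sub>j(k) * P r k\<close>.  As the given matrix \<open>P\<close> is invertible, these equations
  determine all intersection numbers (\<open>intersection_number\<close>).  In terms of the first relation \<open>B\<close>
  and of the fibres they say the following (locale \<open>fibred_graph\<close>).  A fibre has \<open>t\<close> vertices and
  no edge; a vertex has at most one neighbour in another fibre, and it has one as soon as there is any
  edge between the two fibres (which are then called linked); two distinct vertices have \<open>0\<close>, \<open>s - 2\<close>,
  \<open>t\<close> or \<open>t + 1\<close> common neighbours if they are, respectively, in the same fibre, adjacent,
  non-adjacent in linked fibres, or in distinct fibres that are not linked.

  \<^emph>\<open>From a regular point to a net.\<close>  Let \<open>D\<close> be the set of neighbours of the regular point \<open>v\<close>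
  and \<open>X\<close> the set of vertices at distance 2.  Two distinct vertices of \<open>X\<close> have \<open>s - 1\<close> or
  \<open>t + 1\<close> common neighbours altogether; subtracting those in \<open>X\<close> leaves \<open>t + 1\<close>,
  \<open>1\<close>, \<open>1\<close>, \<open>0\<close> common neighbours in \<open>D\<close> in the four cases.  So vertices
  of one fibre see the same part of \<open>D\<close>, and with fibres as points and \<open>D\<close> as blocks, two
  distinct points are on a common block, and then on exactly one, iff their fibres are linked.

  The crucial step (\<open>blocks_of_point_nonadjacent\<close>) is that two blocks through the same point are not
  adjacent in the graph.  Fix \<open>x\<close> in \<open>X\<close>.  With each of its \<open>t + 1\<close> neighbours \<open>d\<close>
  in \<open>D\<close> it has \<open>s - 1\<close> common neighbours, and the sum over \<open>d\<close> of the number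
  of those that lie in \<open>X\<close> is \<open>(s - 1) * (t + 1)\<close>, because each of the
  \<open>(s - 1) * (t + 1)\<close> neighbours of \<open>x\<close> in \<open>X\<close> shares exactly one block with
  \<open>x\<close>.  Hence none lies in \<open>D\<close>.  Consequently adjacent blocks have no common neighbour in
  \<open>X\<close>, the neighbours of a block in \<open>D\<close> form a clique, and \<open>D\<close> is a disjoint union of
  \<open>t + 1\<close> cliques of size \<open>s\<close>: the parallel classes.  The \<open>t + 1\<close> blocks through a
  point are pairwise non-adjacent and therefore meet every class once; two blocks of different classes have
  \<open>t\<close> common neighbours in \<open>X\<close>, which is one fibre.

  \<^emph>\<open>From a net to a regular point.\<close>  All counts in the glued graph follow directly from the numbers
  above and the axioms of a net, except for the number of neighbours of \<open>x\<close> that lie over a block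
  \<open>l\<close>.  Since \<open>x\<close> has one neighbour in each linked fibre, that is the number of points of
  \<open>l\<close> other than the point of \<open>x\<close> and collinear with it, namely \<open>s - 1\<close> or \<open>t\<close>
  (\<open>card_neighbours_over\<close>).  The second subconstituent of the apex is the graph \<open>B\<close>, and \<open>B\<close> generates
  its scheme: the numbers of common neighbours \<open>t\<close>, \<open>0\<close>, \<open>t + 1\<close> on the
  relations other than equality and \<open>B\<close> are distinct, so every scheme that contains \<open>B\<close> separates these relations
  (\<open>scheme_generated_by_first_relation\<close>).

  Finally, schemes, nets and glued graphs are carried along injections, both to reach the prescribed infinite
  types and to place the scheme on the vertices of the given graph.
\<close>

section \<open>Intersection numbers from the eigenmatrix\<close>

lemma assoc_schemeD:
  assumes "assoc_scheme H"
  shows assoc_scheme_finite: "finite (scheme_pts H)"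
    and assoc_scheme_nonempty: "scheme_pts H \<noteq> {}"
    and assoc_scheme_diagonal: "scheme_rel H 0 = Id_on (scheme_pts H)"
    and assoc_scheme_sym: "\<And>i. i \<le> num_classes H \<Longrightarrow> sym (scheme_rel H i)"
    and assoc_scheme_inhabited: "\<And>i. i \<le> num_classes H \<Longrightarrow> scheme_rel H i \<noteq> {}"
    and assoc_scheme_disjoint: "\<And>i j e. i \<le> num_classes H \<Longrightarrow> j \<le> num_classes H \<Longrightarrow>
          e \<in> scheme_rel H i \<Longrightarrow> e \<in> scheme_rel H j \<Longrightarrow> i = j"
    and assoc_scheme_cover: "(\<Union>i\<le>num_classes H. scheme_rel H i) = scheme_pts H \<times> scheme_pts H"
    and assoc_scheme_subset: "\<And>i. i \<le> num_classes H \<Longrightarrow>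
          scheme_rel H i \<subseteq> scheme_pts H \<times> scheme_pts H"
    and assoc_scheme_intersection_numbers: "\<exists>p. \<forall>i\<le>num_classes H. \<forall>j\<le>num_classes H.
          \<forall>k\<le>num_classes H. \<forall>(x, y) \<in> scheme_rel H k.
            card {z \<in> scheme_pts H. (x, z) \<in> scheme_rel H i \<and> (z, y) \<in> scheme_rel H j} = p i j k"
  using assms unfolding assoc_scheme_def Let_def disjoint_family_on_def by blast+

lemma scheme_rel_unique:
  assumes "assoc_scheme H" "k \<le> num_classes H" "m \<le> num_classes H" "e \<in> scheme_rel H k"
  shows "e \<in> scheme_rel H m \<longleftrightarrow> k = m"
  using assoc_scheme_disjoint[OF assms(1-3), of e] assms(4) by blast

text \<open>
  Apply \<open>A\<^sub>i A\<^sub>j = (\<Sum>k. p k * A\<^sub>k)\<close> to a common eigenvector with eigenvalues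
  \<open>P r\<close>; such a vector exists because the rows of \<open>P\<close> belong to nonzero eigenspaces.
\<close>

lemma eigenmatrix_product:
  fixes P :: "nat \<Rightarrow> nat \<Rightarrow> real"
  assumes H: "assoc_scheme H" and P: "first_eigenmatrix H P"
    and p: "\<And>k x y. k \<le> num_classes H \<Longrightarrow> (x, y) \<in> scheme_rel H k \<Longrightarrow>
        card {z \<in> scheme_pts H. (x, z) \<in> scheme_rel H i \<and> (z, y) \<in> scheme_rel H j} = p k"
    and r: "r \<le> num_classes H" and i: "i \<le> num_classes H" and j: "j \<le> num_classes H"
  shows "(\<Sum>k\<le>num_classes H. real (p k) * P r k) = P r i * P r j"
proof -
  let ?X = "scheme_pts H" and ?d = "num_classes H" and ?a = "\<lambda>k. adj_matrix (scheme_rel H k)"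
  have "common_eigenspace H (P r) \<in> common_eigenspaces H"
    using P r unfolding first_eigenmatrix_def by (auto dest: bij_betwE)
  then have "common_eigenspace H (P r) \<noteq> {\<lambda>_. 0}"
    by (auto simp: common_eigenspaces_def)
  moreover have "(\<lambda>_. 0) \<in> common_eigenspace H (P r)"
    by (simp add: common_eigenspace_def)
  ultimately obtain x where x: "x \<in> common_eigenspace H (P r)" and "x \<noteq> (\<lambda>_. 0)" by blast
  then obtain u where u: "x u \<noteq> 0" by auto
  have uX: "u \<in> ?X" using x u by (auto simp: common_eigenspace_def)
  have fin: "finite ?X" using assoc_scheme_finite[OF H] .
  have eig: "(\<Sum>w\<in>?X. ?a k v w * x w) = P r k * x v" if "k \<le> ?d" "v \<in> ?X" for k v
    using x that by (auto simp: common_eigenspace_def)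
  have entry: "(\<Sum>z\<in>?X. ?a i u z * ?a j z w) = (\<Sum>k\<le>?d. real (p k) * ?a k u w)" if w: "w \<in> ?X" for w
  proof -
    obtain k where k: "k \<le> ?d" "(u, w) \<in> scheme_rel H k"
      using assoc_scheme_cover[OF H] uX w by blast
    have "(\<Sum>z\<in>?X. ?a i u z * ?a j z w)
        = (\<Sum>z\<in>?X. if (u, z) \<in> scheme_rel H i \<and> (z, w) \<in> scheme_rel H j then 1 else 0)"
      by (intro sum.cong) (auto simp: adj_matrix_def)
    also have "\<dots> = real (p k)"
      using p[OF k] fin by (simp add: sum.If_cases Int_def)
    also have "\<dots> = (\<Sum>l\<le>?d. if l = k then real (p l) else 0)"
      using k by simp
    also have "\<dots> = (\<Sum>l\<le>?d. real (p l) * ?a l u w)"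
    proof (intro sum.cong refl)
      fix l assume "l \<in> {..?d}"
      then have "(u, w) \<in> scheme_rel H l \<longleftrightarrow> l = k"
        using scheme_rel_unique[OF H k(1) _ k(2)] by auto
      then show "(if l = k then real (p l) else 0) = real (p l) * ?a l u w"
        by (simp add: adj_matrix_def)
    qed
    finally show ?thesis .
  qed
  have "(\<Sum>k\<le>?d. real (p k) * P r k) * x u = (\<Sum>k\<le>?d. real (p k) * (\<Sum>w\<in>?X. ?a k u w * x w))"
    using uX by (simp add: eig sum_distrib_right mult.assoc)
  also have "\<dots> = (\<Sum>w\<in>?X. (\<Sum>k\<le>?d. real (p k) * ?a k u w) * x w)"
    unfolding sum_distrib_left sum_distrib_right mult.assoc by (rule sum.swap)
  also have "\<dots> = (\<Sum>w\<in>?X. (\<Sum>z\<in>?X. ?a i u z * ?a j z w) * x w)"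
    by (simp add: entry)
  also have "\<dots> = (\<Sum>z\<in>?X. ?a i u z * (\<Sum>w\<in>?X. ?a j z w * x w))"
    unfolding sum_distrib_left sum_distrib_right mult.assoc by (rule sum.swap)
  also have "\<dots> = (\<Sum>z\<in>?X. ?a i u z * (P r j * x z))"
    using j by (simp add: eig)
  also have "\<dots> = P r j * (\<Sum>z\<in>?X. ?a i u z * x z)"
    by (simp add: sum_distrib_left mult_ac)
  also have "\<dots> = P r i * P r j * x u"
    using eig[OF i uX] by simp
  finally show ?thesis using u by simp
qed

text \<open>
  Invertibility of \<open>P\<close>.  Rows 1 and 3 differ only in the factor \<open>s - 1\<close> against
  \<open>- (t + 1)\<close> of \<open>c 1 - c 2\<close>, so \<open>c 2 = c 1\<close> and then \<open>c 3 = c 0\<close>.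
  Rows 2 and 4 now give \<open>c 4 = c 1 = c 0\<close> (row 2 alone gives \<open>c 1 = c 0\<close> if \<open>s = t\<close>), and row 0 becomes a positive multiple of \<open>c 1\<close>.
\<close>

lemma matrix_P_kernel:
  fixes c :: "nat \<Rightarrow> real"
  assumes "2 \<le> t" "t \<le> s" and d: "d = (if s = t then 3 else 4 :: nat)"
    and zero: "\<And>r. r \<le> d \<Longrightarrow> (\<Sum>k\<le>d. c k * matrix_P s t r k) = 0" and "k \<le> d"
  shows "c k = 0"
proof -
  define S T where "S = real s" and "T = real t"
  have ST: "T \<ge> 2" "S \<ge> T" using assms by (auto simp: S_def T_def)
  \<comment> \<open>For \<open>s = t\<close> the last column of \<open>P\<close> vanishes on the first four rows, so that
     a fifth coefficient 0 may be added.\<close>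
  define e where "e = (if s = t then 0 else c 4)"
  have row0: "c 0 + c 1 * ((S-1)*(T+1)) + c 2 * ((S-1)*(T^2-1)) + c 3 * (T-1) + e * ((S-1)*T*(S-T)) = 0"
   and row1: "c 0 + c 1 * (S-1) + c 2 * (1-S) - c 3 = 0"
   and row2: "c 0 + c 1 * (S-T-1) + c 2 * ((T-1)*(S-T-1)) + c 3 * (T-1) - e * (T*(S-T)) = 0"
   and row3: "c 0 + c 1 * (-T-1) + c 2 * (T+1) - c 3 = 0"
    using zero[of 0] zero[of 1] zero[of 2] zero[of 3] d
    by (auto simp: matrix_P_def Let_def eval_nat_numeral S_def T_def e_def split: if_splits)
  have row4: "c 0 + c 1 * (-T-1) + c 2 * (1-T^2) + c 3 * (T-1) + e * T^2 = 0" if "s \<noteq> t"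
    using zero[of 4] d that
    by (auto simp: matrix_P_def Let_def eval_nat_numeral S_def T_def e_def)
  have "(S + T) * (c 1 - c 2) = 0"
    using row1 row3 by (simp add: algebra_simps)
  then have c12: "c 2 = c 1" using ST by auto
  have c03: "c 3 = c 0" using row1 unfolding c12 by (simp add: algebra_simps)
  have "T * (c 0 + (S-T-1) * c 1 - e * (S-T)) = 0"
    using row2 unfolding c12 c03 by (simp add: algebra_simps)
  then have r2: "c 0 + (S-T-1) * c 1 - e * (S-T) = 0" using ST by auto
  have e: "e = c 1" if "s \<noteq> t"
  proof -
    have "T * (c 0 - (T+1) * c 1 + e * T) = 0"
      using row4[OF that] unfolding c12 c03 by (simp add: algebra_simps power2_eq_square)
    then have "c 0 - (T+1) * c 1 + e * T = 0" using ST by auto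
    moreover have "S * (c 1 - e)
        = (c 0 + (S-T-1) * c 1 - e * (S-T)) - (c 0 - (T+1) * c 1 + e * T)"
      by (simp add: algebra_simps)
    ultimately have "S * (c 1 - e) = 0" using r2 by simp
    then show ?thesis using ST by auto
  qed
  have e': "e * (S - T) = c 1 * (S - T)"
    using e by (cases "s = t") (auto simp: S_def T_def)
  have c01: "c 0 = c 1" using r2 e' by (simp add: algebra_simps)
  have "T * S^2 * c 1 = c 0 + c 1 * ((S-1)*(T+1)) + c 2 * ((S-1)*(T^2-1)) + c 3 * (T-1)
      + (S-1) * T * (c 1 * (S-T))"
    unfolding c12 c03 c01 by (simp add: algebra_simps power2_eq_square)
  also have "\<dots> = 0" using row0 unfolding e'[symmetric] by (simp add: algebra_simps)
  finally have c1: "c 1 = 0" using ST by simp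
  have "k = 0 \<or> k = 1 \<or> k = 2 \<or> k = 3 \<or> (k = 4 \<and> s \<noteq> t)"
    using \<open>k \<le> d\<close> d by (auto split: if_splits)
  then show ?thesis
    using c1 c12 c03 c01 e by (auto simp: e_def)
qed

text \<open>
  To compute an intersection number it is enough to guess it and to verify the guess row by row in
  \<open>P\<close>, since two solutions of these equations differ by an element of the kernel of \<open>P\<close>.
\<close>

lemma intersection_number:
  fixes q :: "nat \<Rightarrow> real"
  assumes "2 \<le> t" "t \<le> s" and H: "scheme_with_eigenmatrix_P s t H"
    and ij: "i \<le> num_classes H" "j \<le> num_classes H"
    and q: "\<And>r. r \<le> num_classes H \<Longrightarrow>
      (\<Sum>k\<le>num_classes H. q k * matrix_P s t r k) = matrix_P s t r i * matrix_P s t r j"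
    and k: "k \<le> num_classes H" "(x, y) \<in> scheme_rel H k"
  shows "real (card {z \<in> scheme_pts H. (x, z) \<in> scheme_rel H i \<and> (z, y) \<in> scheme_rel H j}) = q k"
proof -
  have A: "assoc_scheme H" and E: "first_eigenmatrix H (matrix_P s t)"
    and d: "num_classes H = (if s = t then 3 else 4)"
    using H by (auto simp: scheme_with_eigenmatrix_P_def)
  obtain p' where p': "\<forall>i\<le>num_classes H. \<forall>j\<le>num_classes H.
      \<forall>k\<le>num_classes H. \<forall>(x, y) \<in> scheme_rel H k.
        card {z \<in> scheme_pts H. (x, z) \<in> scheme_rel H i \<and> (z, y) \<in> scheme_rel H j} = p' i j k"
    using assoc_scheme_intersection_numbers[OF A] by (rule exE)
  define p where "p = p' i j"
  have p: "card {z \<in> scheme_pts H. (x, z) \<in> scheme_rel H i \<and> (z, y) \<in> scheme_rel H j} = p k"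
    if "k \<le> num_classes H" "(x, y) \<in> scheme_rel H k" for k x y
    using p' ij that unfolding p_def by blast
  have "(\<Sum>k\<le>num_classes H. (real (p k) - q k) * matrix_P s t r k) = 0" if "r \<le> num_classes H" for r
    using eigenmatrix_product[OF A E p that ij] q[OF that]
    by (simp add: left_diff_distrib sum_subtractf)
  then have "real (p k) - q k = 0"
    using matrix_P_kernel[OF assms(1,2) d, of "\<lambda>k. real (p k) - q k" k] k by auto
  then show ?thesis using p[OF k] by simp
qed

text \<open>
  Each list gives the values on the relations 0, 1, 2, 3 and, if \<open>s > t\<close>, 4.  In matrix form the four products are
  \<open>B\<^sup>2 = (s-1)(t+1) I + (s-2) B + t B\<^sub>2 + (t+1) B\<^sub>4\<close>, \<open>B B\<^sub>3 = B\<^sub>2\<close>,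
  \<open>B\<^sub>2 B\<^sub>3 = (t-1) B + (t-2) B\<^sub>2\<close> and \<open>B\<^sub>3\<^sup>2 = (t-1) I + (t-2) B\<^sub>3\<close>.
\<close>

lemma intersection_numbers_P:
  assumes "2 \<le> t" "t \<le> s" and H: "scheme_with_eigenmatrix_P s t H"
    and k: "k \<le> num_classes H" "(x, y) \<in> scheme_rel H k"
  shows "card {z \<in> scheme_pts H. (x, z) \<in> scheme_rel H 1 \<and> (z, y) \<in> scheme_rel H 1}
           = [(s - 1) * (t + 1), s - 2, t, 0, t + 1] ! k"
    and "card {z \<in> scheme_pts H. (x, z) \<in> scheme_rel H 1 \<and> (z, y) \<in> scheme_rel H 3}
           = [0, 0, 1, 0, 0] ! k"
    and "card {z \<in> scheme_pts H. (x, z) \<in> scheme_rel H 2 \<and> (z, y) \<in> scheme_rel H 3}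
           = [0, t - 1, t - 2, 0, 0] ! k"
    and "card {z \<in> scheme_pts H. (x, z) \<in> scheme_rel H 3 \<and> (z, y) \<in> scheme_rel H 3}
           = [t - 1, 0, 0, t - 2, 0] ! k"
proof -
  have d: "num_classes H = 3 \<and> s = t \<or> num_classes H = 4 \<and> s \<noteq> t"
    using H by (auto simp: scheme_with_eigenmatrix_P_def)
  have k': "k = 0 \<or> k = 1 \<or> k = 2 \<or> k = 3 \<or> k = 4" using d k by auto
  note rule = intersection_number[OF assms(1-3) _ _ _ k]
  note simps = matrix_P_def Let_def eval_nat_numeral algebra_simps le_Suc_eq
  have 11: "real (card {z \<in> scheme_pts H. (x, z) \<in> scheme_rel H 1 \<and> (z, y) \<in> scheme_rel H 1})
      = [(real s - 1) * (real t + 1), real s - 2, real t, 0, real t + 1] ! k"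
    by (rule rule) (use d in \<open>auto simp: simps\<close>)
  have 13: "real (card {z \<in> scheme_pts H. (x, z) \<in> scheme_rel H 1 \<and> (z, y) \<in> scheme_rel H 3})
      = [0, 0, 1, 0, 0] ! k"
    by (rule rule) (use d in \<open>auto simp: simps\<close>)
  have 23: "real (card {z \<in> scheme_pts H. (x, z) \<in> scheme_rel H 2 \<and> (z, y) \<in> scheme_rel H 3})
      = [0, real t - 1, real t - 2, 0, 0] ! k"
    by (rule rule) (use d in \<open>auto simp: simps\<close>)
  have 33: "real (card {z \<in> scheme_pts H. (x, z) \<in> scheme_rel H 3 \<and> (z, y) \<in> scheme_rel H 3})
      = [real t - 1, 0, 0, real t - 2, 0] ! k"
    by (rule rule) (use d in \<open>auto simp: simps\<close>)
  have m0: "real ((s - 1) * (t + 1)) = (real s - 1) * (real t + 1)"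
    unfolding of_nat_mult of_nat_add using assms(1,2) by (simp add: of_nat_diff)
  have cast: "n = m" if "real n = real m" for n m using that by simp
  show "card {z \<in> scheme_pts H. (x, z) \<in> scheme_rel H 1 \<and> (z, y) \<in> scheme_rel H 1}
           = [(s - 1) * (t + 1), s - 2, t, 0, t + 1] ! k"
    using k' assms(1,2) m0 by (intro cast, unfold 11) (auto simp: of_nat_diff)
  show "card {z \<in> scheme_pts H. (x, z) \<in> scheme_rel H 1 \<and> (z, y) \<in> scheme_rel H 3}
           = [0, 0, 1, 0, 0] ! k"
    using k' by (intro cast, unfold 13) auto
  show "card {z \<in> scheme_pts H. (x, z) \<in> scheme_rel H 2 \<and> (z, y) \<in> scheme_rel H 3}
           = [0, t - 1, t - 2, 0, 0] ! k"
    using k' assms(1,2) by (intro cast, unfold 23) (auto simp: of_nat_diff algebra_simps)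
  show "card {z \<in> scheme_pts H. (x, z) \<in> scheme_rel H 3 \<and> (z, y) \<in> scheme_rel H 3}
           = [t - 1, 0, 0, t - 2, 0] ! k"
    using k' assms(1,2) by (intro cast, unfold 33) (auto simp: of_nat_diff algebra_simps)
qed

section \<open>The first relation and the fibres\<close>

text \<open>
  What both directions of the theorem use of a scheme: the graph \<open>B\<close> of the first relation and the
  equivalence \<open>F\<close> whose classes are the fibres.  The composition \<open>F O B O F\<close> relates the vertices
  of any two fibres that are adjacent in the quotient graph; such fibres are called linked.
\<close>

locale fibred_graph =
  fixes s t :: nat and X :: "'a set" and B F :: "('a \<times> 'a) set"
  assumes finite_X: "finite X"
    and fibre_equiv: "equiv X F"
    and fibre_card: "\<And>x. x \<in> X \<Longrightarrow> card (F `` {x}) = t"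
    and B_subset: "B \<subseteq> X \<times> X"
    and B_sym: "sym B"
    and B_F_disjoint: "B \<inter> F = {}"
    and valency: "\<And>x. x \<in> X \<Longrightarrow> card (B `` {x}) = (s - 1) * (t + 1)"
    and common_fibre: "\<And>x y. (x, y) \<in> F \<Longrightarrow> x \<noteq> y \<Longrightarrow> card (B `` {x} \<inter> B `` {y}) = 0"
    and common_adjacent: "\<And>x y. (x, y) \<in> B \<Longrightarrow> card (B `` {x} \<inter> B `` {y}) = s - 2"
    and common_linked: "\<And>x y. (x, y) \<in> F O B O F \<Longrightarrow> (x, y) \<notin> B \<Longrightarrow>
          card (B `` {x} \<inter> B `` {y}) = t"
    and common_unlinked: "\<And>x y. x \<in> X \<Longrightarrow> y \<in> X \<Longrightarrow> (x, y) \<notin> F \<Longrightarrow> (x, y) \<notin> F O B O F \<Longrightarrow>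
          card (B `` {x} \<inter> B `` {y}) = t + 1"
    and unique_neighbour: "\<And>x y. (x, y) \<in> F O B O F \<Longrightarrow> card (B `` {x} \<inter> F `` {y}) = 1"

lemma scheme_relation_cases:
  assumes H: "scheme_with_eigenmatrix_P s t H" and "x \<in> scheme_pts H" "y \<in> scheme_pts H"
  obtains k where "k \<le> num_classes H" "(x, y) \<in> scheme_rel H k" "k \<in> {0, 1, 2, 3, 4}"
proof -
  have d: "num_classes H \<le> 4" and A: "assoc_scheme H"
    using H by (auto simp: scheme_with_eigenmatrix_P_def)
  obtain k where k: "k \<le> num_classes H" "(x, y) \<in> scheme_rel H k"
    using assoc_scheme_cover[OF A] assms(2,3) by blast
  moreover have "k \<in> {0, 1, 2, 3, 4}" using d k by auto
  ultimately show ?thesis using that by blast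
qed

text \<open>
  From \<open>B\<^sub>3\<^sup>2\<close> the relation \<open>R\<^sub>0 \<union> R\<^sub>3\<close> is transitive; from
  \<open>B B\<^sub>3\<close> and \<open>B\<^sub>2 B\<^sub>3\<close> the union \<open>R\<^sub>1 \<union> R\<^sub>2\<close> is closed under
  moving within fibres, and for a pair \<open>(x, y)\<close> in \<open>R\<^sub>2\<close> the vertex \<open>x\<close> has exactly one
  neighbour in the fibre of \<open>y\<close>.  So the linked pairs are those of \<open>R\<^sub>1 \<union> R\<^sub>2\<close>.
\<close>

lemma scheme_fibred_graph:
  assumes st: "2 \<le> t" "t \<le> s" and H: "scheme_with_eigenmatrix_P s t H"
  shows "fibred_graph s t (scheme_pts H) (scheme_rel H 1) (scheme_rel H 0 \<union> scheme_rel H 3)"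
proof -
  let ?X = "scheme_pts H" and ?R = "scheme_rel H" and ?d = "num_classes H"
  let ?F = "?R 0 \<union> ?R 3"
  have A: "assoc_scheme H" and d: "3 \<le> ?d"
    using H by (auto simp: scheme_with_eigenmatrix_P_def)
  note fin = assoc_scheme_finite[OF A]
  have R0: "?R 0 = Id_on ?X" using assoc_scheme_diagonal[OF A] .
  have sub: "(x, y) \<in> ?R k \<Longrightarrow> x \<in> ?X \<and> y \<in> ?X" if "k \<le> 3" for k x y
    using assoc_scheme_subset[OF A, of k] that d by auto
  have R0': "(x, y) \<in> ?R 0 \<longleftrightarrow> x = y \<and> x \<in> ?X" for x y by (auto simp: R0)
  have sm: "(x, y) \<in> ?R k \<Longrightarrow> (y, x) \<in> ?R k" if "k \<le> 3" for k x y
    using assoc_scheme_sym[OF A, of k] that d by (meson order_trans symD)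
  have sub1: "(x, y) \<in> ?R 1 \<Longrightarrow> x \<in> ?X \<and> y \<in> ?X"
    and sub3: "(x, y) \<in> ?R 3 \<Longrightarrow> x \<in> ?X \<and> y \<in> ?X"
    and sm1: "(x, y) \<in> ?R 1 \<Longrightarrow> (y, x) \<in> ?R 1"
    and sm3: "(x, y) \<in> ?R 3 \<Longrightarrow> (y, x) \<in> ?R 3" for x y
    by (rule sub sm; simp)+
  have dis: "e \<in> ?R i \<Longrightarrow> e \<in> ?R j \<Longrightarrow> i = j" if "i \<le> ?d" "j \<le> ?d" for i j e
    using assoc_scheme_disjoint[OF A that] .
  note cases = scheme_relation_cases[OF H]
  note num = intersection_numbers_P[OF st H]
  have witness: "card {z \<in> ?X. (x, z) \<in> ?R i \<and> (z, y) \<in> ?R j} \<noteq> 0"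
    if "(x, z) \<in> ?R i" "(z, y) \<in> ?R j" "i \<le> 3" for x y z i j
  proof -
    have "z \<in> {z \<in> ?X. (x, z) \<in> ?R i \<and> (z, y) \<in> ?R j}" using that sub by auto
    then show ?thesis using fin by (auto simp: card_eq_0_iff)
  qed
  have t13: "(x, z) \<in> ?R 2" if "(x, y) \<in> ?R 1" "(y, z) \<in> ?R 3" for x y z
  proof -
    from that sub[of 1] sub[of 3] have "x \<in> ?X" "z \<in> ?X" by auto
    then obtain k where k: "k \<le> ?d" "(x, z) \<in> ?R k" "k \<in> {0, 1, 2, 3, 4}" by (rule cases)
    show ?thesis using witness[OF that] num(2)[OF k(1,2)] k by auto
  qed
  have t23: "(x, z) \<in> ?R 1 \<union> ?R 2" if "(x, y) \<in> ?R 2" "(y, z) \<in> ?R 3" for x y z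
  proof -
    from that sub[of 2] sub[of 3] have "x \<in> ?X" "z \<in> ?X" by auto
    then obtain k where k: "k \<le> ?d" "(x, z) \<in> ?R k" "k \<in> {0, 1, 2, 3, 4}" by (rule cases)
    show ?thesis using witness[OF that] num(3)[OF k(1,2)] k by auto
  qed
  have t33: "(x, z) \<in> ?F" if "(x, y) \<in> ?R 3" "(y, z) \<in> ?R 3" for x y z
  proof -
    from that sub[of 3] have "x \<in> ?X" "z \<in> ?X" by auto
    then obtain k where k: "k \<le> ?d" "(x, z) \<in> ?R k" "k \<in> {0, 1, 2, 3, 4}" by (rule cases)
    show ?thesis using witness[OF that] num(4)[OF k(1,2)] k by auto
  qed
  have right: "(x, z) \<in> ?R 1 \<union> ?R 2" if "(x, y) \<in> ?R 1 \<union> ?R 2" "(y, z) \<in> ?F" for x y z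
    using that t13[of x y z] t23[of x y z] by (auto simp: R0)
  have left: "(x, z) \<in> ?R 1 \<union> ?R 2" if "(x, y) \<in> ?F" "(y, z) \<in> ?R 1 \<union> ?R 2" for x y z
    using right[of z y x] that sm[of 0] sm[of 1] sm[of 2] sm[of 3] by auto
  have linked: "?F O ?R 1 O ?F = ?R 1 \<union> ?R 2"
  proof
    show "?F O ?R 1 O ?F \<subseteq> ?R 1 \<union> ?R 2" using left right by blast
    show "?R 1 \<union> ?R 2 \<subseteq> ?F O ?R 1 O ?F"
    proof
      fix e assume e: "e \<in> ?R 1 \<union> ?R 2"
      obtain x y where xy: "e = (x, y)" by (cases e)
      have X: "x \<in> ?X" "y \<in> ?X" using e xy sub[of 1] sub[of 2] by auto
      show "e \<in> ?F O ?R 1 O ?F"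
      proof (cases "e \<in> ?R 1")
        case True
        then show ?thesis using X xy by (auto simp: R0)
      next
        case False
        then have "(x, y) \<in> ?R 2" using e xy by auto
        then have "card {z \<in> ?X. (x, z) \<in> ?R 1 \<and> (z, y) \<in> ?R 3} = 1"
          using num(2)[of 2 x y] d by auto
        then obtain z where "(x, z) \<in> ?R 1" "(z, y) \<in> ?R 3"
          by (auto simp: card_1_singleton_iff)
        then show ?thesis using X xy by (auto simp: R0)
      qed
    qed
  qed
  have common: "?R 1 `` {x} \<inter> ?R 1 `` {y} = {z \<in> ?X. (x, z) \<in> ?R 1 \<and> (z, y) \<in> ?R 1}" for x y
    using sub1 sm1 by blast
  have eq: "equiv ?X ?F"
  proof (rule equivI)
    show "?F \<subseteq> ?X \<times> ?X" using sub[of 0] sub3 by auto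
    show "refl_on ?X ?F" by (auto simp: refl_on_def R0)
    show "sym ?F" using sm3 by (auto simp: sym_def R0)
    show "trans ?F" by (rule transI) (use t33 in \<open>auto simp: R0\<close>)
  qed
  have R1': "(x, y) \<notin> ?R 0 \<and> (x, y) \<notin> ?R 2 \<and> (x, y) \<notin> ?R 3" if "(x, y) \<in> ?R 1" for x y
    using that dis[of 1 0] dis[of 1 2] dis[of 1 3] d by auto
  show ?thesis
  proof
    show "finite ?X" by (fact fin)
    show "equiv ?X ?F" by (fact eq)
    show "?R 1 \<subseteq> ?X \<times> ?X" using sub1 by auto
    show "sym (?R 1)" using sm1 by (auto simp: sym_def)
    show "?R 1 \<inter> ?F = {}" using R1' by auto
  next
    fix x assume x: "x \<in> ?X"
    then have xx: "(x, x) \<in> ?R 0" by (auto simp: R0)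
    have "?F `` {x} = insert x {z \<in> ?X. (x, z) \<in> ?R 3 \<and> (z, x) \<in> ?R 3}"
      using sub3[of x] sm3[of x] x by (intro set_eqI) (simp add: R0', blast)
    moreover have "(x, x) \<notin> ?R 3" using dis[of 0 3] xx d by auto
    ultimately show "card (?F `` {x}) = t" using num(4)[OF _ xx] fin st by simp
    have "?R 1 `` {x} = {z \<in> ?X. (x, z) \<in> ?R 1 \<and> (z, x) \<in> ?R 1}"
      using common[of x x] by simp
    then show "card (?R 1 `` {x}) = (s - 1) * (t + 1)"
      using num(1)[OF _ xx] by simp
  next
    fix x y assume "(x, y) \<in> ?F" "x \<noteq> y"
    then have "(x, y) \<in> ?R 3" by (auto simp: R0)
    then show "card (?R 1 `` {x} \<inter> ?R 1 `` {y}) = 0"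
      unfolding common using num(1)[of 3 x y] d by simp
  next
    fix x y assume "(x, y) \<in> ?R 1"
    then show "card (?R 1 `` {x} \<inter> ?R 1 `` {y}) = s - 2"
      unfolding common using num(1)[of 1 x y] d by simp
  next
    fix x y assume "(x, y) \<in> ?F O ?R 1 O ?F" "(x, y) \<notin> ?R 1"
    then have "(x, y) \<in> ?R 2" unfolding linked by auto
    then show "card (?R 1 `` {x} \<inter> ?R 1 `` {y}) = t"
      unfolding common using num(1)[of 2 x y] d by simp
  next
    fix x y assume "x \<in> ?X" "y \<in> ?X" and not: "(x, y) \<notin> ?F" "(x, y) \<notin> ?F O ?R 1 O ?F"
    then obtain k where k: "k \<le> ?d" "(x, y) \<in> ?R k" "k \<in> {0, 1, 2, 3, 4}" by (metis cases)
    then have "k = 4" using not unfolding linked by auto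
    then show "card (?R 1 `` {x} \<inter> ?R 1 `` {y}) = t + 1"
      unfolding common using num(1)[OF k(1,2)] by simp
  next
    fix x y assume "(x, y) \<in> ?F O ?R 1 O ?F"
    then have xy: "(x, y) \<in> ?R 1 \<or> (x, y) \<in> ?R 2" unfolding linked by auto
    then have y: "y \<in> ?X" using sub1 sub[of 2] by auto
    have *: "?R 1 `` {x} \<inter> ?F `` {y}
        = {z \<in> ?X. (x, z) \<in> ?R 1 \<and> (z, y) \<in> ?R 3} \<union> (if (x, y) \<in> ?R 1 then {y} else {})"
      using sub1[of x] sm3[of y] sm3[of _ y] y
      by (cases "(x, y) \<in> ?R 1"; intro set_eqI; simp add: R0' del: One_nat_def; blast)
    show "card (?R 1 `` {x} \<inter> ?F `` {y}) = 1"
    proof (cases "(x, y) \<in> ?R 1")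
      case True
      have "card {z \<in> ?X. (x, z) \<in> ?R 1 \<and> (z, y) \<in> ?R 3} = 0"
        using num(2)[OF _ True] d by simp
      then have "{z \<in> ?X. (x, z) \<in> ?R 1 \<and> (z, y) \<in> ?R 3} = {}"
        using fin by (subst (asm) card_0_eq) auto
      then show ?thesis unfolding * using True by (simp only: if_True Un_empty_left) simp
    next
      case False
      then show ?thesis unfolding * using num(2)[of 2 x y] xy d by simp
    qed
  qed
qed

context fibred_graph
begin

lemma fibre_subset: "(x, y) \<in> F \<Longrightarrow> x \<in> X \<and> y \<in> X"
  using fibre_equiv by (auto elim: equivE)

lemma fibre_refl: "x \<in> X \<Longrightarrow> (x, x) \<in> F"
  using fibre_equiv by (simp add: equiv_class_self[unfolded Image_singleton_iff])

lemma fibre_sym: "(x, y) \<in> F \<Longrightarrow> (y, x) \<in> F"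
  using fibre_equiv by (auto elim: equivE dest: symD)

lemma fibre_trans: "(x, y) \<in> F \<Longrightarrow> (y, z) \<in> F \<Longrightarrow> (x, z) \<in> F"
  using fibre_equiv by (auto elim: equivE dest: transD)

lemma linkedE:
  assumes "(x, y) \<in> F O B O F"
  obtains x' y' where "(x, x') \<in> F" "(x', y') \<in> B" "(y', y) \<in> F"
  using assms by blast

lemma linked_not_same_fibre:
  assumes "(x, y) \<in> F O B O F"
  shows "x \<in> X" "y \<in> X" "(x, y) \<notin> F"
proof -
  obtain x' y' where *: "(x, x') \<in> F" "(x', y') \<in> B" "(y', y) \<in> F"
    using assms by (rule linkedE)
  show "x \<in> X" "y \<in> X" using fibre_subset[OF *(1)] fibre_subset[OF *(3)] by simp_all
  show "(x, y) \<notin> F"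
  proof
    assume "(x, y) \<in> F"
    then have "(x', y') \<in> F"
      using fibre_trans[OF fibre_sym[OF *(1)]] fibre_trans[OF _ fibre_sym[OF *(3)]] by metis
    then show False using *(2) B_F_disjoint by blast
  qed
qed

lemma fibre_class_eq_iff: "x \<in> X \<Longrightarrow> y \<in> X \<Longrightarrow> F `` {x} = F `` {y} \<longleftrightarrow> (x, y) \<in> F"
  using eq_equiv_class_iff[OF fibre_equiv] .

lemma fibreE:
  assumes "W \<in> X // F" obtains x where "x \<in> X" "W = F `` {x}"
  using assms by (rule quotientE)

lemma fibre_nonempty: "W \<in> X // F \<Longrightarrow> \<exists>x\<in>W. x \<in> X \<and> W = F `` {x}"
  by (metis fibreE fibre_refl Image_singleton_iff)

lemma fibre_member: "W \<in> X // F \<Longrightarrow> x \<in> W \<Longrightarrow> x \<in> X \<and> W = F `` {x}"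
  by (metis fibreE Image_singleton_iff fibre_subset fibre_class_eq_iff)

lemma finite_fibres: "finite (X // F)"
  using finite_X fibre_equiv by (meson equiv_type finite_quotient)

text \<open>
  Passes from counts of vertices to counts of fibres, that is, of points of the net.
\<close>

lemma card_fibres_within:
  assumes A: "A \<subseteq> X" and sat: "\<And>x y. x \<in> A \<Longrightarrow> (x, y) \<in> F \<Longrightarrow> y \<in> A"
  shows "t * card {W \<in> X // F. W \<subseteq> A} = card A"
proof -
  let ?C = "{W \<in> X // F. W \<subseteq> A}"
  have U: "\<Union>?C = A"
  proof (intro equalityI subsetI)
    fix x assume x: "x \<in> A"
    then have "F `` {x} \<in> ?C" using A sat by (auto intro: quotientI)
    moreover have "x \<in> F `` {x}" using x A fibre_refl by auto
    ultimately show "x \<in> \<Union>?C" by blast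
  qed auto
  have "t * card ?C = card (\<Union>?C)"
  proof (rule card_partition)
    show "finite ?C" using finite_fibres by simp
    show "finite (\<Union>?C)" unfolding U using A finite_X finite_subset by blast
    show "card W = t" if "W \<in> ?C" for W
      using that fibre_card by (auto elim: fibreE)
    show "W \<inter> W' = {}" if "W \<in> ?C" "W' \<in> ?C" "W \<noteq> W'" for W W'
      using that fibre_member by blast
  qed
  then show ?thesis unfolding U .
qed

end

section \<open>The first relation generates the scheme\<close>

text \<open>
  A relation of \<open>H\<close> is recognised from equality, adjacency in \<open>B\<close> and the number of common
  \<open>B\<close>-neighbours.  All three are constant on each relation of any scheme \<open>H'\<close> that contains
  \<open>B\<close> as a union of its relations, so every relation of \<open>H'\<close> lies inside a relation of \<open>H\<close>.
\<close>

lemma scheme_generated_by_first_relation: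
  assumes st: "2 \<le> t" "t \<le> s" and H: "scheme_with_eigenmatrix_P s t (H :: 'a scheme)"
    and G: "pverts G = scheme_pts H" "parcs G = scheme_rel H 1"
  shows "generates_scheme G H"
proof -
  let ?X = "scheme_pts H" and ?R = "scheme_rel H" and ?d = "num_classes H"
  have A: "assoc_scheme H" and d: "3 \<le> ?d"
    using H by (auto simp: scheme_with_eigenmatrix_P_def)
  have fin: "finite ?X" using assoc_scheme_finite[OF A] .
  define c where "c x y = card {z \<in> ?X. (x, z) \<in> ?R 1 \<and> (z, y) \<in> ?R 1}" for x y
  have same: "k = l"
    if kl: "k \<le> ?d" "(x, y) \<in> ?R k" "l \<le> ?d" "(x', y') \<in> ?R l"
      and id: "x = y \<longleftrightarrow> x' = y'" and B: "(x, y) \<in> ?R 1 \<longleftrightarrow> (x', y') \<in> ?R 1" and c: "c x y = c x' y'"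
    for k l x y x' y'
  proof -
    \<comment> \<open>Equality and adjacency recognise the relations 0 and 1; the remaining ones are told apart
      by their numbers of common neighbours.\<close>
    have mem: "(k = m) = (l = m)" if m: "m \<in> {0, 1}" for m
    proof -
      have m': "m \<le> ?d" using m d by auto
      have "(x, y) \<in> ?R m \<longleftrightarrow> k = m" "(x', y') \<in> ?R m \<longleftrightarrow> l = m"
        by (rule scheme_rel_unique[OF A kl(1) m' kl(2)], rule scheme_rel_unique[OF A kl(3) m' kl(4)])
      moreover have "x \<in> ?X" "x' \<in> ?X"
        using assoc_scheme_subset[OF A kl(1)] assoc_scheme_subset[OF A kl(3)] kl(2,4) by blast+
      then have "(x, y) \<in> ?R 0 \<longleftrightarrow> x = y" "(x', y') \<in> ?R 0 \<longleftrightarrow> x' = y'"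
        by (auto simp: assoc_scheme_diagonal[OF A])
      ultimately show ?thesis using id B m by auto
    qed
    have "[(s - 1) * (t + 1), s - 2, t, 0, t + 1] ! k = [(s - 1) * (t + 1), s - 2, t, 0, t + 1] ! l"
      using c unfolding c_def intersection_numbers_P(1)[OF st H kl(1,2)]
        intersection_numbers_P(1)[OF st H kl(3,4)] .
    moreover have "k \<in> {0, 1, 2, 3, 4}" "l \<in> {0, 1, 2, 3, 4}"
      using \<open>k \<le> ?d\<close> \<open>l \<le> ?d\<close> H by (auto simp: scheme_with_eigenmatrix_P_def split: if_splits)
    ultimately show "k = l" using mem[of 0] mem[of 1] st by auto
  qed
  have "scheme_contains H' (?R k)"
    if A': "assoc_scheme H'" and X': "scheme_pts H' = ?X" and B': "scheme_contains H' (?R 1)"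
      and k: "k \<le> ?d" for H' :: "'a scheme" and k
  proof -
    let ?R' = "scheme_rel H'" and ?d' = "num_classes H'"
    obtain J where J: "J \<subseteq> {..?d'}" "?R 1 = (\<Union>j\<in>J. ?R' j)"
      using B' unfolding scheme_contains_def by blast
    have finJ: "finite J" using J(1) finite_subset by blast
    have le: "j \<in> J \<Longrightarrow> j \<le> ?d'" for j using J(1) by auto
    have member: "e \<in> ?R 1 \<longleftrightarrow> j \<in> J" if "e \<in> ?R' j" "j \<le> ?d'" for e j
      using J(2) le scheme_rel_unique[OF A' that(2) _ that(1)] that(1) by blast
    have diag: "x = y \<longleftrightarrow> j = 0" if "(x, y) \<in> ?R' j" "j \<le> ?d'" for x y j
    proof -
      have "x \<in> ?X" "y \<in> ?X" using assoc_scheme_subset[OF A' that(2)] that(1) X' by auto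
      then have "(x, y) \<in> ?R' 0 \<longleftrightarrow> x = y" by (auto simp: assoc_scheme_diagonal[OF A'] X')
      then show ?thesis using scheme_rel_unique[OF A' that(2) _ that(1), of 0] by simp
    qed
    obtain p where p: "\<forall>i\<le>?d'. \<forall>j\<le>?d'. \<forall>k\<le>?d'. \<forall>(x, y) \<in> ?R' k.
        card {z \<in> ?X. (x, z) \<in> ?R' i \<and> (z, y) \<in> ?R' j} = p i j k"
      using assoc_scheme_intersection_numbers[OF A'] unfolding X' by (rule exE)
    have count: "c x y = (\<Sum>(i, j)\<in>J \<times> J. p i j l)" if "(x, y) \<in> ?R' l" "l \<le> ?d'" for x y l
    proof -
      let ?Z = "\<lambda>(i, j). {z \<in> ?X. (x, z) \<in> ?R' i \<and> (z, y) \<in> ?R' j}"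
      have "{z \<in> ?X. (x, z) \<in> ?R 1 \<and> (z, y) \<in> ?R 1} = (\<Union>ij\<in>J \<times> J. ?Z ij)"
        unfolding J(2) by auto
      moreover have "card (\<Union>ij\<in>J \<times> J. ?Z ij) = (\<Sum>ij\<in>J \<times> J. card (?Z ij))"
      proof (rule card_UN_disjoint)
        show "finite (J \<times> J)" using finJ by simp
        show "\<forall>ij\<in>J \<times> J. finite (?Z ij)" using fin by auto
        show "\<forall>ij\<in>J \<times> J. \<forall>kl\<in>J \<times> J. ij \<noteq> kl \<longrightarrow> ?Z ij \<inter> ?Z kl = {}"
        proof (intro ballI impI)
          fix a b assume ab: "a \<in> J \<times> J" "b \<in> J \<times> J" "a \<noteq> b"
          obtain i j k l where *: "a = (i, j)" "b = (k, l)" by (cases a, cases b)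
          have "i = k \<and> j = l" if "z \<in> ?Z a \<inter> ?Z b" for z
            using that ab * le scheme_rel_unique[OF A', of i k "(x, z)"]
              scheme_rel_unique[OF A', of j l "(z, y)"] by simp
          then show "?Z a \<inter> ?Z b = {}" using ab(3) * by blast
        qed
      qed
      moreover have "card (?Z ij) = (case ij of (i, j) \<Rightarrow> p i j l)" if "ij \<in> J \<times> J" for ij
        using that p le \<open>(x, y) \<in> ?R' l\<close> \<open>l \<le> ?d'\<close> by (auto split: prod.splits)
      ultimately show ?thesis unfolding c_def by simp
    qed
    \<comment> \<open>The three invariants agree on all pairs of one relation of \<open>H'\<close>.\<close>
    have inside: "?R' l \<subseteq> ?R k" if l: "l \<le> ?d'" and e: "(x, y) \<in> ?R' l" "(x, y) \<in> ?R k" for l x y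
    proof
      fix e' assume e': "e' \<in> ?R' l"
      obtain x' y' where xy': "e' = (x', y')" by (cases e')
      have "x' \<in> ?X" "y' \<in> ?X" using assoc_scheme_subset[OF A' l] e' xy' X' by auto
      then obtain m where m: "m \<le> ?d" "(x', y') \<in> ?R m" by (rule scheme_relation_cases[OF H])
      have "k = m"
        by (rule same[OF k e(2) m])
          (use e' xy' e l in \<open>auto simp: diag member count simp del: One_nat_def\<close>)
      then show "e' \<in> ?R k" using m xy' by simp
    qed
    have "?R k = (\<Union>l\<in>{l. l \<le> ?d' \<and> ?R' l \<subseteq> ?R k}. ?R' l)"
    proof (intro equalityI subsetI)
      fix e assume e: "e \<in> ?R k"
      then have "e \<in> (\<Union>i\<le>?d'. ?R' i)"
        using assoc_scheme_subset[OF A k] unfolding assoc_scheme_cover[OF A'] X' by auto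
      then obtain l where "l \<le> ?d'" "e \<in> ?R' l" by auto
      moreover from this have "?R' l \<subseteq> ?R k" using inside[of l "fst e" "snd e"] e by auto
      ultimately show "e \<in> (\<Union>l\<in>{l. l \<le> ?d' \<and> ?R' l \<subseteq> ?R k}. ?R' l)" by auto
    qed auto
    then show ?thesis unfolding scheme_contains_def by (intro exI[of _ "{l. l \<le> ?d' \<and> ?R' l \<subseteq> ?R k}"]) auto
  qed
  moreover have "scheme_contains H (?R 1)"
    unfolding scheme_contains_def using d by (intro exI[of _ "{1}"]) auto
  ultimately show ?thesis unfolding generates_scheme_def G using A by auto
qed

section \<open>Distance two and isomorphisms of graphs\<close>

lemma distance_2_iff:
  assumes "pair_graph G" and "v \<in> pverts G" "u \<in> pverts G"
    and common: "v \<noteq> u \<Longrightarrow> (v, u) \<notin> parcs G \<Longrightarrow> neighbours G v \<inter> neighbours G u \<noteq> {}"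
  shows "wf_digraph.\<mu> (with_proj G) (\<lambda>_. 1) v u = ereal (real 2) \<longleftrightarrow> u \<noteq> v \<and> (v, u) \<notin> parcs G"
proof -
  interpret pair_graph G by fact
  let ?m = "\<mu> (\<lambda>_. 1) v u"
  have cost: "awalk_cost (\<lambda>_. 1) p = real (length p)" for p
    by (induction p) auto
  show ?thesis
  proof (cases "u = v \<or> (v, u) \<in> parcs G")
    case True
    then obtain p where p: "awalk v p u" "length p \<le> 1"
    proof
      assume "u = v"
      then show ?thesis using that[of "[]"] assms(2) by (simp add: awalk_Nil_iff)
    next
      assume "(v, u) \<in> parcs G"
      then show ?thesis using that[of "[(v, u)]"] assms(3) by (simp add: awalk_Cons_iff awalk_Nil_iff)
    qed
    have "?m \<le> ereal (real (length p))"
      using min_cost_le_walk_cost[OF p(1), of "\<lambda>_. 1"] by (simp add: cost)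
    also have "\<dots> < ereal (real 2)" using p(2) by simp
    finally show ?thesis using True by auto
  next
    case False
    then obtain w where "(v, w) \<in> parcs G" "(u, w) \<in> parcs G"
      using common by (auto simp: neighbours_def)
    then have "(v, w) \<in> parcs G" "(w, u) \<in> parcs G"
      using arcs_symmetric by auto
    then have "awalk v [(v, w), (w, u)] u"
      using assms(3) by (simp add: awalk_Cons_iff awalk_Nil_iff)
    then have "?m \<le> ereal (real 2)"
      using min_cost_le_walk_cost[of v "[(v, w), (w, u)]" u "\<lambda>_. 1"] by (simp add: cost)
    moreover have "ereal (real 2) \<le> ?m"
      unfolding \<mu>_def
    proof (rule INF_greatest)
      fix p assume "p \<in> {p. awalk v p u}"
      then have p: "awalk v p u" by simp
      have "length p \<ge> 2"
      proof (rule ccontr)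
        assume "\<not> length p \<ge> 2"
        then consider "p = []" | e where "p = [e]"
          by (cases p; cases "tl p") auto
        then show False using p False
          by cases (auto simp: awalk_Cons_iff awalk_Nil_iff)
      qed
      then show "ereal (real 2) \<le> ereal (awalk_cost (\<lambda>_. 1) p)"
        by (simp add: cost)
    qed
    ultimately show ?thesis using False by auto
  qed
qed

text \<open>
  As \<open>m > 0\<close>, non-adjacent vertices are at distance 2, and the second subconstituent is the graph of
  non-neighbours.
\<close>

lemma second_subconstituent_strongly_regular:
  assumes G: "strongly_regular G n k l m" and "0 < m" and v: "v \<in> pverts G"
  shows "subconstituent G 2 v = pair_induced G (pverts G - {v} - neighbours G v)"
proof -
  have "wf_digraph.\<mu> (with_proj G) (\<lambda>_. 1) v u = ereal (real 2) \<longleftrightarrow> u \<noteq> v \<and> (v, u) \<notin> parcs G"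
    if u: "u \<in> pverts G" for u
  proof (rule distance_2_iff)
    show "neighbours G v \<inter> neighbours G u \<noteq> {}" if "v \<noteq> u" "(v, u) \<notin> parcs G"
      using G \<open>0 < m\<close> v u that unfolding strongly_regular_def by fastforce
  qed (use G v u in \<open>auto simp: strongly_regular_def\<close>)
  then have "{u \<in> pverts G. wf_digraph.\<mu> (with_proj G) (\<lambda>_. 1) v u = ereal (real 2)}
      = pverts G - {v} - neighbours G v"
    by (auto simp: neighbours_def)
  then show ?thesis by (simp add: subconstituent_def)
qed

lemma graph_isomorphism_comp:
  assumes "graph_isomorphism f G G'" "graph_isomorphism g G' G''"
  shows "graph_isomorphism (g \<circ> f) G G''"
  using assms bij_betw_trans[of f "pverts G" "pverts G'" g "pverts G''"]
  by (auto simp: graph_isomorphism_def dest: bij_betwE)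

lemma graph_isomorphism_inv:
  assumes f: "graph_isomorphism f G G'"
  shows "graph_isomorphism (inv_into (pverts G) f) G' G"
proof -
  have bij: "bij_betw f (pverts G) (pverts G')"
    and arc: "\<And>u w. u \<in> pverts G \<Longrightarrow> w \<in> pverts G \<Longrightarrow> (u, w) \<in> parcs G \<longleftrightarrow> (f u, f w) \<in> parcs G'"
    using f by (auto simp: graph_isomorphism_def)
  have inv: "inv_into (pverts G) f u \<in> pverts G" "f (inv_into (pverts G) f u) = u"
    if "u \<in> pverts G'" for u
    using bij that by (auto simp: bij_betw_def inv_into_into f_inv_into_f)
  show ?thesis
    unfolding graph_isomorphism_def using bij_betw_inv_into[OF bij] arc inv by simp
qed

lemma graph_isomorphism_neighbours:
  assumes f: "graph_isomorphism f G G'" and u: "u \<in> pverts G"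
  shows "f ` neighbours G u = neighbours G' (f u)"
proof -
  have bij: "f ` pverts G = pverts G'"
    and arc: "\<And>w. w \<in> pverts G \<Longrightarrow> (u, w) \<in> parcs G \<longleftrightarrow> (f u, f w) \<in> parcs G'"
    using f u by (auto simp: graph_isomorphism_def bij_betw_def)
  show ?thesis unfolding neighbours_def bij[symmetric] using arc by auto
qed

lemma strongly_regular_isomorphic:
  assumes f: "graph_isomorphism f G G'" and "pair_graph G" and G': "strongly_regular G' n k l m"
  shows "strongly_regular G n k l m"
proof -
  have bij: "bij_betw f (pverts G) (pverts G')" and inj: "inj_on f (pverts G)"
    and arc: "\<And>u w. u \<in> pverts G \<Longrightarrow> w \<in> pverts G \<Longrightarrow> (u, w) \<in> parcs G \<longleftrightarrow> (f u, f w) \<in> parcs G'"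
    using f by (auto simp: graph_isomorphism_def bij_betw_def)
  have f_in: "f u \<in> pverts G'" if "u \<in> pverts G" for u
    using bij that by (rule bij_betw_apply)
  have sub: "neighbours G u \<subseteq> pverts G" for u by (auto simp: neighbours_def)
  have card: "card (f ` A) = card A" if "A \<subseteq> pverts G" for A
    using inj that by (intro card_image) (rule inj_on_subset)
  have deg: "card (neighbours G u) = card (neighbours G' (f u))" if "u \<in> pverts G" for u
    using card[OF sub] graph_isomorphism_neighbours[OF f that] by metis
  have common: "card (neighbours G u \<inter> neighbours G w) = card (neighbours G' (f u) \<inter> neighbours G' (f w))"
    if uw: "u \<in> pverts G" "w \<in> pverts G" for u w
  proof -
    have "f ` (neighbours G u \<inter> neighbours G w) = neighbours G' (f u) \<inter> neighbours G' (f w)"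
      using inj_on_image_Int[OF inj sub sub] graph_isomorphism_neighbours[OF f] uw by metis
    moreover have "neighbours G u \<inter> neighbours G w \<subseteq> pverts G" using sub by blast
    ultimately show ?thesis using card by metis
  qed
  have ne: "f u \<noteq> f w" if "u \<in> pverts G" "w \<in> pverts G" "u \<noteq> w" for u w
    using inj that by (auto dest: inj_onD)
  show ?thesis
    using G' \<open>pair_graph G\<close> bij_betw_same_card[OF bij] ne
    unfolding strongly_regular_def by (simp add: deg common arc f_in)
qed

section \<open>Nets\<close>

lemma netD:
  assumes "net k n I"
  shows net_finite_points: "finite (points I)" and net_card_points: "card (points I) = n\<^sup>2"
    and net_finite_blocks: "finite (blocks I)" and net_card_blocks: "card (blocks I) = k * n"
    and net_incid: "incid I \<subseteq> points I \<times> blocks I"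
    and net_partition: "partition_on (blocks I) (par_classes I)"
    and net_card_classes: "card (par_classes I) = k"
    and net_class_card: "\<And>C. C \<in> par_classes I \<Longrightarrow> card C = n"
    and net_block_card: "\<And>l. l \<in> blocks I \<Longrightarrow> card {p \<in> points I. (p, l) \<in> incid I} = n"
    and net_unique_block: "\<And>C p. C \<in> par_classes I \<Longrightarrow> p \<in> points I \<Longrightarrow>
          \<exists>!l. l \<in> C \<and> (p, l) \<in> incid I"
    and net_meet: "\<And>C D l m. C \<in> par_classes I \<Longrightarrow> D \<in> par_classes I \<Longrightarrow> C \<noteq> D \<Longrightarrow>
          l \<in> C \<Longrightarrow> m \<in> D \<Longrightarrow> card {p \<in> points I. (p, l) \<in> incid I \<and> (p, m) \<in> incid I} = 1"
  using assms by (simp_all add: net_def)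

lemma net_class_subset: "net k n I \<Longrightarrow> C \<in> par_classes I \<Longrightarrow> C \<subseteq> blocks I"
  using net_partition[of k n I] by (auto simp: partition_on_def)

text \<open>
  A point of some block is collinear with itself, unlike in the collinearity graph.
\<close>

definition collinear :: "('p, 'l) net_structure \<Rightarrow> 'p \<Rightarrow> 'p \<Rightarrow> bool" where
  "collinear I p q \<longleftrightarrow> (\<exists>l\<in>blocks I. (p, l) \<in> incid I \<and> (q, l) \<in> incid I)"

context
  fixes I :: "('p, 'l) net_structure" and k n :: nat
  assumes net: "net k n I"
begin

lemma net_block_class:
  assumes "l \<in> blocks I" obtains C where "C \<in> par_classes I" "l \<in> C"
  using net_partition[OF net] assms by (auto simp: partition_on_def)

lemma net_class_unique:
  assumes "C \<in> par_classes I" "D \<in> par_classes I" "l \<in> C" "l \<in> D" shows "C = D"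
  using disjointD[OF partition_onD2[OF net_partition[OF net]] assms(1,2)] assms(3,4) by blast

lemma net_finite_class: "C \<in> par_classes I \<Longrightarrow> finite C"
  using net_class_subset[OF net] net_finite_blocks[OF net] finite_subset by blast

lemma net_card_through_in_class:
  assumes "C \<in> par_classes I" "p \<in> points I"
  shows "card {l \<in> C. (p, l) \<in> incid I} = 1"
proof -
  obtain l where "l \<in> C \<and> (p, l) \<in> incid I" "\<And>m. m \<in> C \<and> (p, m) \<in> incid I \<Longrightarrow> m = l"
    using net_unique_block[OF net assms] by blast
  then have "{l \<in> C. (p, l) \<in> incid I} = {l}" by blast
  then show ?thesis by simp
qed

lemma net_card_through:
  assumes p: "p \<in> points I"
  shows "card {l \<in> blocks I. (p, l) \<in> incid I} = k"
proof -
  let ?P = "par_classes I"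
  have "finite ?P"
    using net_partition[OF net] net_finite_blocks[OF net] finite_elements by blast
  have "{l \<in> blocks I. (p, l) \<in> incid I} = (\<Union>C\<in>?P. {l \<in> C. (p, l) \<in> incid I})"
    using net_partition[OF net] by (auto simp: partition_on_def)
  also have "card \<dots> = (\<Sum>C\<in>?P. card {l \<in> C. (p, l) \<in> incid I})"
  proof (rule card_UN_disjoint)
    show "\<forall>C\<in>?P. finite {l \<in> C. (p, l) \<in> incid I}" using net_finite_class by simp
    show "\<forall>C\<in>?P. \<forall>D\<in>?P. C \<noteq> D \<longrightarrow>
        {l \<in> C. (p, l) \<in> incid I} \<inter> {l \<in> D. (p, l) \<in> incid I} = {}"
      using net_class_unique by blast
  qed fact
  also have "\<dots> = k"
    using net_card_through_in_class[OF _ p] net_card_classes[OF net] by simp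
  finally show ?thesis .
qed

lemma net_parallel_disjoint:
  assumes "C \<in> par_classes I" "l \<in> C" "m \<in> C" "p \<in> points I" "(p, l) \<in> incid I" "(p, m) \<in> incid I"
  shows "l = m"
  using net_unique_block[OF net assms(1,4)] assms by blast

lemma net_common_block_unique:
  assumes pq: "p \<in> points I" "q \<in> points I" "p \<noteq> q" and lm: "l \<in> blocks I" "m \<in> blocks I"
    and "(p, l) \<in> incid I" "(q, l) \<in> incid I" "(p, m) \<in> incid I" "(q, m) \<in> incid I"
  shows "l = m"
proof -
  obtain C D where CD: "C \<in> par_classes I" "l \<in> C" "D \<in> par_classes I" "m \<in> D"
    using net_block_class lm by metis
  show ?thesis
  proof (cases "C = D")
    case True
    then show ?thesis using net_parallel_disjoint[of C l m p] CD assms by simp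
  next
    case False
    then have "card {r \<in> points I. (r, l) \<in> incid I \<and> (r, m) \<in> incid I} = 1"
      using net_meet[OF net CD(1,3)] CD by simp
    then obtain r where "{r \<in> points I. (r, l) \<in> incid I \<and> (r, m) \<in> incid I} = {r}"
      by (auto simp: card_1_singleton_iff)
    moreover have "p \<in> {r \<in> points I. (r, l) \<in> incid I \<and> (r, m) \<in> incid I}"
      "q \<in> {r \<in> points I. (r, l) \<in> incid I \<and> (r, m) \<in> incid I}"
      using assms by simp_all
    ultimately have "p = r" "q = r" by simp_all
    then show ?thesis using pq(3) by simp
  qed
qed

lemma net_card_common_blocks:
  assumes pq: "p \<in> points I" "q \<in> points I" "p \<noteq> q"
  shows "card {l \<in> blocks I. (p, l) \<in> incid I \<and> (q, l) \<in> incid I} = (if collinear I p q then 1 else 0)"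
proof (cases "collinear I p q")
  case True
  then obtain l where l: "l \<in> blocks I" "(p, l) \<in> incid I" "(q, l) \<in> incid I"
    by (auto simp: collinear_def)
  then have "{l \<in> blocks I. (p, l) \<in> incid I \<and> (q, l) \<in> incid I} = {l}"
    using net_common_block_unique[OF pq] by blast
  then show ?thesis using True by simp
next
  case False
  then have "{l \<in> blocks I. (p, l) \<in> incid I \<and> (q, l) \<in> incid I} = {}"
    by (auto simp: collinear_def)
  then show ?thesis using False by (simp only: card.empty if_False)
qed

text \<open>
  Through \<open>p\<close> there are \<open>k - 1\<close> blocks not parallel to \<open>l\<close>; each meets \<open>l\<close> in
  one point, and distinct ones meet it in distinct points.  The proof counts the incident pairs of such a block
  and a point of \<open>l\<close> in two ways.
\<close>

lemma net_card_collinear_on_block: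
  assumes p: "p \<in> points I" and l: "l \<in> blocks I" and pl: "(p, l) \<notin> incid I"
  shows "card {q \<in> points I. (q, l) \<in> incid I \<and> collinear I p q} = k - 1"
proof -
  obtain C where C: "C \<in> par_classes I" "l \<in> C" using net_block_class[OF l] .
  \<comment> \<open>the blocks through \<open>p\<close> that are not parallel to \<open>l\<close>, and the points of \<open>l\<close> to be counted\<close>
  let ?A = "{m \<in> blocks I. (p, m) \<in> incid I} - {m \<in> C. (p, m) \<in> incid I}"
    and ?Q = "{q \<in> points I. (q, l) \<in> incid I \<and> collinear I p q}"
  have fin: "finite {m \<in> blocks I. (p, m) \<in> incid I}" using net_finite_blocks[OF net] by simp
  have sub: "{m \<in> C. (p, m) \<in> incid I} \<subseteq> {m \<in> blocks I. (p, m) \<in> incid I}"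
    using net_class_subset[OF net C(1)] by blast
  have cA: "card ?A = k - 1"
    using card_Diff_subset[OF finite_subset[OF sub fin] sub] net_card_through[OF p]
      net_card_through_in_class[OF C(1) p] by simp
  have total: "(\<Sum>m\<in>?A. card {q \<in> ?Q. (q, m) \<in> incid I}) = 1 * card ?Q"
  proof (rule sum_multicount)
    show "finite ?A" using fin by simp
    show "finite ?Q" using net_finite_points[OF net] by simp
    show "\<forall>q\<in>?Q. card {m \<in> ?A. (q, m) \<in> incid I} = 1"
    proof
      fix q assume q: "q \<in> ?Q"
      then have pq: "p \<noteq> q" using pl by blast
      have "{m \<in> ?A. (q, m) \<in> incid I} = {m \<in> blocks I. (p, m) \<in> incid I \<and> (q, m) \<in> incid I}"
      proof -
        have False if "m \<in> C" "(p, m) \<in> incid I" "(q, m) \<in> incid I" for m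
        proof -
          have "m = l" using net_parallel_disjoint[OF C(1) that(1) C(2), of q] that q by simp
          then show False using that(2) pl by simp
        qed
        then show ?thesis by blast
      qed
      then show "card {m \<in> ?A. (q, m) \<in> incid I} = 1"
        using net_card_common_blocks[OF p _ pq] q by simp
    qed
  qed
  have each: "card {q \<in> ?Q. (q, m) \<in> incid I} = 1" if m: "m \<in> ?A" for m
  proof -
    have mb: "m \<in> blocks I" "(p, m) \<in> incid I" "m \<notin> C" using m by blast+
    obtain D where D: "D \<in> par_classes I" "m \<in> D" using net_block_class[OF mb(1)] .
    have "C \<noteq> D" using D(2) mb(3) by blast
    have "{q \<in> ?Q. (q, m) \<in> incid I} = {q \<in> points I. (q, l) \<in> incid I \<and> (q, m) \<in> incid I}"
      using mb by (auto simp: collinear_def)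
    then show ?thesis using net_meet[OF net C(1) D(1) \<open>C \<noteq> D\<close> C(2) D(2)] by simp
  qed
  have "1 * card ?Q = (\<Sum>m\<in>?A. 1)"
    unfolding total[symmetric] by (rule sum.cong[OF refl each])
  then have "card ?Q = card ?A"
    by (simp only: mult_1 sum_constant of_nat_id mult_1_right)
  then show ?thesis using cA by (simp only:)
qed

end

text \<open>
  Restates the isomorphism of quotient graph and collinearity graph for vertices of the scheme in place of
  fibres, the form in which it is established in one direction and used in the other.
\<close>

lemma quotient_graph_isomorphism_iff:
  assumes fib: "fibred_graph s t (scheme_pts H) (scheme_rel H 1) (scheme_rel H 0 \<union> scheme_rel H 3)"
    (is "fibred_graph s t ?X ?B ?F")
  shows "graph_isomorphism \<phi> (quotient_graph H) (collinearity_graph I) \<longleftrightarrow>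
    bij_betw \<phi> (?X // ?F) (points I) \<and>
    (\<forall>x\<in>?X. \<forall>y\<in>?X. (x, y) \<notin> ?F \<longrightarrow>
       (collinear I (\<phi> (?F `` {x})) (\<phi> (?F `` {y})) \<longleftrightarrow> (x, y) \<in> ?F O ?B O ?F))"
proof -
  interpret fibred_graph s t ?X ?B ?F by (fact fib)
  have verts: "pverts (quotient_graph H) = ?X // ?F" "pverts (collinearity_graph I) = points I"
    by (simp_all add: quotient_graph_def fibres_def collinearity_graph_def)
  have arc: "(?F `` {x}, ?F `` {y}) \<in> parcs (quotient_graph H) \<longleftrightarrow> (x, y) \<in> ?F O ?B O ?F"
    if "x \<in> ?X" "y \<in> ?X" for x y
  proof -
    have "(\<exists>x'\<in>?F `` {x}. \<exists>y'\<in>?F `` {y}. (x', y') \<in> ?B) \<longleftrightarrow> (x, y) \<in> ?F O ?B O ?F"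
    proof
      assume "\<exists>x'\<in>?F `` {x}. \<exists>y'\<in>?F `` {y}. (x', y') \<in> ?B"
      then obtain x' where x': "x' \<in> ?F `` {x}" "\<exists>y'\<in>?F `` {y}. (x', y') \<in> ?B" by (rule bexE)
      from x'(2) obtain y' where y': "(x', y') \<in> ?B" "y' \<in> ?F `` {y}" by (rule bexE)
      have "(x, x') \<in> ?F" "(y', y) \<in> ?F"
        using x'(1) fibre_sym[of y y'] y'(2) by (simp_all only: Image_singleton_iff)
      then show "(x, y) \<in> ?F O ?B O ?F" using y'(1) by (intro relcompI)
    next
      assume "(x, y) \<in> ?F O ?B O ?F"
      then obtain x' y' where *: "(x, x') \<in> ?F" "(x', y') \<in> ?B" "(y', y) \<in> ?F" by (rule linkedE)
      then show "\<exists>x'\<in>?F `` {x}. \<exists>y'\<in>?F `` {y}. (x', y') \<in> ?B"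
        using fibre_sym[OF *(3)] by (intro bexI[of _ x'] bexI[of _ y']) (simp_all only: Image_singleton_iff)
    qed
    moreover have "?F `` {x} \<noteq> ?F `` {y}" if "(x, y) \<in> ?F O ?B O ?F"
      using linked_not_same_fibre[OF that] fibre_class_eq_iff by simp
    ultimately show ?thesis
      using quotientI[OF that(1), of ?F] quotientI[OF that(2), of ?F]
      unfolding quotient_graph_def fibres_def by (simp del: Un_iff Image_singleton_iff) blast
  qed
  have arc': "(p, q) \<in> parcs (collinearity_graph I) \<longleftrightarrow> p \<noteq> q \<and> collinear I p q"
    if "p \<in> points I" "q \<in> points I" for p q
    using that by (auto simp: collinearity_graph_def collinear_def)
  have "(\<forall>W\<in>?X // ?F. \<forall>W'\<in>?X // ?F.
        (W, W') \<in> parcs (quotient_graph H) \<longleftrightarrow> (\<phi> W, \<phi> W') \<in> parcs (collinearity_graph I))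
      \<longleftrightarrow> (\<forall>x\<in>?X. \<forall>y\<in>?X. (x, y) \<notin> ?F \<longrightarrow>
       (collinear I (\<phi> (?F `` {x})) (\<phi> (?F `` {y})) \<longleftrightarrow> (x, y) \<in> ?F O ?B O ?F))"
    if bij: "bij_betw \<phi> (?X // ?F) (points I)"
  proof -
    have pt: "\<phi> (?F `` {x}) \<in> points I" if "x \<in> ?X" for x
      by (rule bij_betw_apply[OF bij]) (rule quotientI[OF that])
    have eq: "\<phi> (?F `` {x}) = \<phi> (?F `` {y}) \<longleftrightarrow> (x, y) \<in> ?F" if "x \<in> ?X" "y \<in> ?X" for x y
      using inj_on_eq_iff[OF bij_betw_imp_inj_on[OF bij] quotientI quotientI] fibre_class_eq_iff that
      by simp
    have "((?F `` {x}, ?F `` {y}) \<in> parcs (quotient_graph H) \<longleftrightarrow>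
          (\<phi> (?F `` {x}), \<phi> (?F `` {y})) \<in> parcs (collinearity_graph I)) \<longleftrightarrow>
        ((x, y) \<notin> ?F \<longrightarrow>
          (collinear I (\<phi> (?F `` {x})) (\<phi> (?F `` {y})) \<longleftrightarrow> (x, y) \<in> ?F O ?B O ?F))"
      if "x \<in> ?X" "y \<in> ?X" for x y
      unfolding arc[OF that] arc'[OF pt[OF that(1)] pt[OF that(2)]] eq[OF that]
      using linked_not_same_fibre(3) by blast
    then show ?thesis
      unfolding quotient_def by (simp del: Un_iff)
  qed
  then show ?thesis unfolding graph_isomorphism_def verts by blast
qed

section \<open>The glued graph\<close>

lemma glued_graph_verts:
  "pverts (glued_graph H I \<phi>) = {Apex} \<union> Block ` blocks I \<union> SVertex ` scheme_pts H"
  by (simp add: glued_graph_def Let_def)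

lemma glued_graph_verts_iff:
  "Apex \<in> pverts (glued_graph H I \<phi>)"
  "Block l \<in> pverts (glued_graph H I \<phi>) \<longleftrightarrow> l \<in> blocks I"
  "SVertex x \<in> pverts (glued_graph H I \<phi>) \<longleftrightarrow> x \<in> scheme_pts H"
  by (auto simp: glued_graph_verts)

lemma glued_graph_arcs:
  "(Apex, Apex) \<notin> parcs (glued_graph H I \<phi>)"
  "(Apex, Block l) \<in> parcs (glued_graph H I \<phi>) \<longleftrightarrow> l \<in> blocks I"
  "(Block l, Apex) \<in> parcs (glued_graph H I \<phi>) \<longleftrightarrow> l \<in> blocks I"
  "(Apex, SVertex x) \<notin> parcs (glued_graph H I \<phi>)"
  "(SVertex x, Apex) \<notin> parcs (glued_graph H I \<phi>)"
  "(Block l, Block m) \<in> parcs (glued_graph H I \<phi>)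
     \<longleftrightarrow> l \<in> blocks I \<and> m \<in> blocks I \<and> l \<noteq> m \<and> parallel I l m"
  "(Block l, SVertex x) \<in> parcs (glued_graph H I \<phi>)
     \<longleftrightarrow> l \<in> blocks I \<and> (\<exists>W\<in>fibres H. x \<in> W \<and> (\<phi> W, l) \<in> incid I)"
  "(SVertex x, Block l) \<in> parcs (glued_graph H I \<phi>)
     \<longleftrightarrow> l \<in> blocks I \<and> (\<exists>W\<in>fibres H. x \<in> W \<and> (\<phi> W, l) \<in> incid I)"
  "(SVertex x, SVertex y) \<in> parcs (glued_graph H I \<phi>)
     \<longleftrightarrow> (x, y) \<in> scheme_rel H 1 \<or> (y, x) \<in> scheme_rel H 1"
  by (auto simp: glued_graph_def Let_def parallel_def)

section \<open>From a regular point to a net\<close>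

text \<open>
  The situation at a regular point \<open>v\<close>: \<open>D\<close> will be the blocks of the net and the fibres in
  \<open>X\<close> its points.
\<close>

locale fibred_second_subconstituent =
  fixes G :: "'a pair_pre_digraph" and v :: 'a and s t :: nat and F :: "('a \<times> 'a) set"
    and D X :: "'a set"
  assumes t_ge: "2 \<le> t" and t_le: "t \<le> s"
    and srg: "strongly_regular G ((t * s + 1) * (s + 1)) ((t + 1) * s) (s - 1) (t + 1)"
    and v: "v \<in> pverts G"
    and D_def: "D = neighbours G v"
    and X_def: "X = pverts G - {v} - neighbours G v"
    and fibred: "fibred_graph s t X (parcs G \<inter> X \<times> X) F"
begin

sublocale fibred_graph s t X "parcs G \<inter> X \<times> X" F
  by (fact fibred)

abbreviation N :: "'a \<Rightarrow> 'a set" where "N \<equiv> neighbours G"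

lemma pair_graph_G: "pair_graph G"
  using srg by (simp add: strongly_regular_def)

lemma finite_verts: "finite (pverts G)"
proof -
  interpret pair_graph G by (fact pair_graph_G)
  show ?thesis by (rule pair_finite_verts)
qed

lemma N_iff: "w \<in> N u \<longleftrightarrow> (u, w) \<in> parcs G"
proof -
  interpret pair_graph G by (fact pair_graph_G)
  show ?thesis by (auto simp: neighbours_def dest: in_arcsD2)
qed

lemma N_sym: "w \<in> N u \<longleftrightarrow> u \<in> N w"
proof -
  interpret pair_graph G by (fact pair_graph_G)
  show ?thesis unfolding N_iff using arcs_symmetric by blast
qed

lemma N_irrefl: "u \<notin> N u"
proof -
  interpret pair_graph G by (fact pair_graph_G)
  show ?thesis unfolding N_iff using no_loops[of "(u, u)"] by auto
qed

lemma N_subset: "N u \<subseteq> pverts G"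
  by (auto simp: neighbours_def)

lemma finite_N: "finite (N u)"
  using finite_verts N_subset finite_subset by blast

lemma verts_split: "pverts G = insert v (D \<union> X)" "v \<notin> D" "v \<notin> X" "D \<inter> X = {}"
  using v N_irrefl[of v] N_subset[of v] by (auto simp: D_def X_def)

lemma finite_D: "finite D"
  using finite_N by (simp add: D_def)

lemma D_verts: "d \<in> D \<Longrightarrow> d \<in> pverts G" and X_verts: "x \<in> X \<Longrightarrow> x \<in> pverts G"
  using verts_split by auto

lemma X_not_D: "x \<in> X \<Longrightarrow> x \<notin> D"
  using verts_split(4) by auto

lemma v_adjacent: "v \<in> N u \<longleftrightarrow> u \<in> D"
  using N_sym by (simp add: D_def)

lemma card_split:
  assumes "A \<subseteq> pverts G"
  shows "card A = (if v \<in> A then 1 else 0) + card (A \<inter> D) + card (A \<inter> X)"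
proof -
  have "A = (A \<inter> {v}) \<union> ((A \<inter> D) \<union> (A \<inter> X))" using assms verts_split(1) by auto
  then have "card A = card ((A \<inter> {v}) \<union> ((A \<inter> D) \<union> (A \<inter> X)))" by simp
  also have "\<dots> = card (A \<inter> {v}) + (card (A \<inter> D) + card (A \<inter> X))"
    using verts_split finite_D finite_X by (subst card_Un_disjoint; (subst card_Un_disjoint)?) auto
  finally show ?thesis by auto
qed

lemma degree: "u \<in> pverts G \<Longrightarrow> card (N u) = (t + 1) * s"
  and common_adj: "u \<in> pverts G \<Longrightarrow> w \<in> pverts G \<Longrightarrow> w \<in> N u \<Longrightarrow> card (N u \<inter> N w) = s - 1"
  and common_nonadj: "u \<in> pverts G \<Longrightarrow> w \<in> pverts G \<Longrightarrow> u \<noteq> w \<Longrightarrow> w \<notin> N u \<Longrightarrow>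
        card (N u \<inter> N w) = t + 1"
  using srg unfolding strongly_regular_def N_iff by blast+

lemma common_split:
  assumes "u \<in> pverts G" "w \<in> pverts G" "u \<noteq> w"
  shows "(if u \<in> D \<and> w \<in> D then 1 else 0) + card (N u \<inter> N w \<inter> D) + card (N u \<inter> N w \<inter> X)
      = (if w \<in> N u then s - 1 else t + 1)"
proof -
  have "N u \<inter> N w \<subseteq> pverts G" using N_subset by auto
  from card_split[OF this] show ?thesis
    using common_adj[OF assms(1,2)] common_nonadj[OF assms] by (simp add: v_adjacent)
qed

lemma card_D: "card D = (t + 1) * s"
  using degree[OF v] by (simp add: D_def)

lemma card_X: "card X = s\<^sup>2 * t"
proof -
  have "card (pverts G) = (t * s + 1) * (s + 1)"
    using srg by (simp add: strongly_regular_def)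
  then have "1 + (t + 1) * s + card X = (t * s + 1) * (s + 1)"
    using card_split[of "pverts G"] v verts_split(1) card_D by (simp add: Int_absorb1 subset_insertI2)
  then show ?thesis by (simp add: algebra_simps power2_eq_square)
qed

lemma N_Int_X: "x \<in> X \<Longrightarrow> N x \<inter> X = (parcs G \<inter> X \<times> X) `` {x}"
  by (auto simp: N_iff)

lemma point_degree:
  assumes x: "x \<in> X" shows "card (N x \<inter> D) = t + 1"
proof -
  have "card (N x) = card (N x \<inter> D) + card (N x \<inter> X)"
    using card_split[OF N_subset] x v_adjacent verts_split by auto
  also have "card (N x \<inter> X) = (s - 1) * (t + 1)"
    unfolding N_Int_X[OF x] by (rule valency[OF x])
  finally have "(t + 1) * s = card (N x \<inter> D) + (s - 1) * (t + 1)"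
    using degree x X_verts by simp
  moreover have "(t + 1) * s = (t + 1) + (s - 1) * (t + 1)"
    using t_ge t_le by (cases s) auto
  ultimately show ?thesis by simp
qed

text \<open>
  The common neighbours in \<open>D\<close> are those prescribed by strong regularity minus those in \<open>X\<close>;
  the vertex \<open>v\<close> itself has no neighbour in \<open>X\<close>.
\<close>

lemma common_blocks:
  assumes x: "x \<in> X" and y: "y \<in> X" and "x \<noteq> y"
  shows "card (N x \<inter> N y \<inter> D) + card ((parcs G \<inter> X \<times> X) `` {x} \<inter> (parcs G \<inter> X \<times> X) `` {y})
      = (if (x, y) \<in> parcs G then s - 1 else t + 1)"
proof -
  have "N x \<inter> N y \<inter> X = (parcs G \<inter> X \<times> X) `` {x} \<inter> (parcs G \<inter> X \<times> X) `` {y}"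
    using x y by (auto simp: N_iff)
  then show ?thesis
    using common_split[OF X_verts[OF x] X_verts[OF y] \<open>x \<noteq> y\<close>] X_not_D[OF x] by (simp add: N_iff)
qed

text \<open>
  Both vertices have \<open>t + 1\<close> neighbours in \<open>D\<close>, and all \<open>t + 1\<close> of their common
  neighbours are in \<open>D\<close>.
\<close>

lemma same_fibre_same_blocks:
  assumes "(x, y) \<in> F"
  shows "N x \<inter> D = N y \<inter> D"
proof (cases "x = y")
  case False
  have X: "x \<in> X" "y \<in> X" using fibre_subset assms by auto
  have "(x, y) \<notin> parcs G" using B_F_disjoint assms X by auto
  then have c: "card (N x \<inter> N y \<inter> D) = t + 1"
    using common_blocks[OF X False] common_fibre[OF assms False] by simp
  have "N x \<inter> N y \<inter> D = N z \<inter> D" if "z \<in> {x, y}" for z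
    by (rule card_subset_eq) (use that finite_N c point_degree X in auto)
  then show ?thesis by blast
qed simp

lemma linked_common_block:
  assumes "(x, y) \<in> F O (parcs G \<inter> X \<times> X) O F"
  shows "card (N x \<inter> N y \<inter> D) = 1"
proof -
  have X: "x \<in> X" "y \<in> X" and "(x, y) \<notin> F"
    by (rule linked_not_same_fibre[OF assms])+
  then have ne: "x \<noteq> y" using fibre_refl by auto
  show ?thesis
  proof (cases "(x, y) \<in> parcs G")
    case True
    then show ?thesis
      using common_blocks[OF X ne] common_adjacent[of x y] X t_ge t_le by simp
  next
    case False
    then show ?thesis
      using common_blocks[OF X ne] common_linked[OF assms] by simp
  qed
qed

lemma unlinked_no_common_block:
  assumes X: "x \<in> X" "y \<in> X" and F: "(x, y) \<notin> F"
    and L: "(x, y) \<notin> F O (parcs G \<inter> X \<times> X) O F"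
  shows "N x \<inter> N y \<inter> D = {}"
proof -
  have ne: "x \<noteq> y" using F X fibre_refl by auto
  have "(x, y) \<notin> parcs G" using L X fibre_refl by blast
  then have "card (N x \<inter> N y \<inter> D) = 0"
    using common_blocks[OF X ne] common_unlinked[OF X F L] by simp
  then show ?thesis using finite_D by (simp add: card_eq_0_iff)
qed

text \<open>
  The step that turns adjacency in \<open>D\<close> into parallelism.  For each neighbour \<open>e\<close> of \<open>x\<close>
  in \<open>D\<close>, the common neighbours of \<open>x\<close> and \<open>e\<close> number \<open>s - 1\<close>, and none is
  \<open>v\<close>.  Those in \<open>X\<close>, summed over the \<open>t + 1\<close> choices of \<open>e\<close>, already make up
  \<open>(s - 1) * (t + 1)\<close>: this is the valency of \<open>x\<close> in \<open>X\<close>, and each neighbour is counted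
  once since it shares exactly one block with \<open>x\<close>.  Nothing is left for \<open>D\<close>.
\<close>

lemma blocks_of_point_nonadjacent:
  assumes x: "x \<in> X" and d: "d \<in> D" "d \<in> N x"
  shows "N x \<inter> N d \<inter> D = {}"
proof -
  let ?B = "(parcs G \<inter> X \<times> X) `` {x}" and ?S = "N x \<inter> D"
  have each: "card (N x \<inter> N e \<inter> D) + card (N x \<inter> N e \<inter> X) = s - 1" if "e \<in> ?S" for e
    using common_split[OF X_verts[OF x] D_verts, of e] that X_not_D[OF x] by (cases "x = e") simp_all
  \<comment> \<open>Each neighbour of \<open>x\<close> in \<open>X\<close> shares exactly one block with \<open>x\<close>.\<close>
  have "(\<Sum>e\<in>?S. card {y \<in> ?B. y \<in> N e}) = 1 * card ?B"
  proof (rule sum_multicount)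
    show "finite ?S" "finite ?B" using finite_D finite_N[of x] N_Int_X[OF x, symmetric] by auto
    show "\<forall>y\<in>?B. card {e \<in> ?S. y \<in> N e} = 1"
    proof
      fix y assume "y \<in> ?B"
      then have "(x, y) \<in> F O (parcs G \<inter> X \<times> X) O F" using fibre_refl by blast
      moreover have "{e \<in> ?S. y \<in> N e} = N x \<inter> N y \<inter> D" using N_sym by auto
      ultimately show "card {e \<in> ?S. y \<in> N e} = 1" using linked_common_block by simp
    qed
  qed
  moreover have "{y \<in> ?B. y \<in> N e} = N x \<inter> N e \<inter> X" for e
    using N_Int_X[OF x] by auto
  ultimately have total: "(\<Sum>e\<in>?S. card (N x \<inter> N e \<inter> X)) = (s - 1) * (t + 1)"
    using valency[OF x] by simp
  have "(\<Sum>e\<in>?S. card (N x \<inter> N e \<inter> D)) + (\<Sum>e\<in>?S. card (N x \<inter> N e \<inter> X)) = (\<Sum>e\<in>?S. s - 1)"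
    unfolding sum.distrib[symmetric] by (rule sum.cong) (auto simp: each)
  also have "\<dots> = (s - 1) * (t + 1)" using point_degree[OF x] by simp
  finally have "(\<Sum>e\<in>?S. card (N x \<inter> N e \<inter> D)) = 0" using total by simp
  then have "card (N x \<inter> N d \<inter> D) = 0" using d finite_D by simp
  then show ?thesis using finite_D by (simp add: card_eq_0_iff)
qed

definition par :: "('a \<times> 'a) set" where
  "par = {(d, e) \<in> D \<times> D. d = e \<or> e \<in> N d}"

text \<open>
  A common neighbour in \<open>X\<close> would be on two blocks that are adjacent.  Of the \<open>s - 1\<close> common neighbours one
  is \<open>v\<close>, and the others lie in \<open>D\<close>.
\<close>

lemma adjacent_blocks_common:
  assumes d: "d \<in> D" and e: "e \<in> D" "e \<in> N d"
  shows "N d \<inter> N e \<inter> X = {}" "card (N d \<inter> N e \<inter> D) = s - 2"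
proof -
  show X: "N d \<inter> N e \<inter> X = {}"
  proof (rule ccontr)
    assume "N d \<inter> N e \<inter> X \<noteq> {}"
    then obtain x where "x \<in> X" "x \<in> N d" "x \<in> N e" by auto
    then have x: "x \<in> X" "d \<in> N x" "e \<in> N x"
      by (simp_all add: N_sym[of x d] N_sym[of x e])
    then have "N x \<inter> N d \<inter> D = {}" using blocks_of_point_nonadjacent d by simp
    then show False using x e by auto
  qed
  have "d \<noteq> e" using e N_irrefl by auto
  then show "card (N d \<inter> N e \<inter> D) = s - 2"
    using common_split[OF D_verts D_verts, of d e] d e X by auto
qed

lemma block_degree:
  assumes d: "d \<in> D" shows "card (N d \<inter> D) = s - 1" "card (N d \<inter> X) = s * t"
proof -
  have "d \<in> N v" using d by (simp add: D_def)
  then have "card (N v \<inter> N d) = s - 1" using common_adj[OF v D_verts[OF d]] by simp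
  then show 1: "card (N d \<inter> D) = s - 1" unfolding D_def by (subst Int_commute)
  have "v \<in> N d" using d by (simp add: v_adjacent)
  then have "(t + 1) * s = 1 + (s - 1) + card (N d \<inter> X)"
    using card_split[OF N_subset[of d]] unfolding degree[OF D_verts[OF d]] 1 by (simp only: if_True)
  moreover have "1 + (s - 1) = s" using t_ge t_le by simp
  moreover have "(t + 1) * s = s + s * t" by simp
  ultimately show "card (N d \<inter> X) = s * t" by linarith
qed

text \<open>
  The neighbours of \<open>e\<close> in \<open>D\<close> are \<open>s - 1\<close> in number, and by \<open>adjacent_blocks_common\<close>
  each of them is adjacent to the \<open>s - 2\<close> others: a clique.
\<close>

lemma par_equiv: "equiv D par"
proof (rule equivI)
  show "par \<subseteq> D \<times> D" "refl_on D par" by (auto simp: par_def refl_on_def)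
  show "sym par" using N_sym by (auto simp: par_def sym_def)
  have closed: "f \<in> N d" if "d \<in> D" "e \<in> D" "f \<in> D" "e \<in> N d" "f \<in> N e" "d \<noteq> f" for d e f
  proof -
    have "N d \<inter> N e \<inter> D = (N e \<inter> D) - {d}"
    proof (rule card_subset_eq)
      show "finite (N e \<inter> D - {d})" using finite_D by simp
      show "N d \<inter> N e \<inter> D \<subseteq> N e \<inter> D - {d}" using N_irrefl by auto
      have "d \<in> N e \<inter> D" using that N_sym[of d e] by simp
      then show "card (N d \<inter> N e \<inter> D) = card (N e \<inter> D - {d})"
        using adjacent_blocks_common(2)[of d e] block_degree(1)[of e] that by simp
    qed
    then show ?thesis using that by blast
  qed
  show "trans par"
  proof (rule transI)
    fix d e f assume "(d, e) \<in> par" "(e, f) \<in> par"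
    then show "(d, f) \<in> par" using closed[of d e f] by (auto simp: par_def)
  qed
qed

lemma par_class_card:
  assumes "C \<in> D // par" shows "card C = s"
proof -
  obtain d where d: "d \<in> D" "C = par `` {d}" using assms by (rule quotientE)
  then have "C = insert d (N d \<inter> D)" by (auto simp: par_def)
  then show ?thesis using block_degree(1)[OF d(1)] N_irrefl finite_D t_ge t_le by simp
qed

lemma finite_par_classes: "finite (D // par)"
  using finite_D par_equiv by (meson equiv_type finite_quotient)

lemma card_par_classes: "card (D // par) = t + 1"
proof -
  have "s * card (D // par) = card (\<Union>(D // par))"
  proof (rule card_partition)
    show "finite (\<Union>(D // par))" using finite_D Union_quotient[OF par_equiv] by simp
    show "C \<inter> C' = {}" if "C \<in> D // par" "C' \<in> D // par" "C \<noteq> C'" for C C'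
      using quotient_disj[OF par_equiv] that by blast
  qed (use finite_par_classes par_class_card in auto)
  then have "s * card (D // par) = s * (t + 1)"
    unfolding Union_quotient[OF par_equiv] card_D by simp
  moreover have "s \<noteq> 0" using t_ge t_le by simp
  ultimately show ?thesis by (simp only: mult_cancel1 simp_thms)
qed

text \<open>
  The \<open>t + 1\<close> blocks of \<open>x\<close> are pairwise non-parallel and there are \<open>t + 1\<close> classes.
\<close>

lemma unique_block_in_class:
  assumes x: "x \<in> X" and C: "C \<in> D // par"
  shows "\<exists>!d. d \<in> C \<and> d \<in> N x"
proof -
  let ?g = "\<lambda>d. par `` {d}"
  have inj: "inj_on ?g (N x \<inter> D)"
  proof (rule inj_onI)
    fix d e assume d: "d \<in> N x \<inter> D" and e: "e \<in> N x \<inter> D" and "?g d = ?g e"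
    then have "(d, e) \<in> par" using eq_equiv_class_iff[OF par_equiv] by auto
    then show "d = e" using blocks_of_point_nonadjacent[OF x, of d] d e by (auto simp: par_def)
  qed
  have "?g ` (N x \<inter> D) = D // par"
  proof (rule card_subset_eq)
    show "?g ` (N x \<inter> D) \<subseteq> D // par" by (auto intro: quotientI)
    show "card (?g ` (N x \<inter> D)) = card (D // par)"
      using card_image[OF inj] point_degree[OF x] card_par_classes by simp
  qed (rule finite_par_classes)
  then obtain d where d: "d \<in> N x" "d \<in> D" "C = ?g d" using C by auto
  have "e = d" if "e \<in> C" "e \<in> N x" for e
  proof -
    have par: "(d, e) \<in> par" using that(1) d(3) by simp
    then have "e \<in> D" by (simp add: par_def)
    show ?thesis
    proof (rule inj_onD[OF inj])
      show "?g e = ?g d" using equiv_class_eq[OF par_equiv par] by simp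
    qed (use that(2) d \<open>e \<in> D\<close> in simp_all)
  qed
  moreover have "d \<in> C" using d equiv_class_self[OF par_equiv] by simp
  ultimately show ?thesis using d(1) by blast
qed

text \<open>
  Of the \<open>t + 1\<close> common neighbours one is \<open>v\<close>, and a common neighbour in \<open>D\<close> would make the two
  blocks parallel.
\<close>

lemma nonparallel_blocks_common:
  assumes d: "d \<in> D" and e: "e \<in> D" and np: "(d, e) \<notin> par"
  shows "card (N d \<inter> N e \<inter> X) = t"
proof -
  have "N d \<inter> N e \<inter> D = {}"
  proof (rule ccontr)
    assume "N d \<inter> N e \<inter> D \<noteq> {}"
    then obtain f where "f \<in> D" "f \<in> N d" "f \<in> N e" by auto
    then have "(d, f) \<in> par" "(f, e) \<in> par" using d e N_sym by (auto simp: par_def)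
    then show False using np par_equiv by (meson equivE transD)
  qed
  then show ?thesis
    using common_split[OF D_verts[OF d] D_verts[OF e]] np d e by (auto simp: par_def)
qed

definition fibre_net :: "('a set, 'a) net_structure" where
  "fibre_net = \<lparr>points = X // F, blocks = D,
     incid = {(W, d). W \<in> X // F \<and> d \<in> D \<and> (\<exists>x\<in>W. d \<in> N x)}, par_classes = D // par\<rparr>"

lemma incid_iff:
  assumes "x \<in> X"
  shows "(F `` {x}, d) \<in> incid fibre_net \<longleftrightarrow> d \<in> D \<and> d \<in> N x"
  using assms same_fibre_same_blocks fibre_refl by (auto simp: fibre_net_def intro: quotientI)

lemma incid_iff_subset:
  assumes "W \<in> X // F" "d \<in> D"
  shows "(W, d) \<in> incid fibre_net \<longleftrightarrow> W \<subseteq> N d \<inter> X"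
proof -
  obtain x where x: "x \<in> X" "W = F `` {x}" using assms(1) by (rule fibreE)
  have "d \<in> N x \<longleftrightarrow> W \<subseteq> N d \<inter> X"
    using x same_fibre_same_blocks[of x] fibre_refl[of x] fibre_subset[of x] assms(2) N_sym[of d]
    by blast
  then show ?thesis using incid_iff[OF x(1)] x(2) assms(2) by simp
qed

lemma card_points_on:
  assumes S: "S \<subseteq> D"
  shows "t * card {W \<in> X // F. \<forall>d\<in>S. (W, d) \<in> incid fibre_net} = card {x \<in> X. \<forall>d\<in>S. x \<in> N d}"
proof -
  let ?A = "{x \<in> X. \<forall>d\<in>S. x \<in> N d}"
  have "t * card {W \<in> X // F. W \<subseteq> ?A} = card ?A"
  proof (rule card_fibres_within)
    fix x y assume x: "x \<in> ?A" and xy: "(x, y) \<in> F"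
    then show "y \<in> ?A" using same_fibre_same_blocks[OF xy] fibre_subset[OF xy] N_sym S by blast
  qed auto
  moreover have "W \<subseteq> ?A \<longleftrightarrow> (\<forall>d\<in>S. (W, d) \<in> incid fibre_net)" if W: "W \<in> X // F" for W
  proof -
    have WX: "W \<subseteq> X" using fibre_member[OF W] by blast
    have "(W, d) \<in> incid fibre_net \<longleftrightarrow> W \<subseteq> N d" if "d \<in> S" for d
      using incid_iff_subset[OF W, of d] WX S that by blast
    then show ?thesis using WX by (simp add: subset_iff) blast
  qed
  then have "{W \<in> X // F. W \<subseteq> ?A} = {W \<in> X // F. \<forall>d\<in>S. (W, d) \<in> incid fibre_net}"
    by (intro Collect_cong conj_cong refl)
  ultimately show ?thesis by simp
qed

lemma net_fibre_net: "net (t + 1) s fibre_net"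
proof -
  have t0: "t \<noteq> 0" using t_ge by simp
  have "t * card (X // F) = t * s\<^sup>2"
    using card_points_on[of "{}"] card_X t0 by simp
  then have points: "card (X // F) = s\<^sup>2" using t0 by simp
  have on: "card {W \<in> X // F. (W, d) \<in> incid fibre_net} = s" if "d \<in> D" for d
  proof -
    have "{x \<in> X. x \<in> N d} = N d \<inter> X" by auto
    then have "t * card {W \<in> X // F. (W, d) \<in> incid fibre_net} = t * s"
      using card_points_on[of "{d}"] block_degree(2)[OF that] that by (simp add: mult.commute)
    then show ?thesis using t0 by simp
  qed
  have one: "\<exists>!d. d \<in> C \<and> (W, d) \<in> incid fibre_net" if C: "C \<in> D // par" and W: "W \<in> X // F" for C W
  proof -
    obtain x where x: "x \<in> X" "W = F `` {x}" using W by (rule fibreE)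
    have "d \<in> C \<and> (W, d) \<in> incid fibre_net \<longleftrightarrow> d \<in> C \<and> d \<in> N x" for d
      using incid_iff[OF x(1)] x(2) C Union_quotient[OF par_equiv] by blast
    then show ?thesis using unique_block_in_class[OF x(1) C] by simp
  qed
  have meet: "card {W \<in> X // F. (W, d) \<in> incid fibre_net \<and> (W, e) \<in> incid fibre_net} = 1"
    if C: "C \<in> D // par" "C' \<in> D // par" "C \<noteq> C'" and de: "d \<in> C" "e \<in> C'" for C C' d e
  proof -
    have D: "d \<in> D" "e \<in> D" using C de Union_quotient[OF par_equiv] by auto
    have "(d, e) \<notin> par" using C de quotient_eqI[OF par_equiv] by blast
    then have "card (N d \<inter> N e \<inter> X) = t" using nonparallel_blocks_common D by simp
    moreover have "{x \<in> X. \<forall>f\<in>{d, e}. x \<in> N f} = N d \<inter> N e \<inter> X" by auto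
    ultimately have "t * card {W \<in> X // F. (W, d) \<in> incid fibre_net \<and> (W, e) \<in> incid fibre_net} = t"
      using card_points_on[of "{d, e}"] D by simp
    then show ?thesis using t0 by simp
  qed
  show ?thesis
    unfolding net_def
    using finite_fibres points finite_D card_D partition_on_quotient[OF par_equiv]
      card_par_classes par_class_card on one meet
    by (auto simp: fibre_net_def)
qed

lemma collinear_iff_linked:
  assumes X: "x \<in> X" "y \<in> X" and F: "(x, y) \<notin> F"
  shows "(\<exists>d\<in>D. (F `` {x}, d) \<in> incid fibre_net \<and> (F `` {y}, d) \<in> incid fibre_net)
      \<longleftrightarrow> (x, y) \<in> F O (parcs G \<inter> X \<times> X) O F"
proof -
  have "(\<exists>d\<in>D. (F `` {x}, d) \<in> incid fibre_net \<and> (F `` {y}, d) \<in> incid fibre_net)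
      \<longleftrightarrow> N x \<inter> N y \<inter> D \<noteq> {}"
    by (auto simp: incid_iff X)
  then show ?thesis
    using unlinked_no_common_block[OF X F] linked_common_block[of x y] by fastforce
qed

lemma parallel_iff: "d \<in> D \<Longrightarrow> e \<in> D \<Longrightarrow> parallel fibre_net d e \<longleftrightarrow> (d, e) \<in> par"
proof -
  assume D: "d \<in> D" "e \<in> D"
  have "parallel fibre_net d e \<longleftrightarrow> (\<exists>C\<in>D // par. d \<in> C \<and> e \<in> C)"
    by (simp add: parallel_def fibre_net_def)
  also have "\<dots> \<longleftrightarrow> (d, e) \<in> par"
    using D equiv_class_self[OF par_equiv D(1)] quotient_eqI[OF par_equiv]
    by (auto intro!: bexI[of _ "par `` {d}"] quotientI elim!: quotientE)
       (meson equivE par_equiv symD transD)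
  finally show ?thesis .
qed

end

context fibred_second_subconstituent
begin

lemma fibre_net_simps:
  "points fibre_net = X // F" "blocks fibre_net = D" "par_classes fibre_net = D // par"
  by (simp_all add: fibre_net_def)

lemma quotient_isomorphic_fibre_net:
  assumes H: "scheme_pts H = X" "scheme_rel H 1 = parcs G \<inter> X \<times> X" "scheme_rel H 0 \<union> scheme_rel H 3 = F"
  shows "graph_isomorphism (\<lambda>W. W) (quotient_graph H) (collinearity_graph fibre_net)"
proof -
  have fib: "fibred_graph s t (scheme_pts H) (scheme_rel H 1) (scheme_rel H 0 \<union> scheme_rel H 3)"
    unfolding H by (rule fibred)
  show ?thesis
    unfolding quotient_graph_isomorphism_iff[OF fib] unfolding H fibre_net_simps
    using collinear_iff_linked by (simp add: collinear_def fibre_net_simps bij_betw_def)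
qed

definition sort_vertex :: "'a \<Rightarrow> ('a, 'a) gvertex" where
  "sort_vertex u = (if u = v then Apex else if u \<in> D then Block u else SVertex u)"

lemma isomorphic_glued_graph:
  assumes H: "scheme_pts H = X" "scheme_rel H 1 = parcs G \<inter> X \<times> X" "scheme_rel H 0 \<union> scheme_rel H 3 = F"
  shows "graph_isomorphism sort_vertex G (glued_graph H fibre_net (\<lambda>W. W))"
    (is "graph_isomorphism ?f G ?G'")
proof -
  have verts: "u = v \<or> u \<in> D \<or> u \<in> X" if "u \<in> pverts G" for u
    using that verts_split(1) by auto
  have f: "?f v = Apex" "\<And>d. d \<in> D \<Longrightarrow> ?f d = Block d" "\<And>x. x \<in> X \<Longrightarrow> ?f x = SVertex x"
    using verts_split by (auto simp: sort_vertex_def)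
  have bij: "bij_betw ?f (pverts G) (pverts ?G')"
    unfolding bij_betw_def
  proof
    show "inj_on ?f (pverts G)" by (auto simp: inj_on_def sort_vertex_def split: if_splits)
    have *: "?f ` D = Block ` D" "?f ` X = SVertex ` X"
      by (rule image_cong[OF refl], erule f)+
    show "?f ` pverts G = pverts ?G'"
      unfolding verts_split(1) image_insert image_Un * f(1) glued_graph_verts fibre_net_simps H
      by (simp only: insert_is_Un[symmetric] Un_insert_left Un_empty_left)
  qed
  have block: "(Block d, SVertex x) \<in> parcs ?G' \<longleftrightarrow> d \<in> N x"
    "(SVertex x, Block d) \<in> parcs ?G' \<longleftrightarrow> d \<in> N x" if d: "d \<in> D" and x: "x \<in> X" for d x
  proof -
    have "(\<exists>W\<in>fibres H. x \<in> W \<and> (W, d) \<in> incid fibre_net) \<longleftrightarrow> (F `` {x}, d) \<in> incid fibre_net"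
    proof
      assume "\<exists>W\<in>fibres H. x \<in> W \<and> (W, d) \<in> incid fibre_net"
      then obtain W where W: "x \<in> W \<and> (W, d) \<in> incid fibre_net" "W \<in> fibres H" by (rule bexE)
      then have "W = F `` {x}" using fibre_member[of W x] by (simp only: fibres_def H)
      then show "(F `` {x}, d) \<in> incid fibre_net" using W(1) by simp
    next
      assume "(F `` {x}, d) \<in> incid fibre_net"
      moreover have "x \<in> F `` {x}" using fibre_refl[OF x] by simp
      ultimately show "\<exists>W\<in>fibres H. x \<in> W \<and> (W, d) \<in> incid fibre_net"
        using quotientI[OF x, of F] unfolding fibres_def H by (intro bexI conjI)
    qed
    then show "(Block d, SVertex x) \<in> parcs ?G' \<longleftrightarrow> d \<in> N x"
      "(SVertex x, Block d) \<in> parcs ?G' \<longleftrightarrow> d \<in> N x"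
      unfolding glued_graph_arcs fibre_net_simps using incid_iff[OF x] d by simp_all
  qed
  have arc: "(u, w) \<in> parcs G \<longleftrightarrow> (?f u, ?f w) \<in> parcs ?G'" if uw: "u \<in> pverts G" "w \<in> pverts G" for u w
  proof -
    have vD: "d \<in> N v \<longleftrightarrow> d \<in> D" for d by (simp add: D_def)
    from verts[OF uw(1)] verts[OF uw(2)] consider
        "u = v" "w = v" | "u = v" "w \<in> D" | "u = v" "w \<in> X"
      | "u \<in> D" "w = v" | "u \<in> D" "w \<in> D" | "u \<in> D" "w \<in> X"
      | "u \<in> X" "w = v" | "u \<in> X" "w \<in> D" | "u \<in> X" "w \<in> X" by blast
    then have "w \<in> N u \<longleftrightarrow> (?f u, ?f w) \<in> parcs ?G'"
    proof cases
      case 1 then show ?thesis by (simp only: f glued_graph_arcs N_irrefl simp_thms)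
    next
      case 2 then show ?thesis by (simp only: f glued_graph_arcs fibre_net_simps vD)
    next
      case 3 then show ?thesis using X_not_D by (simp only: f glued_graph_arcs vD simp_thms)
    next
      case 4 then show ?thesis by (simp only: f glued_graph_arcs fibre_net_simps v_adjacent)
    next
      case 5
      then show ?thesis
        using N_irrefl parallel_iff[OF 5]
        by (simp only: f glued_graph_arcs fibre_net_simps) (auto simp: par_def)
    next
      case 6 then show ?thesis using block[of u w] N_sym[of w u] by (simp only: f)
    next
      case 7 then show ?thesis using X_not_D by (simp only: f glued_graph_arcs v_adjacent simp_thms)
    next
      case 8 then show ?thesis using block[of w u] by (simp only: f)
    next
      case 9
      then show ?thesis
        using N_sym[of u w] by (simp only: f glued_graph_arcs H N_iff) blast
    qed
    then show ?thesis by (simp only: N_iff)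
  qed
  show ?thesis unfolding graph_isomorphism_def using bij arc by blast
qed

end

text \<open>
  The points of the net are the fibres themselves, so that the identity serves as the bijection from fibres to points.
\<close>

lemma regular_point_imp_glued_graph:
  fixes G :: "'v pair_pre_digraph"
  assumes st: "2 \<le> t" "t \<le> s"
    and srg: "strongly_regular G ((t * s + 1) * (s + 1)) ((t + 1) * s) (s - 1) (t + 1)"
    and reg: "regular_point s t G v"
  shows "\<exists>(H :: 'v scheme) (I :: ('v set, 'v) net_structure) f.
    scheme_with_eigenmatrix_P s t H \<and> net (t + 1) s I \<and>
    graph_isomorphism (\<lambda>W. W) (quotient_graph H) (collinearity_graph I) \<and>
    graph_isomorphism f G (glued_graph H I (\<lambda>W. W))"
proof -
  let ?X = "pverts G - {v} - neighbours G v"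
  obtain H where v: "v \<in> pverts G" and gen: "generates_scheme (subconstituent G 2 v) H"
    and H: "scheme_with_eigenmatrix_P s t H" and B: "scheme_rel H 1 = parcs (subconstituent G 2 v)"
    using reg unfolding regular_point_def by blast
  have sub: "subconstituent G 2 v = pair_induced G ?X"
    by (rule second_subconstituent_strongly_regular[OF srg _ v]) simp
  have pts: "scheme_pts H = ?X"
    using gen unfolding generates_scheme_def sub by (simp add: pair_induced_def)
  have rel: "scheme_rel H 1 = parcs G \<inter> ?X \<times> ?X"
    unfolding B sub by (simp add: pair_induced_def)
  interpret fibred_second_subconstituent G v s t "scheme_rel H 0 \<union> scheme_rel H 3" "neighbours G v" ?X
    using scheme_fibred_graph[OF st H] st srg v
    unfolding pts rel by (intro fibred_second_subconstituent.intro) auto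
  show ?thesis
    using H net_fibre_net quotient_isomorphic_fibre_net[OF pts rel refl]
      isomorphic_glued_graph[OF pts rel refl] by blast
qed

section \<open>The glued graph is strongly regular\<close>

text \<open>
  A vertex \<open>x\<close> of the scheme is said to lie over the point \<open>pt x\<close> that belongs to its fibre, and over all blocks
  through that point.
\<close>

locale net_gluing =
  fixes s t :: nat and H :: "'h scheme" and I :: "('p, 'l) net_structure" and \<phi> :: "'h set \<Rightarrow> 'p"
  assumes t_ge: "2 \<le> t" and t_le: "t \<le> s"
    and scheme: "scheme_with_eigenmatrix_P s t H"
    and net: "net (t + 1) s I"
    and iso: "graph_isomorphism \<phi> (quotient_graph H) (collinearity_graph I)"
begin

abbreviation X :: "'h set" where "X \<equiv> scheme_pts H"
abbreviation B :: "('h \<times> 'h) set" where "B \<equiv> scheme_rel H 1"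
abbreviation F :: "('h \<times> 'h) set" where "F \<equiv> scheme_rel H 0 \<union> scheme_rel H 3"

sublocale fibred_graph s t X B F
  by (rule scheme_fibred_graph[OF t_ge t_le scheme])

definition pt :: "'h \<Rightarrow> 'p" where
  "pt x = \<phi> (F `` {x})"

definition through :: "'h \<Rightarrow> 'l set" where
  "through x = {l \<in> blocks I. (pt x, l) \<in> incid I}"

definition over :: "'l \<Rightarrow> 'h set" where
  "over l = {x \<in> X. l \<in> through x}"

definition par_to :: "'l \<Rightarrow> 'l set" where
  "par_to l = {m \<in> blocks I. m \<noteq> l \<and> parallel I l m}"

lemma bij_fibres: "bij_betw \<phi> (X // F) (points I)"
  and collinear_iff: "\<And>x y. x \<in> X \<Longrightarrow> y \<in> X \<Longrightarrow> (x, y) \<notin> F \<Longrightarrow>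
        collinear I (pt x) (pt y) \<longleftrightarrow> (x, y) \<in> F O B O F"
  using iso unfolding quotient_graph_isomorphism_iff[OF fibred_graph_axioms] pt_def by blast+

lemma pt_in: "x \<in> X \<Longrightarrow> pt x \<in> points I"
  unfolding pt_def by (rule bij_betw_apply[OF bij_fibres]) (rule quotientI)

lemma pt_surj: assumes "p \<in> points I" obtains x where "x \<in> X" "p = pt x"
proof -
  have "p \<in> \<phi> ` (X // F)" using bij_fibres assms by (simp add: bij_betw_def)
  then obtain W where W: "p = \<phi> W" "W \<in> X // F" by (rule imageE)
  from W(2) obtain x where "x \<in> X" "W = F `` {x}" by (rule fibreE)
  then show ?thesis using W(1) that by (simp add: pt_def)
qed

lemma pt_eq_iff: "x \<in> X \<Longrightarrow> y \<in> X \<Longrightarrow> pt x = pt y \<longleftrightarrow> (x, y) \<in> F"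
  unfolding pt_def
  using inj_on_eq_iff[OF bij_betw_imp_inj_on[OF bij_fibres] quotientI quotientI] fibre_class_eq_iff
  by simp

lemma through_eq: "(x, y) \<in> F \<Longrightarrow> through x = through y"
  using pt_eq_iff fibre_subset unfolding through_def by metis

lemma finite_blocks: "finite (blocks I)"
  by (rule net_finite_blocks[OF net])

lemma finite_through: "finite (through x)"
  unfolding through_def using finite_blocks by simp

lemma finite_over: "finite (over l)"
  unfolding over_def using finite_X by simp

lemma finite_par_to: "finite (par_to l)"
  unfolding par_to_def using finite_blocks by simp

lemma B_class_subset: "B `` {x} \<subseteq> X"
  using B_subset by blast

lemma finite_B: "finite (B `` {x})"
  by (rule finite_subset[OF B_class_subset finite_X])

lemma card_through: "x \<in> X \<Longrightarrow> card (through x) = t + 1"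
  unfolding through_def by (rule net_card_through[OF net pt_in])

lemma card_through_Int:
  assumes "x \<in> X" "y \<in> X" "(x, y) \<notin> F"
  shows "card (through x \<inter> through y) = (if (x, y) \<in> F O B O F then 1 else 0)"
proof -
  have "through x \<inter> through y = {l \<in> blocks I. (pt x, l) \<in> incid I \<and> (pt y, l) \<in> incid I}"
    by (auto simp: through_def)
  then show ?thesis
    using net_card_common_blocks[OF net pt_in[OF assms(1)] pt_in[OF assms(2)]]
    by (simp add: pt_eq_iff assms(1,2,3)[unfolded Un_iff] assms(3) collinear_iff[OF assms])
qed

text \<open>
  Every point carries \<open>t\<close> vertices.
\<close>

lemma card_over_all:
  assumes S: "S \<subseteq> blocks I"
  shows "card {x \<in> X. S \<subseteq> through x} = t * card {p \<in> points I. \<forall>l\<in>S. (p, l) \<in> incid I}"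
proof -
  let ?A = "{x \<in> X. S \<subseteq> through x}"
  have "t * card {W \<in> X // F. W \<subseteq> ?A} = card ?A"
  proof (rule card_fibres_within)
    fix x y assume x: "x \<in> ?A" and xy: "(x, y) \<in> F"
    show "y \<in> ?A" using x through_eq[OF xy] fibre_subset[OF xy] by simp
  qed simp
  moreover have "\<phi> ` {W \<in> X // F. W \<subseteq> ?A} = {p \<in> points I. \<forall>l\<in>S. (p, l) \<in> incid I}"
  proof (intro equalityI subsetI)
    fix p assume "p \<in> \<phi> ` {W \<in> X // F. W \<subseteq> ?A}"
    then obtain W where W: "p = \<phi> W" "W \<in> {W \<in> X // F. W \<subseteq> ?A}" by (rule imageE)
    then obtain x where x: "x \<in> W" "x \<in> X" "W = F `` {x}" using fibre_nonempty by blast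
    then have "S \<subseteq> through x" using W(2) by blast
    then show "p \<in> {p \<in> points I. \<forall>l\<in>S. (p, l) \<in> incid I}"
      using pt_in[OF x(2)] W(1) x(3) by (auto simp: through_def pt_def)
  next
    fix p assume p: "p \<in> {p \<in> points I. \<forall>l\<in>S. (p, l) \<in> incid I}"
    then obtain x where x: "x \<in> X" "p = pt x" using pt_surj by blast
    then have "S \<subseteq> through x" using p S by (auto simp: through_def)
    then have "F `` {x} \<subseteq> ?A" using through_eq fibre_subset by blast
    then show "p \<in> \<phi> ` {W \<in> X // F. W \<subseteq> ?A}"
      using x quotientI[OF x(1)] unfolding pt_def by blast
  qed
  moreover have "card (\<phi> ` {W \<in> X // F. W \<subseteq> ?A}) = card {W \<in> X // F. W \<subseteq> ?A}"
    by (intro card_image inj_on_subset[OF bij_betw_imp_inj_on[OF bij_fibres]]) blast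
  ultimately show ?thesis by simp
qed

lemma card_over: "l \<in> blocks I \<Longrightarrow> card (over l) = t * s"
  using card_over_all[of "{l}"] net_block_card[OF net] by (simp add: over_def)

lemma card_X: "card X = t * s\<^sup>2"
  using card_over_all[of "{}"] net_card_points[OF net] by simp

lemma card_over_Int:
  assumes lm: "l \<in> blocks I" "m \<in> blocks I" "l \<noteq> m"
  shows "card (over l \<inter> over m) = (if parallel I l m then 0 else t)"
proof -
  have "over l \<inter> over m = {x \<in> X. {l, m} \<subseteq> through x}" by (auto simp: over_def)
  then have eq: "card (over l \<inter> over m) = t * card {p \<in> points I. (p, l) \<in> incid I \<and> (p, m) \<in> incid I}"
    using card_over_all[of "{l, m}"] lm by simp
  show ?thesis
  proof (cases "parallel I l m")
    case True
    then obtain C where C: "C \<in> par_classes I" "l \<in> C" "m \<in> C" by (auto simp: parallel_def)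
    have "{p \<in> points I. (p, l) \<in> incid I \<and> (p, m) \<in> incid I} = {}"
      using net_parallel_disjoint[OF net C] lm(3) by blast
    then show ?thesis using eq True by (simp only: card.empty mult_0_right if_True)
  next
    case False
    obtain C D where CD: "C \<in> par_classes I" "l \<in> C" "D \<in> par_classes I" "m \<in> D"
      using net_block_class[OF net] lm by metis
    then have "C \<noteq> D" using False by (auto simp: parallel_def)
    then show ?thesis using eq net_meet[OF net CD(1,3)] CD False by simp
  qed
qed

lemma par_to_class:
  assumes "C \<in> par_classes I" "l \<in> C"
  shows "par_to l = C - {l}"
  using assms net_class_subset[OF net] net_class_unique[OF net] unfolding par_to_def parallel_def by blast

lemma card_par_to:
  assumes "l \<in> blocks I" shows "card (par_to l) = s - 1"
proof -
  obtain C where C: "C \<in> par_classes I" "l \<in> C" using net_block_class[OF net assms] .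
  then show ?thesis using par_to_class[OF C] net_class_card[OF net C(1)] by simp
qed

lemma card_par_to_Int:
  assumes lm: "l \<in> blocks I" "m \<in> blocks I" "l \<noteq> m"
  shows "card (par_to l \<inter> par_to m) = (if parallel I l m then s - 2 else 0)"
proof (cases "parallel I l m")
  case True
  then obtain C where C: "C \<in> par_classes I" "l \<in> C" "m \<in> C" by (auto simp: parallel_def)
  have "par_to l \<inter> par_to m = C - {l, m}" using par_to_class[OF C(1)] C by auto
  then show ?thesis
    using True net_class_card[OF net C(1)] net_finite_class[OF net C(1)] C lm(3)
    by (simp add: card_Diff_subset)
next
  case False
  obtain C D where CD: "C \<in> par_classes I" "l \<in> C" "D \<in> par_classes I" "m \<in> D"
    using net_block_class[OF net] lm by metis
  then have "C \<noteq> D" using False by (auto simp: parallel_def)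
  then have "par_to l \<inter> par_to m = {}"
    using par_to_class CD net_class_unique[OF net CD(1,3)] by blast
  then show ?thesis using False by simp
qed

lemma card_par_to_through:
  assumes l: "l \<in> blocks I" and x: "x \<in> X"
  shows "card (par_to l \<inter> through x) = (if l \<in> through x then 0 else 1)"
proof -
  obtain C where C: "C \<in> par_classes I" "l \<in> C" using net_block_class[OF net l] .
  have "card {m \<in> C. (pt x, m) \<in> incid I} = 1"
    using net_card_through_in_class[OF net C(1) pt_in[OF x]] .
  moreover have "{m \<in> C. (pt x, m) \<in> incid I} = C \<inter> through x"
    using net_class_subset[OF net C(1)] unfolding through_def by blast
  moreover have "par_to l \<inter> through x = (C \<inter> through x) - {l}"
    using par_to_class[OF C] by blast
  ultimately show ?thesis using C(2) by simp
qed

lemma neighbour_linked: "(x, y) \<in> B \<Longrightarrow> (x, y) \<in> F O B O F"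
  using B_subset fibre_refl by blast

text \<open>
  A vertex has exactly one neighbour in each fibre linked to its own, and the linked fibres correspond to the
  collinear points.
\<close>

lemma pt_bij_neighbours:
  assumes x: "x \<in> X"
  shows "bij_betw pt (B `` {x}) {q \<in> points I. q \<noteq> pt x \<and> collinear I (pt x) q}"
  unfolding bij_betw_def
proof
  have unique: "y = z" if "y \<in> B `` {x}" "z \<in> B `` {x}" "(y, z) \<in> F" for y z
  proof -
    have yX: "y \<in> X" using that(1) B_class_subset by blast
    have "card (B `` {x} \<inter> F `` {y}) = 1"
      using unique_neighbour[OF neighbour_linked[of x y]] that(1) by simp
    then obtain w where w: "B `` {x} \<inter> F `` {y} = {w}" by (auto simp: card_1_singleton_iff)
    have "y \<in> B `` {x} \<inter> F `` {y}" "z \<in> B `` {x} \<inter> F `` {y}"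
      using that fibre_refl[OF yX] by simp_all
    then show ?thesis unfolding w by simp
  qed
  show "inj_on pt (B `` {x})"
  proof (rule inj_onI)
    fix y z assume y: "y \<in> B `` {x}" and z: "z \<in> B `` {x}" and "pt y = pt z"
    moreover from y z have "y \<in> X" "z \<in> X" using B_class_subset by blast+
    ultimately show "y = z" using unique[OF y z] pt_eq_iff by simp
  qed
  show "pt ` (B `` {x}) = {q \<in> points I. q \<noteq> pt x \<and> collinear I (pt x) q}"
  proof (intro equalityI subsetI)
    fix q assume "q \<in> pt ` (B `` {x})"
    then obtain y where y: "q = pt y" "y \<in> B `` {x}" by (rule imageE)
    have L: "(x, y) \<in> F O B O F" using neighbour_linked y(2) by simp
    note * = linked_not_same_fibre[OF L]
    have "pt x \<noteq> pt y" using pt_eq_iff[OF *(1,2)] *(3) by simp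
    then show "q \<in> {q \<in> points I. q \<noteq> pt x \<and> collinear I (pt x) q}"
      using y(1) pt_in[OF *(2)] collinear_iff[OF *] L by simp
  next
    fix q assume q: "q \<in> {q \<in> points I. q \<noteq> pt x \<and> collinear I (pt x) q}"
    then obtain z where z: "z \<in> X" "q = pt z" using pt_surj by blast
    then have "pt x \<noteq> pt z" using q by auto
    then have "(x, z) \<notin> F" using pt_eq_iff[OF x z(1)] by simp
    then have "(x, z) \<in> F O B O F" using q z collinear_iff[OF x z(1)] by simp
    then have "card (B `` {x} \<inter> F `` {z}) = 1" by (rule unique_neighbour)
    then obtain y where y: "B `` {x} \<inter> F `` {z} = {y}" by (auto simp: card_1_singleton_iff)
    then have yB: "y \<in> B `` {x}" and zy: "(z, y) \<in> F" by auto
    have "pt z = pt y"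
      using pt_eq_iff[OF z(1), of y] fibre_subset[OF zy] zy by blast
    then show "q \<in> pt ` (B `` {x})" using z(2) yB by simp
  qed
qed

text \<open>
  By \<open>pt_bij_neighbours\<close> this counts the points of \<open>l\<close>, other than \<open>pt x\<close>, that are
  collinear with \<open>pt x\<close>: all of the \<open>s - 1\<close> others if \<open>pt x\<close> is on \<open>l\<close>, and \<open>t\<close>
  by \<open>net_card_collinear_on_block\<close> if not.
\<close>

lemma card_neighbours_over:
  assumes x: "x \<in> X" and l: "l \<in> blocks I"
  shows "card (B `` {x} \<inter> over l) = (if l \<in> through x then s - 1 else t)"
proof -
  let ?Q = "{q \<in> points I. q \<noteq> pt x \<and> collinear I (pt x) q}"
  note bij = pt_bij_neighbours[OF x]
  have "B `` {x} \<inter> over l = {y \<in> B `` {x}. (pt y, l) \<in> incid I}"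
    using B_class_subset l by (auto simp: over_def through_def)
  moreover have "card {y \<in> B `` {x}. (pt y, l) \<in> incid I} = card {q \<in> ?Q. (q, l) \<in> incid I}"
  proof -
    have "pt ` {y \<in> B `` {x}. (pt y, l) \<in> incid I} = {q \<in> pt ` (B `` {x}). (q, l) \<in> incid I}"
      by blast
    also have "pt ` (B `` {x}) = ?Q" using bij by (simp only: bij_betw_def)
    finally have img: "pt ` {y \<in> B `` {x}. (pt y, l) \<in> incid I} = {q \<in> ?Q. (q, l) \<in> incid I}" .
    have inj: "inj_on pt {y \<in> B `` {x}. (pt y, l) \<in> incid I}"
      by (rule inj_on_subset[OF bij_betw_imp_inj_on[OF bij]]) blast
    show ?thesis using card_image[OF inj] unfolding img by (rule sym)
  qed
  moreover have "card {q \<in> ?Q. (q, l) \<in> incid I} = (if l \<in> through x then s - 1 else t)"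
  proof (cases "l \<in> through x")
    case True
    then have xl: "(pt x, l) \<in> incid I" by (simp add: through_def)
    have "{q \<in> ?Q. (q, l) \<in> incid I} = {q \<in> points I. (q, l) \<in> incid I} - {pt x}"
      using xl l by (auto simp: collinear_def)
    then show ?thesis
      using True net_block_card[OF net l] net_finite_points[OF net] xl pt_in[OF x] by simp
  next
    case False
    then have xl: "(pt x, l) \<notin> incid I" using l by (simp add: through_def)
    then have "{q \<in> ?Q. (q, l) \<in> incid I} = {q \<in> points I. (q, l) \<in> incid I \<and> collinear I (pt x) q}"
      by blast
    then show ?thesis using net_card_collinear_on_block[OF net pt_in[OF x] l xl] False by simp
  qed
  ultimately show ?thesis by simp
qed

abbreviation G :: "('l, 'h) gvertex pair_pre_digraph" where "G \<equiv> glued_graph H I \<phi>"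

lemma block_point_arc:
  assumes "x \<in> X"
  shows "l \<in> blocks I \<and> (\<exists>W\<in>fibres H. x \<in> W \<and> (\<phi> W, l) \<in> incid I) \<longleftrightarrow> l \<in> through x"
proof -
  have "(\<exists>W\<in>fibres H. x \<in> W \<and> (\<phi> W, l) \<in> incid I) \<longleftrightarrow> (pt x, l) \<in> incid I"
  proof
    assume "\<exists>W\<in>fibres H. x \<in> W \<and> (\<phi> W, l) \<in> incid I"
    then obtain W where W: "x \<in> W \<and> (\<phi> W, l) \<in> incid I" "W \<in> fibres H" by (rule bexE)
    then have "W = F `` {x}" using fibre_member[of W x] by (simp only: fibres_def)
    then show "(pt x, l) \<in> incid I" using W(1) unfolding pt_def by simp
  next
    assume "(pt x, l) \<in> incid I"
    moreover have "x \<in> F `` {x}" using fibre_refl[OF assms] by (rule ImageI) simp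
    ultimately show "\<exists>W\<in>fibres H. x \<in> W \<and> (\<phi> W, l) \<in> incid I"
      using quotientI[OF assms, of F] unfolding pt_def fibres_def by (intro bexI conjI)
  qed
  then show ?thesis unfolding through_def by simp
qed

lemma B_commute: "(x, y) \<in> B \<longleftrightarrow> (y, x) \<in> B"
  using B_sym by (auto dest: symD)

lemma neighbours_Apex: "neighbours G Apex = Block ` blocks I"
proof -
  have "w \<in> neighbours G Apex \<longleftrightarrow> w \<in> Block ` blocks I" for w
    by (cases w) (auto simp: neighbours_def glued_graph_verts_iff glued_graph_arcs)
  then show ?thesis by blast
qed

lemma neighbours_Block:
  assumes l: "l \<in> blocks I"
  shows "neighbours G (Block l) = insert Apex (Block ` par_to l \<union> SVertex ` over l)"
proof -
  have "w \<in> neighbours G (Block l) \<longleftrightarrow> w \<in> insert Apex (Block ` par_to l \<union> SVertex ` over l)" for w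
  proof (cases w)
    case (SVertex x)
    show ?thesis
      using block_point_arc[of x l]
      by (auto simp: SVertex neighbours_def glued_graph_verts_iff glued_graph_arcs over_def)
  qed (use l in \<open>auto simp: neighbours_def glued_graph_verts_iff glued_graph_arcs par_to_def\<close>)
  then show ?thesis by blast
qed

lemma neighbours_SVertex:
  assumes x: "x \<in> X"
  shows "neighbours G (SVertex x) = Block ` through x \<union> SVertex ` (B `` {x})"
proof -
  have "w \<in> neighbours G (SVertex x) \<longleftrightarrow> w \<in> Block ` through x \<union> SVertex ` (B `` {x})" for w
  proof (cases w)
    case (Block l)
    show ?thesis
      using block_point_arc[OF x, of l]
      by (auto simp: Block neighbours_def glued_graph_verts_iff glued_graph_arcs)
  next
    case (SVertex y)
    have "y \<in> B `` {x} \<longleftrightarrow> y \<in> X \<and> ((x, y) \<in> B \<or> (y, x) \<in> B)"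
      using B_commute[of x y] B_subset by auto
    then show ?thesis
      by (auto simp: SVertex neighbours_def glued_graph_verts_iff glued_graph_arcs)
  qed (auto simp: neighbours_def glued_graph_arcs)
  then show ?thesis by blast
qed

lemma card_sorts:
  fixes L :: "'l set" and Y :: "'h set"
  assumes "finite L" "finite Y"
  shows "card (Block ` L \<union> SVertex ` Y) = card L + card Y"
    and "card (insert Apex (Block ` L \<union> SVertex ` Y)) = 1 + card L + card Y"
proof -
  have "card (Block ` L \<union> SVertex ` Y)
      = card (Block ` L :: ('l, 'h) gvertex set) + card (SVertex ` Y :: ('l, 'h) gvertex set)"
    using assms by (subst card_Un_disjoint) auto
  then show "card (Block ` L \<union> SVertex ` Y) = card L + card Y"
    by (simp add: card_image inj_on_def)
  then show "card (insert Apex (Block ` L \<union> SVertex ` Y)) = 1 + card L + card Y"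
    using assms by (subst card_insert_disjoint) auto
qed

lemma card_Block: "card (Block ` L) = card L"
  by (simp add: card_image inj_on_def)

lemma Int_sorts:
  "Block ` L \<inter> insert Apex (Block ` L' \<union> SVertex ` Y') = Block ` (L \<inter> L')"
  "Block ` L \<inter> (Block ` L' \<union> SVertex ` Y') = Block ` (L \<inter> L')"
  "insert Apex (Block ` L \<union> SVertex ` Y) \<inter> insert Apex (Block ` L' \<union> SVertex ` Y')
     = insert Apex (Block ` (L \<inter> L') \<union> SVertex ` (Y \<inter> Y'))"
  "insert Apex (Block ` L \<union> SVertex ` Y) \<inter> (Block ` L' \<union> SVertex ` Y')
     = Block ` (L \<inter> L') \<union> SVertex ` (Y \<inter> Y')"
  "(Block ` L \<union> SVertex ` Y) \<inter> (Block ` L' \<union> SVertex ` Y')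
     = Block ` (L \<inter> L') \<union> SVertex ` (Y \<inter> Y')"
  by auto

lemma pair_graph_G: "pair_graph G"
proof
  show "finite (pverts G)"
    using finite_X finite_blocks by (simp add: glued_graph_verts)
  have arc: "u \<in> pverts G \<and> w \<in> pverts G \<and> u \<noteq> w \<and> (w, u) \<in> parcs G" if "(u, w) \<in> parcs G" for u w
  proof (cases u; cases w)
    fix l x assume "u = Block l" "w = SVertex x"
    then show ?thesis
      using \<open>(u, w) \<in> parcs G\<close> fibre_member[of _ x]
      by (auto simp: glued_graph_verts_iff glued_graph_arcs fibres_def)
  next
    fix l x assume "u = SVertex x" "w = Block l"
    then show ?thesis
      using \<open>(u, w) \<in> parcs G\<close> fibre_member[of _ x]
      by (auto simp: glued_graph_verts_iff glued_graph_arcs fibres_def)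
  next
    fix x y assume "u = SVertex x" "w = SVertex y"
    then show ?thesis
      using \<open>(u, w) \<in> parcs G\<close> B_subset B_F_disjoint fibre_refl[of x]
      by (auto simp: glued_graph_verts_iff glued_graph_arcs)
  qed (use \<open>(u, w) \<in> parcs G\<close> in
      \<open>auto simp: glued_graph_verts_iff glued_graph_arcs parallel_def\<close>)
  show "fst e \<in> pverts G" "snd e \<in> pverts G" "fst e \<noteq> snd e" if "e \<in> parcs G" for e
    using arc[of "fst e" "snd e"] that by simp_all
  show "finite (parcs G)"
    by (rule finite_subset[of _ "pverts G \<times> pverts G"])
      (use arc finite_X finite_blocks in \<open>auto simp: glued_graph_verts\<close>)
  show "symmetric G"
    using arc by (auto simp: symmetric_def intro: symI)
qed

text \<open>
  In each pair of sorts the common neighbours split into the apex, blocks and scheme vertices.  For two scheme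
  vertices a common block compensates for one missing common neighbour in \<open>B\<close>; the fibre-mates trade all
  \<open>t + 1\<close> common neighbours for blocks.
\<close>

lemma common_neighbours:
  assumes "u \<in> pverts G" "w \<in> pverts G" "u \<noteq> w"
  shows "card (neighbours G u \<inter> neighbours G w) = (if w \<in> neighbours G u then s - 1 else t + 1)"
proof -
  have s2: "s - Suc 0 = Suc (s - 2)" using t_ge t_le by simp
  note simps = neighbours_Apex neighbours_Block neighbours_SVertex Int_sorts card_sorts card_Block
    finite_blocks finite_through finite_over finite_par_to finite_B
  have AB: "card (neighbours G Apex \<inter> neighbours G (Block l)) = s - 1" if l: "l \<in> blocks I" for l
  proof -
    have "blocks I \<inter> par_to l = par_to l" by (auto simp: par_to_def)
    then show ?thesis using card_par_to[OF l] l by (simp add: simps)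
  qed
  have AS: "card (neighbours G Apex \<inter> neighbours G (SVertex x)) = t + 1" if x: "x \<in> X" for x
  proof -
    have "blocks I \<inter> through x = through x" by (auto simp: through_def)
    then show ?thesis using card_through[OF x] x by (simp add: simps)
  qed
  have BB: "card (neighbours G (Block l) \<inter> neighbours G (Block m))
      = (if parallel I l m then s - 1 else t + 1)"
    if "l \<in> blocks I" "m \<in> blocks I" "l \<noteq> m" for l m
    using that by (simp add: simps card_par_to_Int card_over_Int s2)
  have BS: "card (neighbours G (Block l) \<inter> neighbours G (SVertex x))
      = (if l \<in> through x then s - 1 else t + 1)"
    if "l \<in> blocks I" "x \<in> X" for l x
    using that card_neighbours_over[OF that(2,1)]
    by (simp add: simps card_par_to_through Int_commute[of "over l"])
  have SS: "card (neighbours G (SVertex x) \<inter> neighbours G (SVertex y))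
      = (if (x, y) \<in> B then s - 1 else t + 1)"
    if xy: "x \<in> X" "y \<in> X" "x \<noteq> y" for x y
  proof -
    have "card (neighbours G (SVertex x) \<inter> neighbours G (SVertex y))
        = card (through x \<inter> through y) + card (B `` {x} \<inter> B `` {y})"
      using xy by (simp add: simps del: One_nat_def)
    also have "\<dots> = (if (x, y) \<in> B then s - 1 else t + 1)"
    proof (cases "(x, y) \<in> F")
      case True
      then have "(x, y) \<notin> B" using B_F_disjoint by blast
      moreover have "through x \<inter> through y = through x" using through_eq[OF True] by simp
      ultimately show ?thesis using card_through[OF xy(1)] common_fibre[OF True xy(3)] by simp
    next
      case False
      note card_through_Int[OF xy(1,2) False]
      moreover have "card (B `` {x} \<inter> B `` {y}) = (if (x, y) \<in> B then s - 2
          else if (x, y) \<in> F O B O F then t else t + 1)"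
        using common_adjacent[of x y] common_linked[of x y] common_unlinked[OF xy(1,2) False] by presburger
      ultimately show ?thesis using neighbour_linked[of x y] s2 by auto
    qed
    finally show ?thesis .
  qed
  show ?thesis
  proof (cases u; cases w)
    fix l m assume *: "u = Block l" "w = Block m"
    then have "l \<in> blocks I" "m \<in> blocks I" "l \<noteq> m" using assms by (auto simp: glued_graph_verts_iff)
    then show ?thesis using * BB by (auto simp: neighbours_Block par_to_def)
  next
    fix l x assume *: "u = Block l" "w = SVertex x"
    then have "l \<in> blocks I" "x \<in> X" using assms by (auto simp: glued_graph_verts_iff)
    then show ?thesis using * BS by (auto simp: neighbours_Block over_def)
  next
    fix l x assume *: "u = SVertex x" "w = Block l"
    then have "l \<in> blocks I" "x \<in> X" using assms by (auto simp: glued_graph_verts_iff)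
    then show ?thesis using * BS by (subst Int_commute) (auto simp: neighbours_SVertex)
  next
    fix x y assume *: "u = SVertex x" "w = SVertex y"
    then have "x \<in> X" "y \<in> X" "x \<noteq> y" using assms by (auto simp: glued_graph_verts_iff)
    then show ?thesis using * SS by (auto simp: neighbours_SVertex)
  next
    fix l assume *: "u = Apex" "w = Block l"
    then have "l \<in> blocks I" using assms by (auto simp: glued_graph_verts_iff)
    then show ?thesis using * AB by (auto simp: neighbours_Apex)
  next
    fix l assume *: "u = Block l" "w = Apex"
    then have "l \<in> blocks I" using assms by (auto simp: glued_graph_verts_iff)
    then show ?thesis using * AB by (subst Int_commute) (auto simp: neighbours_Block)
  next
    fix x assume *: "u = Apex" "w = SVertex x"
    then have "x \<in> X" using assms by (auto simp: glued_graph_verts_iff)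
    then show ?thesis using * AS by (auto simp: neighbours_Apex)
  next
    fix x assume *: "u = SVertex x" "w = Apex"
    then have "x \<in> X" using assms by (auto simp: glued_graph_verts_iff)
    then show ?thesis using * AS by (subst Int_commute) (auto simp: neighbours_SVertex)
  qed (use assms in auto)
qed

lemma glued_degree:
  assumes "u \<in> pverts G" shows "card (neighbours G u) = (t + 1) * s"
proof (cases u)
  case Apex
  then show ?thesis
    using net_card_blocks[OF net] by (simp add: neighbours_Apex card_Block)
next
  case (Block l)
  then have l: "l \<in> blocks I" using assms by (simp add: glued_graph_verts_iff)
  have "card (neighbours G u) = 1 + (s - 1) + t * s"
    using l by (simp add: Block neighbours_Block card_sorts finite_par_to finite_over card_par_to card_over)
  then show ?thesis using t_ge t_le by simp
next
  case (SVertex x)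
  then have x: "x \<in> X" using assms by (simp add: glued_graph_verts_iff)
  have "card (neighbours G u) = (t + 1) + (s - 1) * (t + 1)"
    using x by (simp add: SVertex neighbours_SVertex card_sorts finite_through finite_B
      card_through valency del: One_nat_def)
  also have "\<dots> = (t + 1) * s" using t_ge t_le by (cases s) simp_all
  finally show ?thesis .
qed

lemma glued_graph_strongly_regular:
  "strongly_regular G ((t * s + 1) * (s + 1)) ((t + 1) * s) (s - 1) (t + 1)"
proof -
  have "pverts G = insert Apex (Block ` blocks I \<union> SVertex ` X)"
    by (simp add: glued_graph_verts)
  then have "card (pverts G) = 1 + (t + 1) * s + t * s\<^sup>2"
    using card_sorts(2)[OF finite_blocks finite_X] net_card_blocks[OF net] card_X by simp
  also have "\<dots> = (t * s + 1) * (s + 1)" by (simp add: algebra_simps power2_eq_square)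
  finally have n: "card (pverts G) = (t * s + 1) * (s + 1)" .
  have arc: "w \<in> neighbours G u \<longleftrightarrow> (u, w) \<in> parcs G" if "w \<in> pverts G" for u w
    using that by (simp add: neighbours_def)
  have loop: "u \<noteq> w" if "(u, w) \<in> parcs G" for u w
  proof -
    interpret pair_graph G by (rule pair_graph_G)
    show ?thesis using no_loops[OF that] by simp
  qed
  show ?thesis
    unfolding strongly_regular_def
  proof (intro conjI ballI impI)
    fix u w assume *: "u \<in> pverts G" "w \<in> pverts G" "(u, w) \<in> parcs G"
    then show "card (neighbours G u \<inter> neighbours G w) = s - 1"
      using common_neighbours[OF *(1,2) loop[OF *(3)]] arc[OF *(2)] by simp
  next
    fix u w assume *: "u \<in> pverts G" "w \<in> pverts G" "u \<noteq> w \<and> (u, w) \<notin> parcs G"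
    then show "card (neighbours G u \<inter> neighbours G w) = t + 1"
      using common_neighbours[OF *(1,2)] arc[OF *(2)] by simp
  qed (use pair_graph_G n glued_degree in auto)
qed

end

section \<open>Transport along injections\<close>

definition map_scheme :: "('a \<Rightarrow> 'b) \<Rightarrow> 'a scheme \<Rightarrow> 'b scheme" where
  "map_scheme g H = \<lparr>scheme_pts = g ` scheme_pts H, num_classes = num_classes H,
     scheme_rel = (\<lambda>i. map_prod g g ` scheme_rel H i)\<rparr>"

lemma map_scheme_simps [simp]:
  "scheme_pts (map_scheme g H) = g ` scheme_pts H"
  "num_classes (map_scheme g H) = num_classes H"
  "scheme_rel (map_scheme g H) i = map_prod g g ` scheme_rel H i"
  by (simp_all add: map_scheme_def)

lemma map_prod_image_iff:
  assumes "inj_on g A" "R \<subseteq> A \<times> A" "x \<in> A" "y \<in> A"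
  shows "(g x, g y) \<in> map_prod g g ` R \<longleftrightarrow> (x, y) \<in> R"
proof
  assume "(g x, g y) \<in> map_prod g g ` R"
  then obtain x' y' where *: "(x', y') \<in> R" "g x = g x'" "g y = g y'" by auto
  then have "x' \<in> A" "y' \<in> A" using assms(2) by auto
  then show "(x, y) \<in> R" using * assms by (metis inj_onD)
qed force

lemma image_Collect_conj: "{w \<in> g ` A. Q w} = g ` {z \<in> A. Q (g z)}"
  by blast

lemma assoc_scheme_map:
  assumes inj: "inj_on g (scheme_pts H)" and H: "assoc_scheme H"
  shows "assoc_scheme (map_scheme g H)"
proof -
  let ?X = "scheme_pts H" and ?R = "scheme_rel H" and ?d = "num_classes H"
  have sub: "?R i \<subseteq> ?X \<times> ?X" if "i \<le> ?d" for i using assoc_scheme_subset[OF H that] .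
  have iff: "(g x, g y) \<in> map_prod g g ` ?R i \<longleftrightarrow> (x, y) \<in> ?R i"
    if "i \<le> ?d" "x \<in> ?X" "y \<in> ?X" for i x y
    using map_prod_image_iff[OF inj sub[OF that(1)] that(2,3)] .
  obtain p where p: "\<forall>i\<le>?d. \<forall>j\<le>?d. \<forall>k\<le>?d. \<forall>(x, y) \<in> ?R k.
      card {z \<in> ?X. (x, z) \<in> ?R i \<and> (z, y) \<in> ?R j} = p i j k"
    using assoc_scheme_intersection_numbers[OF H] by (rule exE)
  have "card {z \<in> g ` ?X. (x', z) \<in> map_prod g g ` ?R i \<and> (z, y') \<in> map_prod g g ` ?R j} = p i j k"
    if ijk: "i \<le> ?d" "j \<le> ?d" "k \<le> ?d" and e: "(x', y') \<in> map_prod g g ` ?R k" for i j k x' y'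
  proof -
    obtain x y where xy: "(x, y) \<in> ?R k" "x' = g x" "y' = g y" using e by auto
    then have X: "x \<in> ?X" "y \<in> ?X" using sub[OF ijk(3)] by auto
    have "{z \<in> g ` ?X. (x', z) \<in> map_prod g g ` ?R i \<and> (z, y') \<in> map_prod g g ` ?R j}
        = g ` {z \<in> ?X. (x, z) \<in> ?R i \<and> (z, y) \<in> ?R j}"
      unfolding xy(2,3) image_Collect_conj
      by (rule arg_cong[where f = "image g"]) (simp add: iff ijk X cong: conj_cong)
    moreover have "inj_on g {z \<in> ?X. (x, z) \<in> ?R i \<and> (z, y) \<in> ?R j}"
      using inj by (rule inj_on_subset) auto
    moreover have "card {z \<in> ?X. (x, z) \<in> ?R i \<and> (z, y) \<in> ?R j} = p i j k"
      using p ijk xy(1) by blast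
    ultimately show ?thesis by (simp add: card_image)
  qed
  then have numbers: "\<exists>p. \<forall>i\<le>?d. \<forall>j\<le>?d. \<forall>k\<le>?d. \<forall>(x, y) \<in> map_prod g g ` ?R k.
      card {z \<in> g ` ?X. (x, z) \<in> map_prod g g ` ?R i \<and> (z, y) \<in> map_prod g g ` ?R j} = p i j k"
    by (intro exI[of _ p]) blast
  have diagonal: "map_prod g g ` ?R 0 = Id_on (g ` ?X)"
    unfolding assoc_scheme_diagonal[OF H] by (auto simp: Id_on_def image_iff)
  have inhabited: "map_prod g g ` ?R i \<noteq> {}" if "i \<le> ?d" for i
    using assoc_scheme_inhabited[OF H that] by simp
  have symmetric: "sym (map_prod g g ` ?R i)" if "i \<le> ?d" for i
  proof (rule symI)
    fix a b assume "(a, b) \<in> map_prod g g ` ?R i"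
    then obtain x y where "(x, y) \<in> ?R i" "a = g x" "b = g y" by auto
    moreover from this have "(y, x) \<in> ?R i" using assoc_scheme_sym[OF H that] by (auto dest: symD)
    ultimately show "(b, a) \<in> map_prod g g ` ?R i" by force
  qed
  have disjoint: "disjoint_family_on (\<lambda>i. map_prod g g ` ?R i) {..?d}"
    unfolding disjoint_family_on_def
  proof (intro ballI impI)
    fix i j assume ij: "i \<in> {..?d}" "j \<in> {..?d}" "i \<noteq> j"
    show "map_prod g g ` ?R i \<inter> map_prod g g ` ?R j = {}"
    proof (rule equals0I)
      fix e assume e: "e \<in> map_prod g g ` ?R i \<inter> map_prod g g ` ?R j"
      obtain x y where xy: "(x, y) \<in> ?R i" "e = (g x, g y)" using e by auto
      then have "x \<in> ?X" "y \<in> ?X" using sub[of i] ij by auto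
      then have "(x, y) \<in> ?R j" using IntD2[OF e] xy iff ij by simp
      then show False using assoc_scheme_disjoint[OF H, of i j] xy(1) ij by simp
    qed
  qed
  have cover: "(\<Union>i\<le>?d. map_prod g g ` ?R i) = (g ` ?X) \<times> (g ` ?X)"
    unfolding image_UN[symmetric] assoc_scheme_cover[OF H] by (rule map_prod_surj_on[OF refl refl])
  show ?thesis
    unfolding assoc_scheme_def Let_def map_scheme_simps
    using assoc_scheme_finite[OF H] assoc_scheme_nonempty[OF H]
    by (intro conjI numbers disjoint cover diagonal allI impI symmetric inhabited) simp_all
qed

text \<open>
  Relabelling the vertices relabels the eigenvectors: \<open>push\<close> maps each common eigenspace of \<open>H\<close>
  onto the one of the image with the same eigenvalues.
\<close>

lemma first_eigenmatrix_map:
  assumes inj: "inj_on g (scheme_pts H)" and H: "assoc_scheme H" and P: "first_eigenmatrix H P"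
  shows "first_eigenmatrix (map_scheme g H) P"
proof -
  let ?X = "scheme_pts H" and ?R = "scheme_rel H" and ?d = "num_classes H" and ?H = "map_scheme g H"
  define push where "push x = (\<lambda>w. if w \<in> g ` ?X then x (inv_into ?X g w) else (0 :: real))" for x
  have push: "push x (g u) = x u" if "u \<in> ?X" for x u
    using that inj by (simp add: push_def)
  have push_out: "push x w = 0" if "w \<notin> g ` ?X" for x w
    using that by (simp add: push_def)
  have mat: "adj_matrix (map_prod g g ` ?R j) (g u) (g w) = adj_matrix (?R j) u w"
    if "j \<le> ?d" "u \<in> ?X" "w \<in> ?X" for j u w
    using map_prod_image_iff[OF inj assoc_scheme_subset[OF H that(1)] that(2,3)]
    by (simp add: adj_matrix_def)
  have eq: "(\<Sum>w\<in>g ` ?X. adj_matrix (map_prod g g ` ?R j) (g u) w * y w)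
      = (\<Sum>w\<in>?X. adj_matrix (?R j) u w * y (g w))" if "j \<le> ?d" "u \<in> ?X" for j u y
    using that by (simp add: sum.reindex[OF inj] mat)
  have space: "common_eigenspace ?H \<theta> = push ` common_eigenspace H \<theta>" for \<theta>
  proof (intro equalityI subsetI)
    fix y assume y: "y \<in> common_eigenspace ?H \<theta>"
    define x where "x u = (if u \<in> ?X then y (g u) else 0)" for u
    have "y = push x"
    proof
      fix w show "y w = push x w"
        using y by (cases "w \<in> g ` ?X") (auto simp: push push_out x_def common_eigenspace_def)
    qed
    moreover have "x \<in> common_eigenspace H \<theta>"
      using y unfolding common_eigenspace_def by (simp add: eq x_def)
    ultimately show "y \<in> push ` common_eigenspace H \<theta>" by blast
  next
    fix y assume "y \<in> push ` common_eigenspace H \<theta>"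
    then obtain x where "x \<in> common_eigenspace H \<theta>" "y = push x" by blast
    then show "y \<in> common_eigenspace ?H \<theta>"
      unfolding common_eigenspace_def by (simp add: eq push push_out)
  qed
  have inj_push: "inj_on push {x. \<forall>u. u \<notin> ?X \<longrightarrow> x u = 0}"
  proof (rule inj_onI)
    fix x y assume xy: "x \<in> {x. \<forall>u. u \<notin> ?X \<longrightarrow> x u = 0}" "y \<in> {x. \<forall>u. u \<notin> ?X \<longrightarrow> x u = 0}"
      and "push x = push y"
      (is "?l = ?r")
    have "x u = y u" if "u \<in> ?X" for u
      using push[OF that, of x] push[OF that, of y] \<open>?l = ?r\<close> by simp
    then show "x = y" using xy by fastforce
  qed
  have supp: "common_eigenspace H \<theta> \<subseteq> {x. \<forall>u. u \<notin> ?X \<longrightarrow> x u = 0}" for \<theta>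
    by (auto simp: common_eigenspace_def)
  have zero: "push (\<lambda>_. 0) = (\<lambda>_. 0)" by (auto simp: push_def)
  have img_inj: "push ` common_eigenspace H \<theta> = push ` A \<longleftrightarrow> common_eigenspace H \<theta> = A"
    if "A \<subseteq> {x. \<forall>u. u \<notin> ?X \<longrightarrow> x u = 0}" for \<theta> A
    using inj_on_image_eq_iff[OF inj_push supp that] .
  have nonzero: "push ` common_eigenspace H \<theta> = {\<lambda>_. 0} \<longleftrightarrow> common_eigenspace H \<theta> = {\<lambda>_. 0}" for \<theta>
    using img_inj[of "{\<lambda>_. 0}" \<theta>] zero by simp
  have spaces: "common_eigenspaces ?H = image push ` common_eigenspaces H"
    unfolding common_eigenspaces_def space nonzero setcompr_eq_image image_image ..
  have "bij_betw (image push) (common_eigenspaces H) (common_eigenspaces ?H)"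
    unfolding bij_betw_def spaces
  proof (intro conjI inj_onI refl)
    fix A A' assume "A \<in> common_eigenspaces H" "A' \<in> common_eigenspaces H" and eq: "push ` A = push ` A'"
    then obtain \<theta> \<theta>' where "A = common_eigenspace H \<theta>" "A' = common_eigenspace H \<theta>'"
      unfolding common_eigenspaces_def by blast
    then show "A = A'" using eq img_inj[OF supp] by simp
  qed
  from bij_betw_trans[OF P[unfolded first_eigenmatrix_def] this] show ?thesis
    unfolding first_eigenmatrix_def by (simp add: space comp_def)
qed

lemma scheme_with_eigenmatrix_P_map:
  assumes "inj_on g (scheme_pts H)" "scheme_with_eigenmatrix_P s t H"
  shows "scheme_with_eigenmatrix_P s t (map_scheme g H)"
  using assms assoc_scheme_map first_eigenmatrix_map by (auto simp: scheme_with_eigenmatrix_P_def)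

lemma fibres_map:
  assumes inj: "inj_on g (scheme_pts H)"
    and F: "scheme_rel H 0 \<union> scheme_rel H 3 \<subseteq> scheme_pts H \<times> scheme_pts H"
  shows "fibres (map_scheme g H) = image g ` fibres H"
proof -
  let ?X = "scheme_pts H" and ?F = "scheme_rel H 0 \<union> scheme_rel H 3"
  have "(map_prod g g ` ?F) `` {g x} = g ` (?F `` {x})" if x: "x \<in> ?X" for x
  proof (intro equalityI subsetI)
    fix w assume "w \<in> (map_prod g g ` ?F) `` {g x}"
    then have w: "(g x, w) \<in> map_prod g g ` ?F" by (rule Image_singleton_iff[THEN iffD1])
    then obtain e where e: "(g x, w) = map_prod g g e" "e \<in> ?F" by (rule imageE)
    have y: "snd e \<in> ?X" "w = g (snd e)" using F e by (cases e; auto)+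
    have "(x, snd e) \<in> ?F"
      using w unfolding y(2) map_prod_image_iff[OF inj F x y(1)] .
    then show "w \<in> g ` (?F `` {x})" using y(2) by blast
  qed force
  then show ?thesis
    unfolding fibres_def quotient_def by (auto simp: image_Un[symmetric])
qed

lemma fibres_subset:
  assumes "scheme_rel H 0 \<union> scheme_rel H 3 \<subseteq> scheme_pts H \<times> scheme_pts H" "W \<in> fibres H"
  shows "W \<subseteq> scheme_pts H"
  using assms by (auto simp: fibres_def quotient_def)

lemma quotient_graph_map:
  assumes inj: "inj_on g (scheme_pts H)"
    and F: "scheme_rel H 0 \<union> scheme_rel H 3 \<subseteq> scheme_pts H \<times> scheme_pts H"
    and B: "scheme_rel H 1 \<subseteq> scheme_pts H \<times> scheme_pts H"
  shows "graph_isomorphism (image g) (quotient_graph H) (quotient_graph (map_scheme g H))"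
proof -
  note sub = fibres_subset[OF F]
  have inj': "inj_on (image g) (fibres H)"
    using inj_on_image_eq_iff[OF inj sub sub] by (intro inj_onI) simp
  have "(\<exists>x\<in>g ` W. \<exists>y\<in>g ` W'. (x, y) \<in> map_prod g g ` scheme_rel H 1)
      \<longleftrightarrow> (\<exists>x\<in>W. \<exists>y\<in>W'. (x, y) \<in> scheme_rel H 1)"
    if "W \<in> fibres H" "W' \<in> fibres H" for W W'
    unfolding bex_simps(7) using sub[OF that(1)] sub[OF that(2)]
    by (intro bex_cong refl map_prod_image_iff[OF inj B]) blast+
  moreover have "g ` W = g ` W' \<longleftrightarrow> W = W'" if "W \<in> fibres H" "W' \<in> fibres H" for W W'
    using inj_on_image_eq_iff[OF inj sub sub] that by simp
  ultimately show ?thesis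
    unfolding graph_isomorphism_def quotient_graph_def
    using inj' by (simp add: bij_betw_def fibres_map[OF inj F])
qed

definition map_net :: "('p \<Rightarrow> 'q) \<Rightarrow> ('l \<Rightarrow> 'm) \<Rightarrow> ('p, 'l) net_structure \<Rightarrow> ('q, 'm) net_structure" where
  "map_net \<pi> \<beta> I = \<lparr>points = \<pi> ` points I, blocks = \<beta> ` blocks I,
     incid = map_prod \<pi> \<beta> ` incid I, par_classes = image \<beta> ` par_classes I\<rparr>"

lemma map_net_simps [simp]:
  "points (map_net \<pi> \<beta> I) = \<pi> ` points I"
  "blocks (map_net \<pi> \<beta> I) = \<beta> ` blocks I"
  "incid (map_net \<pi> \<beta> I) = map_prod \<pi> \<beta> ` incid I"
  "par_classes (map_net \<pi> \<beta> I) = image \<beta> ` par_classes I"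
  by (simp_all add: map_net_def)

context
  fixes I :: "('p, 'l) net_structure" and \<pi> :: "'p \<Rightarrow> 'q" and \<beta> :: "'l \<Rightarrow> 'm" and k n :: nat
  assumes net: "net k n I" and inj_p: "inj_on \<pi> (points I)" and inj_b: "inj_on \<beta> (blocks I)"
begin

lemma incid_map_iff:
  assumes "p \<in> points I" "l \<in> blocks I"
  shows "(\<pi> p, \<beta> l) \<in> map_prod \<pi> \<beta> ` incid I \<longleftrightarrow> (p, l) \<in> incid I"
proof
  assume "(\<pi> p, \<beta> l) \<in> map_prod \<pi> \<beta> ` incid I"
  then obtain p' l' where *: "(p', l') \<in> incid I" "\<pi> p = \<pi> p'" "\<beta> l = \<beta> l'" by auto
  then have "p' \<in> points I" "l' \<in> blocks I" using net by (auto simp: net_def)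
  then show "(p, l) \<in> incid I" using * assms inj_p inj_b by (metis inj_onD)
qed force

lemma parallel_map_iff:
  assumes "l \<in> blocks I" "m \<in> blocks I"
  shows "parallel (map_net \<pi> \<beta> I) (\<beta> l) (\<beta> m) \<longleftrightarrow> parallel I l m"
proof -
  have "\<beta> l \<in> \<beta> ` C \<longleftrightarrow> l \<in> C" if "C \<in> par_classes I" "l \<in> blocks I" for l C
    using inj_on_image_mem_iff[OF inj_b that(2) net_class_subset[OF net that(1)]] .
  then show ?thesis using assms by (auto simp: parallel_def)
qed

lemma net_map: "net k n (map_net \<pi> \<beta> I)"
proof -
  note P = net_finite_points[OF net] net_card_points[OF net] net_finite_blocks[OF net]
    net_card_blocks[OF net] net_incid[OF net] net_partition[OF net] net_card_classes[OF net]
    and size = net_class_card[OF net] and on = net_block_card[OF net]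
    and one = net_unique_block[OF net] and meet = net_meet[OF net]
  have card_p: "card (\<pi> ` A) = card A" if "A \<subseteq> points I" for A
    using inj_p that by (intro card_image) (rule inj_on_subset)
  have inj_c: "inj_on (image \<beta>) (par_classes I)"
    using inj_on_image_eq_iff[OF inj_b net_class_subset[OF net] net_class_subset[OF net]] by (intro inj_onI) simp
  have part: "partition_on (\<beta> ` blocks I) (image \<beta> ` par_classes I)"
  proof (rule partition_onI)
    show "\<Union>(image \<beta> ` par_classes I) = \<beta> ` blocks I"
      using P(6) by (auto simp: partition_on_def)
    show "{} \<notin> image \<beta> ` par_classes I"
      using P(6) by (auto simp: partition_on_def)
    show "disjnt p q" if pq: "p \<in> image \<beta> ` par_classes I" "q \<in> image \<beta> ` par_classes I" "p \<noteq> q" for p q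
    proof -
      obtain C D where CD: "C \<in> par_classes I" "D \<in> par_classes I" "p = \<beta> ` C" "q = \<beta> ` D"
        using pq by blast
      then have "C \<noteq> D" using pq(3) by blast
      then have "C \<inter> D = {}"
        using disjointD[OF partition_onD2[OF P(6)] CD(1,2)] by blast
      then show ?thesis
        using inj_on_image_Int[OF inj_b net_class_subset[OF net CD(1)] net_class_subset[OF net CD(2)]] CD
        by (simp add: disjnt_def)
    qed
  qed
  have on': "card {p \<in> \<pi> ` points I. (p, l) \<in> map_prod \<pi> \<beta> ` incid I} = n" if "l \<in> \<beta> ` blocks I" for l
  proof -
    obtain m where m: "m \<in> blocks I" "l = \<beta> m" using \<open>l \<in> \<beta> ` blocks I\<close> by blast
    then have "{p \<in> \<pi> ` points I. (p, l) \<in> map_prod \<pi> \<beta> ` incid I} = \<pi> ` {p \<in> points I. (p, m) \<in> incid I}"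
      unfolding m(2) image_Collect_conj
      by (intro arg_cong[where f = "image \<pi>"]) (simp add: incid_map_iff m(1) cong: conj_cong)
    then show ?thesis using on[OF m(1)] card_p by simp
  qed
  have one': "\<exists>!l. l \<in> \<beta> ` C \<and> (\<pi> p, l) \<in> map_prod \<pi> \<beta> ` incid I"
    if C: "C \<in> par_classes I" and p: "p \<in> points I" for C p
  proof -
    obtain l where l: "l \<in> C" "(p, l) \<in> incid I" using one[OF C p] by blast
    show ?thesis
    proof (rule ex1I[of _ "\<beta> l"])
      show "\<beta> l \<in> \<beta> ` C \<and> (\<pi> p, \<beta> l) \<in> map_prod \<pi> \<beta> ` incid I" using l by force
      fix m assume m: "m \<in> \<beta> ` C \<and> (\<pi> p, m) \<in> map_prod \<pi> \<beta> ` incid I"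
      obtain m' where m': "m = \<beta> m'" "m' \<in> C" using conjunct1[OF m] by (rule imageE)
      have "m' \<in> blocks I" using m'(2) net_class_subset[OF net C] by blast
      then have "(p, m') \<in> incid I" using conjunct2[OF m] incid_map_iff[OF p] m'(1) by simp
      then show "m = \<beta> l" using one[OF C p] l m' by blast
    qed
  qed
  have meet': "card {p \<in> \<pi> ` points I. (p, \<beta> l) \<in> map_prod \<pi> \<beta> ` incid I
        \<and> (p, \<beta> m) \<in> map_prod \<pi> \<beta> ` incid I} = 1"
    if CD: "C \<in> par_classes I" "D \<in> par_classes I" "C \<noteq> D" and lm: "l \<in> C" "m \<in> D" for C D l m
  proof -
    have "l \<in> blocks I" "m \<in> blocks I" using net_class_subset[OF net] CD lm by blast+
    then have "{p \<in> \<pi> ` points I. (p, \<beta> l) \<in> map_prod \<pi> \<beta> ` incid I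
        \<and> (p, \<beta> m) \<in> map_prod \<pi> \<beta> ` incid I}
        = \<pi> ` {p \<in> points I. (p, l) \<in> incid I \<and> (p, m) \<in> incid I}"
      unfolding image_Collect_conj
      by (intro arg_cong[where f = "image \<pi>"]) (simp add: incid_map_iff cong: conj_cong)
    then show ?thesis using meet[OF CD lm] card_p by simp
  qed
  have size': "card (\<beta> ` C) = n" if "C \<in> par_classes I" for C
    using size[OF that] inj_on_subset[OF inj_b net_class_subset[OF net that]] by (simp add: card_image)
  have sub': "map_prod \<pi> \<beta> ` incid I \<subseteq> \<pi> ` points I \<times> \<beta> ` blocks I"
    using P(5) by auto
  have "\<forall>C\<in>image \<beta> ` par_classes I. \<forall>D\<in>image \<beta> ` par_classes I. C \<noteq> D \<longrightarrow> (\<forall>l\<in>C. \<forall>m\<in>D.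
      card {p \<in> \<pi> ` points I. (p, l) \<in> map_prod \<pi> \<beta> ` incid I \<and> (p, m) \<in> map_prod \<pi> \<beta> ` incid I} = 1)"
    unfolding ball_simps(9)
  proof (intro ballI impI)
    fix C D l m
    assume "C \<in> par_classes I" "D \<in> par_classes I" "\<beta> ` C \<noteq> \<beta> ` D" "l \<in> C" "m \<in> D"
    then show "card {p \<in> \<pi> ` points I. (p, \<beta> l) \<in> map_prod \<pi> \<beta> ` incid I
        \<and> (p, \<beta> m) \<in> map_prod \<pi> \<beta> ` incid I} = 1"
      by (intro meet'[of C D]) auto
  qed
  moreover have "\<forall>C\<in>image \<beta> ` par_classes I. \<forall>p\<in>\<pi> ` points I.
      \<exists>!l. l \<in> C \<and> (p, l) \<in> map_prod \<pi> \<beta> ` incid I"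
    unfolding ball_simps(9) by (intro ballI one')
  ultimately show ?thesis
    unfolding net_def map_net_simps
    using P(1-4,7) card_p[of "points I"] card_image[OF inj_b] card_image[OF inj_c]
      part on' size' sub' by simp
qed

lemma collinearity_graph_map:
  "graph_isomorphism \<pi> (collinearity_graph I) (collinearity_graph (map_net \<pi> \<beta> I))"
proof -
  have "\<pi> p = \<pi> q \<longleftrightarrow> p = q" if "p \<in> points I" "q \<in> points I" for p q
    using inj_p that by (auto dest: inj_onD)
  then show ?thesis
    unfolding graph_isomorphism_def collinearity_graph_def
    using inj_p by (simp add: bij_betw_def incid_map_iff)
qed

end

lemma glued_graph_map:
  fixes I :: "('p, 'l) net_structure"
  assumes inj: "inj_on g (scheme_pts H)"
    and F: "scheme_rel H 0 \<union> scheme_rel H 3 \<subseteq> scheme_pts H \<times> scheme_pts H"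
    and B: "scheme_rel H 1 \<subseteq> scheme_pts H \<times> scheme_pts H"
    and net: "net k n I" and inj_p: "inj_on \<pi> (points I)" and inj_b: "inj_on \<beta> (blocks I)"
    and \<phi>: "\<And>W. W \<in> fibres H \<Longrightarrow> \<phi> W \<in> points I"
    and \<phi>': "\<And>W. W \<in> fibres H \<Longrightarrow> \<phi>' (g ` W) = \<pi> (\<phi> W)"
  shows "graph_isomorphism (map_gvertex \<beta> g) (glued_graph H I \<phi>)
           (glued_graph (map_scheme g H) (map_net \<pi> \<beta> I) \<phi>')"
    (is "graph_isomorphism ?f ?G ?G'")
proof -
  note incid_map_iff = incid_map_iff[OF net inj_p inj_b]
    and parallel_map_iff = parallel_map_iff[OF net inj_p inj_b]
  have beta: "\<beta> l = \<beta> m \<longleftrightarrow> l = m" if "l \<in> blocks I" "m \<in> blocks I" for l m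
    using inj_b that by (auto dest: inj_onD)
  have bij: "bij_betw ?f (pverts ?G) (pverts ?G')"
    unfolding bij_betw_def
  proof
    show "inj_on ?f (pverts ?G)"
      using inj inj_b by (auto simp: inj_on_def glued_graph_verts)
    show "?f ` pverts ?G = pverts ?G'"
      by (simp add: glued_graph_verts image_Un image_image)
  qed
  have fib: "(\<exists>W'\<in>fibres (map_scheme g H). g x \<in> W' \<and> (\<phi>' W', \<beta> l) \<in> map_prod \<pi> \<beta> ` incid I)
      \<longleftrightarrow> (\<exists>W\<in>fibres H. x \<in> W \<and> (\<phi> W, l) \<in> incid I)"
    if "x \<in> scheme_pts H" "l \<in> blocks I" for x l
  proof -
    have "g x \<in> g ` W \<and> (\<phi>' (g ` W), \<beta> l) \<in> map_prod \<pi> \<beta> ` incid I \<longleftrightarrow> x \<in> W \<and> (\<phi> W, l) \<in> incid I"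
      if W: "W \<in> fibres H" for W
      using inj_on_image_mem_iff[OF inj \<open>x \<in> scheme_pts H\<close> fibres_subset[OF F W]]
        incid_map_iff[OF \<phi>[OF W] \<open>l \<in> blocks I\<close>] \<phi>'[OF W] by simp
    then show ?thesis unfolding fibres_map[OF inj F] by simp
  qed
  have "(u, w) \<in> parcs ?G \<longleftrightarrow> (?f u, ?f w) \<in> parcs ?G'" if "u \<in> pverts ?G" "w \<in> pverts ?G" for u w
    using that
    by (cases u; cases w)
      (simp_all add: glued_graph_verts_iff glued_graph_arcs parallel_map_iff beta fib
        map_prod_image_iff[OF inj B] del: One_nat_def)
  then show ?thesis unfolding graph_isomorphism_def using bij by blast
qed

text \<open>
  Finite sets embed into any infinite type, so a glued graph can be rebuilt over the required types.
\<close>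

lemma glued_graph_transfer:
  fixes H :: "'a scheme" and I :: "('b, 'c) net_structure"
  assumes H: "scheme_with_eigenmatrix_P s t H" and net: "net (t + 1) s I"
    and iso: "graph_isomorphism \<phi> (quotient_graph H) (collinearity_graph I)"
  shows "\<exists>(H' :: 'h::infinite scheme) (I' :: ('p::infinite, 'l::infinite) net_structure) \<phi>' f.
    scheme_with_eigenmatrix_P s t H' \<and> net (t + 1) s I' \<and>
    graph_isomorphism \<phi>' (quotient_graph H') (collinearity_graph I') \<and>
    graph_isomorphism f (glued_graph H I \<phi>) (glued_graph H' I' \<phi>')"
proof -
  have A: "assoc_scheme H" and d: "3 \<le> num_classes H"
    using H by (auto simp: scheme_with_eigenmatrix_P_def)
  have F: "scheme_rel H 0 \<union> scheme_rel H 3 \<subseteq> scheme_pts H \<times> scheme_pts H"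
    using assoc_scheme_subset[OF A, of 0] assoc_scheme_subset[OF A, of 3] d by simp
  have B: "scheme_rel H 1 \<subseteq> scheme_pts H \<times> scheme_pts H"
    using assoc_scheme_subset[OF A, of 1] d by simp
  obtain g :: "'a \<Rightarrow> 'h" where g: "inj_on g (scheme_pts H)"
    using arb_inj_on_finite_infinite[OF assoc_scheme_finite[OF A]] by blast
  obtain \<pi> :: "'b \<Rightarrow> 'p" where \<pi>: "inj_on \<pi> (points I)"
    using arb_inj_on_finite_infinite[OF net_finite_points[OF net]] by blast
  obtain \<beta> :: "'c \<Rightarrow> 'l" where \<beta>: "inj_on \<beta> (blocks I)"
    using arb_inj_on_finite_infinite[OF net_finite_blocks[OF net]] by blast
  let ?H = "map_scheme g H" and ?I = "map_net \<pi> \<beta> I"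
  \<comment> \<open>Images of fibres are pulled back to fibres before \<open>\<phi>\<close> is applied.\<close>
  define q where "q = inv_into (pverts (quotient_graph H)) (image g)"
  define \<phi>' where "\<phi>' = \<pi> \<circ> (\<phi> \<circ> q)"
  note qi = quotient_graph_map[OF g F B]
  have "graph_isomorphism q (quotient_graph ?H) (quotient_graph H)"
    unfolding q_def by (rule graph_isomorphism_inv[OF qi])
  then have iso': "graph_isomorphism \<phi>' (quotient_graph ?H) (collinearity_graph ?I)"
    unfolding \<phi>'_def
    by (intro graph_isomorphism_comp[OF _ collinearity_graph_map[OF net \<pi> \<beta>]]
        graph_isomorphism_comp[OF _ iso])
  have verts: "pverts (quotient_graph H) = fibres H" "pverts (collinearity_graph I) = points I"
    by (simp_all add: quotient_graph_def collinearity_graph_def)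
  have inj: "inj_on (image g) (fibres H)"
    using qi by (simp add: graph_isomorphism_def bij_betw_def verts)
  have "\<phi>' (g ` W) = \<pi> (\<phi> W)" if "W \<in> fibres H" for W
    using inv_into_f_f[OF inj that] by (simp add: \<phi>'_def q_def verts)
  moreover have "\<phi> W \<in> points I" if "W \<in> fibres H" for W
    using iso that unfolding graph_isomorphism_def verts by (auto dest: bij_betwE)
  ultimately have "graph_isomorphism (map_gvertex \<beta> g) (glued_graph H I \<phi>) (glued_graph ?H ?I \<phi>')"
    by (intro glued_graph_map[OF g F B net \<pi> \<beta>]) simp_all
  then show ?thesis
    using scheme_with_eigenmatrix_P_map[OF g H] net_map[OF net \<pi> \<beta>] iso' by blast
qed

section \<open>Regular points and glued graphs\<close>

text \<open>
  The regular point is the vertex that corresponds to the apex: its second subconstituent is a copy of the first relation,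
  which generates the correspondingly relabelled scheme.
\<close>

lemma glued_graph_imp_regular_point:
  fixes G :: "'v pair_pre_digraph"
  assumes st: "2 \<le> t" "t \<le> s" and G: "pair_graph G"
    and H: "scheme_with_eigenmatrix_P s t H" and net: "net (t + 1) s I"
    and iso: "graph_isomorphism \<phi> (quotient_graph H) (collinearity_graph I)"
    and f: "graph_isomorphism f G (glued_graph H I \<phi>)"
  shows "strongly_regular G ((t * s + 1) * (s + 1)) ((t + 1) * s) (s - 1) (t + 1)"
    and "\<exists>v. regular_point s t G v"
proof -
  interpret K: net_gluing s t H I \<phi>
    using st H net iso by unfold_locales
  show srg: "strongly_regular G ((t * s + 1) * (s + 1)) ((t + 1) * s) (s - 1) (t + 1)"
    by (rule strongly_regular_isomorphic[OF f G K.glued_graph_strongly_regular])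
  define h where "h = inv_into (pverts G) f"
  have h: "graph_isomorphism h K.G G" unfolding h_def by (rule graph_isomorphism_inv[OF f])
  have img: "h ` pverts K.G = pverts G" and inj: "inj_on h (pverts K.G)"
    and arc: "\<And>a b. a \<in> pverts K.G \<Longrightarrow> b \<in> pverts K.G \<Longrightarrow>
      (a, b) \<in> parcs K.G \<longleftrightarrow> (h a, h b) \<in> parcs G"
    using h by (auto simp: graph_isomorphism_def bij_betw_def)
  define v where "v = h Apex"
  define g where "g = h \<circ> SVertex"
  have Apex: "Apex \<in> pverts K.G" by (simp add: glued_graph_verts_iff)
  have v: "v \<in> pverts G" using img Apex unfolding v_def by blast
  have g_in: "SVertex ` scheme_pts H \<subseteq> pverts K.G" by (auto simp: glued_graph_verts_iff)
  have inj_g: "inj_on g (scheme_pts H)"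
    unfolding g_def by (intro comp_inj_on inj_on_subset[OF inj g_in]) (simp add: inj_on_def)
  let ?X = "pverts G - {v} - neighbours G v"
  have X: "?X = g ` scheme_pts H"
  proof -
    have "neighbours G v = h ` (Block ` blocks I)"
      using graph_isomorphism_neighbours[OF h Apex] K.neighbours_Apex unfolding v_def by simp
    then have "?X = h ` pverts K.G - h ` {Apex} - h ` (Block ` blocks I)"
      unfolding img v_def by simp
    also have "\<dots> = h ` (pverts K.G - {Apex} - Block ` blocks I)"
    proof -
      have "{Apex} \<subseteq> pverts K.G" "Block ` blocks I \<subseteq> pverts K.G"
        by (auto simp: glued_graph_verts)
      then have "h ` (pverts K.G - {Apex}) = h ` pverts K.G - h ` {Apex}"
        "h ` (pverts K.G - {Apex} - Block ` blocks I)
          = h ` (pverts K.G - {Apex}) - h ` (Block ` blocks I)"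
        by (intro inj_on_image_set_diff[OF inj]; blast)+
      then show ?thesis by (simp only:)
    qed
    also have "pverts K.G - {Apex} - Block ` blocks I = SVertex ` scheme_pts H"
      by (auto simp: glued_graph_verts)
    finally show ?thesis by (simp add: g_def image_comp)
  qed
  have rel: "parcs G \<inter> ?X \<times> ?X = map_prod g g ` scheme_rel H 1"
  proof -
    have garc: "(g x, g y) \<in> parcs G \<longleftrightarrow> (x, y) \<in> scheme_rel H 1"
      if "x \<in> scheme_pts H" "y \<in> scheme_pts H" for x y
      using arc[of "SVertex x" "SVertex y"] that K.B_commute[of x y]
      by (simp add: glued_graph_verts_iff glued_graph_arcs g_def)
    show ?thesis
    proof (intro equalityI subsetI)
      fix e assume "e \<in> parcs G \<inter> ?X \<times> ?X"
      then have e: "e \<in> parcs G" "e \<in> (g ` scheme_pts H) \<times> (g ` scheme_pts H)" unfolding X by simp_all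
      then obtain x y where xy: "e = (g x, g y)" "x \<in> scheme_pts H" "y \<in> scheme_pts H" by blast
      then have "(x, y) \<in> scheme_rel H 1" using e(1) garc by simp
      then show "e \<in> map_prod g g ` scheme_rel H 1" using xy(1) by force
    next
      fix e assume "e \<in> map_prod g g ` scheme_rel H 1"
      then obtain d where d: "e = map_prod g g d" "d \<in> scheme_rel H 1" by (rule imageE)
      obtain x y where xy: "d = (x, y)" by (cases d)
      have "x \<in> scheme_pts H" "y \<in> scheme_pts H" using K.B_subset d(2) xy by auto
      then show "e \<in> parcs G \<inter> ?X \<times> ?X" unfolding X using d xy garc by simp
    qed
  qed
  have sub: "subconstituent G 2 v = pair_induced G ?X"
    by (rule second_subconstituent_strongly_regular[OF srg _ v]) simp
  let ?H = "map_scheme g H"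
  have H': "scheme_with_eigenmatrix_P s t ?H"
    by (rule scheme_with_eigenmatrix_P_map[OF inj_g H])
  have pts': "pverts (subconstituent G 2 v) = scheme_pts ?H"
    unfolding sub by (simp add: pair_induced_def X)
  have rel': "parcs (subconstituent G 2 v) = scheme_rel ?H 1"
    unfolding sub map_scheme_simps rel[symmetric] by (simp add: pair_induced_def)
  have "generates_scheme (subconstituent G 2 v) ?H"
    by (rule scheme_generated_by_first_relation[OF st H' pts' rel'])
  then show "\<exists>v. regular_point s t G v"
    unfolding regular_point_def using v H' rel' by (intro exI[of _ v] conjI exI[of _ ?H]) simp_all
qed

theorem theorem3p5:
  fixes \<Gamma> :: "'v pair_pre_digraph" and s t :: nat
  assumes "2 \<le> t" and "t \<le> s"
    and "pair_graph \<Gamma>"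
  shows "strongly_regular \<Gamma> ((t * s + 1) * (s + 1)) ((t + 1) * s) (s - 1) (t + 1) \<and>
           (\<exists>v. regular_point s t \<Gamma> v)
         \<longleftrightarrow>
         (\<exists>(H :: 'h::infinite scheme) (I :: ('p::infinite, 'l::infinite) net_structure) \<phi>.
            scheme_with_eigenmatrix_P s t H \<and>
            net (t + 1) s I \<and>
            graph_isomorphism \<phi> (quotient_graph H) (collinearity_graph I) \<and>
            (\<exists>f. graph_isomorphism f \<Gamma> (glued_graph H I \<phi>)))"
  (is "?L \<longleftrightarrow> ?R")
proof
  assume ?L
  then obtain v where srg: "strongly_regular \<Gamma> ((t * s + 1) * (s + 1)) ((t + 1) * s) (s - 1) (t + 1)"
    and "regular_point s t \<Gamma> v" by blast
  from regular_point_imp_glued_graph[OF assms(1,2) this]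
  obtain H :: "'v scheme" and I :: "('v set, 'v) net_structure" and f
    where HI: "scheme_with_eigenmatrix_P s t H" "net (t + 1) s I"
      "graph_isomorphism (\<lambda>W. W) (quotient_graph H) (collinearity_graph I)"
      and f: "graph_isomorphism f \<Gamma> (glued_graph H I (\<lambda>W. W))" by blast
  from glued_graph_transfer[OF HI]
  obtain H' :: "'h scheme" and I' :: "('p, 'l) net_structure" and \<phi>' f'
    where "scheme_with_eigenmatrix_P s t H'" "net (t + 1) s I'"
      "graph_isomorphism \<phi>' (quotient_graph H') (collinearity_graph I')"
      and "graph_isomorphism f' (glued_graph H I (\<lambda>W. W)) (glued_graph H' I' \<phi>')" by blast
  moreover from this(4) have "graph_isomorphism (f' \<circ> f) \<Gamma> (glued_graph H' I' \<phi>')"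
    by (rule graph_isomorphism_comp[OF f])
  ultimately show ?R by blast
next
  assume ?R
  then obtain H :: "'h scheme" and I :: "('p, 'l) net_structure" and \<phi> f
    where "scheme_with_eigenmatrix_P s t H" "net (t + 1) s I"
      "graph_isomorphism \<phi> (quotient_graph H) (collinearity_graph I)"
      "graph_isomorphism f \<Gamma> (glued_graph H I \<phi>)" by blast
  from glued_graph_imp_regular_point[OF assms this] show ?L by blast
qed

end
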